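(* Let $m,n\ge 0$ and $k\ge 1$ be integers with $m+n\ge 1$, and let $\boldsymbol z=(z_1,\dots,z_k)\in\mathbb C^k$ and $\boldsymbol\Lambda=(\Lambda_1,\dots,\Lambda_{m+n})\in\mathbb C^{m+n}$ be arbitrary sequences of complex numbers. With the superalgebra $\mathcal D$, the homomorphisms $\hat\pi_{m|n}:U\mathfrak{gl}_{m|n}[t]\to\mathcal D$ and $\hat\pi_k:U\mathfrak{gl}_k[t]\to\mathcal D$, the matrices $B(\boldsymbol\Lambda)$, $G(\boldsymbol z)$ and the Bethe algebras $\mathfrak B_{m|n}(\boldsymbol\Lambda)\subset U\mathfrak{gl}_{m|n}[t]$, $\mathfrak B_k(\boldsymbol z)\subset U\mathfrak{gl}_k[t]$ defined in the context: The subalgebras $\hat\pi_k\big(\mathfrak B_k(\boldsymbol z)\big)$ and $\hat\pi_{m|n}\big(\mathfrak B_{m|n}(\boldsymbol\Lambda)\big)$ of $\mathcal D$ coincide. Moreover, the generators are identified as follows. If $b_{r,s}(\boldsymbol z,\boldsymbol\Lambda),\ g_{r,s}(\boldsymbol\Lambda,\boldsymbol z)\in\mathcal D$ (not depending on $v,\partial_v,u,\partial_u$) are such that $$(v-z_1)\cdots(v-z_k)\ \hat\pi_{m|n}\,\mathrm{Ber}\,B(\boldsymbol\Lambda)=\sum_{r=0}^{k}\ \sum_{s=-\infty}^{m-n}b_{r,s}(\boldsymbol z,\boldsymbol\Lambda)\,v^r\partial_v^{s},$$ $$\frac{(u-\Lambda_1)\cdots(u-\Lambda_m)}{(u-\Lambda_{m+1})\cdots(u-\Lambda_{m+n})}\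 \hat\pi_{k}\,\mathrm{cdet}\,G(\boldsymbol z)=\sum_{r=-\infty}^{m-n}\ \sum_{s=0}^k g_{r,s}(\boldsymbol\Lambda,\boldsymbol z)\,u^{r}\partial_u^s,$$ then $$b_{r,s}(\boldsymbol z,\boldsymbol\Lambda)=g_{s,r}(\boldsymbol\Lambda,\boldsymbol z)$$ for all $0\le r\le k$ and all integers $s\le m-n$.
   Context: Everything is over $\mathbb C$; a superalgebra is a $\mathbb Z_2$-graded associative unital algebra, and $[a,b]=ab-(-1)^{\bar a\bar b}ba$ for homogeneous $a,b$ of parities $\bar a,\bar b$. Put $\bar i=\bar 0$ for $1\le i\le m$ and $\bar i=\bar 1$ for $m+1\le i\le m+n$. Lie superalgebras: $\mathfrak{gl}_{m|n}$ has basis $e_{i,j}=e^{[m|n]}_{i,j}$, $1\le i,j\le m+n$, of parity $\bar i+\bar j$, with $[e_{i,j},e_{p,q}]=\delta_{j,p}e_{i,q}-(-1)^{(\bar i+\bar j)(\bar p+\bar q)}\delta_{i,q}e_{p,j}$. The Lie algebra $\mathfrak{gl}_k=\mathfrak{gl}_{k|0}$ has basis $e^{[k]}_{a,b}$. The current algebra $\mathfrak{gl}_{m|n}[t]=\mathfrak{gl}_{m|n}\otimes\mathbb C[t]$ has pointwise superbracket, and $e_{i,j}(v)=\sum_{r\ge0}(e_{i,j}\otimes t^r)v^{-r-1}$; similarly for $\mathfrak{gl}_k[t]$ with variable $u$. The algebra $\mathcal D$: the superalgebra generated by $x_{i,a},\partial_{i,a}$, $1\le i\le m+n$, $1\le a\le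 k$, with parities $\bar x_{i,a}=\bar\partial_{i,a}=\bar i$ and relations (supercommutators) $[x_{i,a},x_{j,b}]=[\partial_{i,a},\partial_{j,b}]=0$, $[\partial_{i,a},x_{j,b}]=\delta_{i,j}\delta_{a,b}$. It acts on the space of supersymmetric polynomials $V$, the subalgebra generated by all the $x_{i,a}$. Homomorphisms (fractions expanded in powers of $v^{-1}$, resp. $u^{-1}$): $$\hat\pi_{m|n}:\ e^{[m|n]}_{i,j}(v)\mapsto\sum_{a=1}^k\frac{x_{i,a}\partial_{j,a}}{v-z_a},\qquad \hat\pi_k:\ e^{[k]}_{a,b}(u)\mapsto\sum_{i=1}^{m+n}\frac{x_{i,a}\partial_{i,b}}{u-\Lambda_i}.$$ They are extended coefficientwise to pseudodifferential operators below. Pseudodifferential operators: for a superalgebra $\mathcal A$ with even derivation $\partial$, $\mathcal A((\partial^{-1}))$ is the algebra of series $\sum_{r\le N}a_r\partial^r$, $a_r\in\mathcal A$, with $\partial^r a=\sum_{s\ge0}\binom rs a_{(s)}\partial^{r-s}$ for $r\in\mathbb Z$, where $a_{(s)}$ is the $s$-th derivative of $a$. Let $\mathcal A_v^{m|n}=U\mathfrak{gl}_{m|n}[t]((v^{-1}))$ with derivation $\partial_v=d/dv$, and similarly $\mathcal A_u^{k}=U\mathfrak{gl}_k[t]((u^{-1}))$ with derivation $\partial_u=d/du$. Matrices: $$B(\boldsymbol\Lambda)=\Big(\delta_{i,j}(\partial_v-\Lambda_i)-(-1)^{\bar i}e^{[m|n]}_{i,j}(v)\Big)_{i,j=1}^{m+n}\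 \text{ over }\mathcal A_v^{m|n}((\partial_v^{-1})),\qquad G(\boldsymbol z)=\Big(\delta_{a,b}(\partial_u-z_a)-e^{[k]}_{a,b}(u)\Big)_{a,b=1}^{k}\ \text{ over }\mathcal A_u^{k}((\partial_u^{-1})).$$ Column determinant: $\mathrm{cdet}\,G=\sum_{\sigma\in\mathfrak S_k}\mathrm{sgn}(\sigma)\,G_{\sigma(1),1}\cdots G_{\sigma(k),k}$. Berezinian: for a matrix $A$, let the $i$-th principal quasi-minor $d_i(A)$ be the inverse of the $(i,i)$ entry of the inverse of the top-left $i\times i$ submatrix of $A$. Then $\mathrm{Ber}\,B(\boldsymbol\Lambda)=d_1\cdots d_m\,d_{m+1}^{-1}\cdots d_{m+n}^{-1}$ with $d_i=d_i(B(\boldsymbol\Lambda))$ (all of these are well defined in $\mathcal A_v^{m|n}((\partial_v^{-1}))$). Bethe algebras: write $\mathrm{Ber}\,B(\boldsymbol\Lambda)=\sum_{r\le m-n}B_r^{\boldsymbol\Lambda}(v)\partial_v^r$ with $B_r^{\boldsymbol\Lambda}(v)\in U\mathfrak{gl}_{m|n}[t]((v^{-1}))$; $\mathfrak B_{m|n}(\boldsymbol\Lambda)$ is the unital subalgebra of $U\mathfrak{gl}_{m|n}[t]$ generated by all coefficients (of powers of $v$) of all the series $B_r^{\boldsymbol\Lambda}(v)$. Similarly, writing $\mathrm{cdet}\,G(\boldsymbol z)=\sum_{s=0}^kG_s^{\boldsymbol z}(u)\partial_u^s$, $\mathfrak B_k(\boldsymbol z)$ is the unital subalgebra of $U\mathfrak{gl}_k[t]$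 generated by all coefficients of the series $G_s^{\boldsymbol z}(u)$. The rational prefactor in $u$ is expanded as a Laurent series in $u^{-1}$. *)

theory Defs
  imports
    "HOL-Library.Poly_Mapping"
    "HOL-Library.Numeral_Type"
    "HOL-Library.Nat_Bijection"
    "HOL-Computational_Algebra.Formal_Laurent_Series"
    "HOL-Combinatorics.Permutations"
    "Jordan_Normal_Form.Matrix"
begin

class complex_algebra = ring_1 +
  fixes cscale :: "complex \<Rightarrow> 'a \<Rightarrow> 'a"  (infixr \<open>*\<^sub>C\<close> 75)
  assumes cscale_add_right: "c *\<^sub>C (x + y) = c *\<^sub>C x + c *\<^sub>C y"
    and cscale_add_left: "(c + d) *\<^sub>C x = c *\<^sub>C x + d *\<^sub>C x"
    and cscale_cscale: "c *\<^sub>C (d *\<^sub>C x) = (c * d) *\<^sub>C x"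
    and cscale_one: "1 *\<^sub>C x = x"
    and mult_cscale_left: "(c *\<^sub>C x) * y = c *\<^sub>C (x * y)"
    and mult_cscale_right: "x * (c *\<^sub>C y) = c *\<^sub>C (x * y)"

definition of_cx :: "complex \<Rightarrow> 'a::complex_algebra"
  where "of_cx c = c *\<^sub>C 1"

definition calg_hom :: "('a::complex_algebra \<Rightarrow> 'b::complex_algebra) \<Rightarrow> bool"
  where "calg_hom f \<longleftrightarrow> f 1 = 1 \<and> (\<forall>x y. f (x + y) = f x + f y)
    \<and> (\<forall>x y. f (x * y) = f x * f y) \<and> (\<forall>c x. f (c *\<^sub>C x) = c *\<^sub>C f x)"

inductive_set unital_subalgebra :: "'a::complex_algebra set \<Rightarrow> 'a set" for S where
  gen: "x \<in> S \<Longrightarrow> x \<in> unital_subalgebra S"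
| one: "1 \<in> unital_subalgebra S"
| add: "x \<in> unital_subalgebra S \<Longrightarrow> y \<in> unital_subalgebra S \<Longrightarrow> x + y \<in> unital_subalgebra S"
| mult: "x \<in> unital_subalgebra S \<Longrightarrow> y \<in> unital_subalgebra S \<Longrightarrow> x * y \<in> unital_subalgebra S"
| scale: "x \<in> unital_subalgebra S \<Longrightarrow> c *\<^sub>C x \<in> unital_subalgebra S"

lemma cscale_zero_right [simp]: "c *\<^sub>C (0::'a::complex_algebra) = 0"
  using cscale_add_right[of c 0 "0::'a"] by simp

lemma cscale_zero_left [simp]: "0 *\<^sub>C (x::'a::complex_algebra) = 0"
  using cscale_add_left[of 0 0 x] by simp

lemma cscale_minus_left: "(- c) *\<^sub>C (x::'a::complex_algebra) = - (c *\<^sub>C x)"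
  using cscale_add_left[of "- c" c x] by (simp add: eq_neg_iff_add_eq_0)

lemma cscale_minus_right: "c *\<^sub>C (- x :: 'a::complex_algebra) = - (c *\<^sub>C x)"
  using cscale_add_right[of c "- x" x] by (simp add: eq_neg_iff_add_eq_0)

lemma cscale_diff_right: "c *\<^sub>C (x - y :: 'a::complex_algebra) = c *\<^sub>C x - c *\<^sub>C y"
  using cscale_add_right[of c x "- y"] by (simp add: cscale_minus_right)

lemma cscale_sum_right: "c *\<^sub>C (\<Sum>i\<in>A. f i :: 'a::complex_algebra) = (\<Sum>i\<in>A. c *\<^sub>C f i)"
  by (induction A rule: infinite_finite_induct) (simp_all add: cscale_add_right)

lemma of_cx_simps [simp]: "of_cx 0 = 0" "of_cx 1 = 1"
  by (simp_all add: of_cx_def cscale_one)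

text \<open>The free monoid, written additively so that the type of finitely supported functions on it
  carries the convolution product of the free associative algebra.\<close>

datatype 'g fword = FWord (letters: "'g list")

instantiation fword :: (type) monoid_add
begin

definition zero_fword :: "'a fword" where "0 = FWord []"
definition plus_fword :: "'a fword \<Rightarrow> 'a fword \<Rightarrow> 'a fword"
  where "v + w = FWord (letters v @ letters w)"

instance by standard (simp_all add: zero_fword_def plus_fword_def)

end

type_synonym 'g free_alg = "'g fword \<Rightarrow>\<^sub>0 complex"

definition free_gen :: "'g \<Rightarrow> 'g free_alg"
  where "free_gen x = Poly_Mapping.single (FWord [x]) 1"

definition free_const :: "complex \<Rightarrow> 'g free_alg"
  where "free_const c = Poly_Mapping.single 0 c"

lemma poly_mapping_induct [case_names zero add]:
  fixes p :: "'k \<Rightarrow>\<^sub>0 'v::ab_group_add"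
  assumes "P 0" and "\<And>k v p. P p \<Longrightarrow> P (Poly_Mapping.single k v + p)"
  shows "P p"
proof (induction p rule: update_induct)
  case const
  then show ?case using assms(1) .
next
  case (update f a b)
  have "Poly_Mapping.update a b f = Poly_Mapping.single a b + f"
    by (rule poly_mapping_eqI)
      (use update in \<open>auto simp: lookup_update lookup_add lookup_single in_keys_iff when_def\<close>)
  then show ?case using assms(2)[OF update(3)] by simp
qed

lemma free_const_central: "p * free_const c = free_const c * (p :: 'g free_alg)"
proof (induction p rule: poly_mapping_induct)
  case zero
  then show ?case by simp
next
  case (add k v p)
  then show ?case
    by (simp add: distrib_left distrib_right free_const_def mult_single mult.commute)
qed

definition free_lift :: "('g \<Rightarrow> 'a::complex_algebra) \<Rightarrow> 'g free_alg \<Rightarrow> 'a"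
  where "free_lift f p =
    (\<Sum>w\<in>Poly_Mapping.keys p. Poly_Mapping.lookup p w *\<^sub>C prod_list (map f (letters w)))"

lemma free_lift_single: "free_lift f (Poly_Mapping.single w c) = c *\<^sub>C prod_list (map f (letters w))"
  by (cases "c = 0") (simp_all add: free_lift_def)

lemma free_lift_zero [simp]: "free_lift f 0 = 0"
  by (simp add: free_lift_def)

lemma free_lift_add [simp]: "free_lift f (p + q) = free_lift f p + free_lift f q"
proof -
  have *: "free_lift f r =
      (\<Sum>w\<in>A. Poly_Mapping.lookup r w *\<^sub>C prod_list (map f (letters w)))"
    if "finite A" "Poly_Mapping.keys r \<subseteq> A" for r and A
    unfolding free_lift_def by (rule sum.mono_neutral_left) (use that in \<open>auto simp: in_keys_iff\<close>)
  let ?A = "Poly_Mapping.keys p \<union> Poly_Mapping.keys q"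
  have "Poly_Mapping.keys (p + q) \<subseteq> ?A" by (rule Poly_Mapping.keys_add)
  then show ?thesis
    by (simp add: *[of ?A] lookup_add cscale_add_left sum.distrib)
qed

lemma free_lift_mult [simp]: "free_lift f (p * q) = free_lift f p * free_lift f q"
proof (induction p rule: poly_mapping_induct)
  case (add k v p)
  have "free_lift f (Poly_Mapping.single k v * q) = free_lift f (Poly_Mapping.single k v) * free_lift f q"
    by (induction q rule: poly_mapping_induct)
      (simp_all add: distrib_left mult_single free_lift_single plus_fword_def mult.commute[where ?'a = complex] mult_cscale_left
        mult_cscale_right cscale_cscale)
  then show ?case using add by (simp add: distrib_right)
qed simp

lemma free_lift_one [simp]: "free_lift f 1 = 1"
  by (simp add: free_lift_single zero_fword_def cscale_one flip: single_one)

lemma free_lift_gen [simp]: "free_lift f (free_gen x) = f x"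
  by (simp add: free_gen_def free_lift_single cscale_one)

lemma free_lift_const [simp]: "free_lift f (free_const c) = of_cx c"
  by (simp add: free_const_def free_lift_single zero_fword_def of_cx_def)

lemma free_lift_uminus [simp]: "free_lift f (- p) = - free_lift f p"
  using free_lift_add[of f p "- p"] by (simp add: eq_neg_iff_add_eq_0 add.commute)

lemma free_lift_diff [simp]: "free_lift f (p - q) = free_lift f p - free_lift f q"
  using free_lift_add[of f p "- q"] by simp

inductive_set two_sided_ideal :: "'r::ring_1 set \<Rightarrow> 'r set" for R where
  rel: "x \<in> R \<Longrightarrow> x \<in> two_sided_ideal R"
| zero: "0 \<in> two_sided_ideal R"
| add: "x \<in> two_sided_ideal R \<Longrightarrow> y \<in> two_sided_ideal R \<Longrightarrow> x + y \<in> two_sided_ideal R"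
| mult_left: "x \<in> two_sided_ideal R \<Longrightarrow> a * x \<in> two_sided_ideal R"
| mult_right: "x \<in> two_sided_ideal R \<Longrightarrow> x * a \<in> two_sided_ideal R"

lemma two_sided_ideal_minus: "x \<in> two_sided_ideal R \<Longrightarrow> - x \<in> two_sided_ideal R"
  using two_sided_ideal.mult_left[of x R "-1"] by simp

lemma two_sided_ideal_diff:
  "x \<in> two_sided_ideal R \<Longrightarrow> y \<in> two_sided_ideal R \<Longrightarrow> x - y \<in> two_sided_ideal R"
  using two_sided_ideal.add[OF _ two_sided_ideal_minus] by fastforce

lemma free_lift_ideal:
  assumes "\<And>r. r \<in> R \<Longrightarrow> free_lift f r = 0" and "p \<in> two_sided_ideal R"
  shows "free_lift f p = 0"
  using assms(2) by induction (simp_all add: assms(1))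

text \<open>A generator type determines the algebra \<open>'g presented_alg\<close> through its class instance. The
  class axiom only says that this algebra is not zero, as \<^class>\<open>ring_1\<close> requires.\<close>

class relations =
  fixes relators :: "'a free_alg set"
  assumes one_notin_relators_ideal: "1 \<notin> two_sided_ideal relators"

quotient_type (overloaded) 'g presented_alg = "'g::relations free_alg" /
  "\<lambda>x y. x - y \<in> two_sided_ideal relators"
proof (rule equivpI)
  let ?I = "two_sided_ideal relators :: 'g free_alg set"
  show "reflp (\<lambda>x y. x - y \<in> ?I)" by (simp add: reflp_def two_sided_ideal.zero)
  show "symp (\<lambda>x y. x - y \<in> ?I)"
    by (rule sympI) (metis minus_diff_eq two_sided_ideal_minus)
  show "transp (\<lambda>x y. x - y \<in> ?I)"
  proof (rule transpI)
    fix x y z :: "'g free_alg"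
    assume "x - y \<in> ?I" "y - z \<in> ?I"
    then have "(x - y) + (y - z) \<in> ?I" by (rule two_sided_ideal.add)
    then show "x - z \<in> ?I" by simp
  qed
qed

instantiation presented_alg :: (relations) complex_algebra
begin

lift_definition zero_presented_alg :: "'a presented_alg" is 0 .
lift_definition one_presented_alg :: "'a presented_alg" is 1 .
lift_definition plus_presented_alg :: "'a presented_alg \<Rightarrow> 'a presented_alg \<Rightarrow> 'a presented_alg"
  is "(+)"
proof -
  fix x x' y y' :: "'a free_alg"
  assume "x - x' \<in> two_sided_ideal relators" "y - y' \<in> two_sided_ideal relators"
  then have "(x - x') + (y - y') \<in> two_sided_ideal relators" by (rule two_sided_ideal.add)
  then show "(x + y) - (x' + y') \<in> two_sided_ideal relators" by (simp add: algebra_simps)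
qed
lift_definition minus_presented_alg :: "'a presented_alg \<Rightarrow> 'a presented_alg \<Rightarrow> 'a presented_alg"
  is "(-)"
proof -
  fix x x' y y' :: "'a free_alg"
  assume "x - x' \<in> two_sided_ideal relators" "y - y' \<in> two_sided_ideal relators"
  then have "(x - x') - (y - y') \<in> two_sided_ideal relators" by (rule two_sided_ideal_diff)
  then show "(x - y) - (x' - y') \<in> two_sided_ideal relators" by (simp add: algebra_simps)
qed
lift_definition uminus_presented_alg :: "'a presented_alg \<Rightarrow> 'a presented_alg"
  is uminus
proof -
  fix x y :: "'a free_alg"
  assume "x - y \<in> two_sided_ideal relators"
  then have "- (x - y) \<in> two_sided_ideal relators" by (rule two_sided_ideal_minus)
  then show "- x - - y \<in> two_sided_ideal relators" by simp
qed
lift_definition times_presented_alg :: "'a presented_alg \<Rightarrow> 'a presented_alg \<Rightarrow> 'a presented_alg"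
  is "(*)"
proof -
  fix x x' y y' :: "'a free_alg"
  assume "x - x' \<in> two_sided_ideal relators" "y - y' \<in> two_sided_ideal relators"
  then have "(x - x') * y + x' * (y - y') \<in> two_sided_ideal relators"
    by (intro two_sided_ideal.add two_sided_ideal.mult_left two_sided_ideal.mult_right)
  then show "x * y - x' * y' \<in> two_sided_ideal relators" by (simp add: algebra_simps)
qed
lift_definition cscale_presented_alg :: "complex \<Rightarrow> 'a presented_alg \<Rightarrow> 'a presented_alg"
  is "\<lambda>c x. free_const c * x" by (metis right_diff_distrib two_sided_ideal.mult_left)

instance
proof
  fix a b c :: "'a presented_alg" and r s :: complex
  note [simp] = two_sided_ideal.zero
  show "a + b + c = a + (b + c)" by transfer (simp add: add.assoc)
  show "a + b = b + a" by transfer (simp add: add.commute)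
  show "0 + a = a" by transfer simp
  show "- a + a = 0" by transfer simp
  show "a - b = a + - b" by transfer simp
  show "a * b * c = a * (b * c)" by transfer (simp add: mult.assoc)
  show "(a + b) * c = a * c + b * c" by transfer (simp add: algebra_simps)
  show "a * (b + c) = a * b + a * c" by transfer (simp add: algebra_simps)
  show "(0 :: 'a presented_alg) \<noteq> 1"
    by transfer (use one_notin_relators_ideal two_sided_ideal_minus in force)
  show "1 * a = a" by transfer simp
  show "a * 1 = a" by transfer simp
  show "r *\<^sub>C (a + b) = r *\<^sub>C a + r *\<^sub>C b" by transfer (simp add: algebra_simps)
  show "(r + s) *\<^sub>C a = r *\<^sub>C a + s *\<^sub>C a"
    by transfer (simp add: free_const_def single_add algebra_simps)
  show "r *\<^sub>C (s *\<^sub>C a) = (r * s) *\<^sub>C a"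
    by transfer (simp add: free_const_def mult_single flip: mult.assoc)
  show "1 *\<^sub>C a = a" by transfer (simp add: free_const_def)
  show "(r *\<^sub>C a) * b = r *\<^sub>C (a * b)" by transfer (simp add: mult.assoc)
  show "a * (r *\<^sub>C b) = r *\<^sub>C (a * b)"
    by transfer (simp add: free_const_central flip: mult.assoc)
qed

end

lift_definition pgen :: "'g::relations \<Rightarrow> 'g presented_alg" is free_gen .

lemma presented_alg_lift_ex1:
  fixes f :: "'g::relations \<Rightarrow> 'a::complex_algebra"
  assumes "\<And>r. r \<in> relators \<Longrightarrow> free_lift f r = 0"
  shows "\<exists>!h. calg_hom h \<and> (\<forall>x. h (pgen x) = f x)"
proof (rule ex_ex1I)
  define h where "h y = free_lift f (rep_presented_alg y)" for y
  have h: "h (abs_presented_alg p) = free_lift f p" for p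
  proof -
    have "rep_presented_alg (abs_presented_alg p) - p \<in> two_sided_ideal relators"
      by (rule rep_abs_rsp_left[OF Quotient3_presented_alg]) (simp add: two_sided_ideal.zero)
    then have "free_lift f (rep_presented_alg (abs_presented_alg p) - p) = 0"
      by (rule free_lift_ideal[rotated]) (rule assms)
    then show ?thesis by (simp add: h_def)
  qed
  have "calg_hom h"
    unfolding calg_hom_def
  proof (intro conjI allI)
    show "h 1 = 1" by (simp add: one_presented_alg_def h)
    fix x y :: "'g presented_alg" and c
    obtain p q where x: "x = abs_presented_alg p" and y: "y = abs_presented_alg q"
      using Quotient_abs_rep[OF Quotient_presented_alg] by metis
    show "h (x + y) = h x + h y" by (simp add: x y plus_presented_alg.abs_eq h)
    show "h (x * y) = h x * h y" by (simp add: x y times_presented_alg.abs_eq h)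
    show "h (c *\<^sub>C x) = c *\<^sub>C h x"
      by (simp add: x cscale_presented_alg.abs_eq h of_cx_def mult_cscale_left)
  qed
  moreover have "h (pgen x) = f x" for x by (simp add: pgen_def h)
  ultimately show "\<exists>h. calg_hom h \<and> (\<forall>x. h (pgen x) = f x)" by blast
next
  fix h h' :: "'g presented_alg \<Rightarrow> 'a"
  assume *: "calg_hom h \<and> (\<forall>x. h (pgen x) = f x)" "calg_hom h' \<and> (\<forall>x. h' (pgen x) = f x)"
  have "g (abs_presented_alg p) = free_lift f p"
    if g: "calg_hom g \<and> (\<forall>x. g (pgen x) = f x)" for g :: "'g presented_alg \<Rightarrow> 'a" and p
  proof -
    have add: "g (x + y) = g x + g y" and mult: "g (x * y) = g x * g y"
      and scale: "g (c *\<^sub>C x) = c *\<^sub>C g x" and one: "g 1 = 1" and gen: "g (pgen a) = f a" for x y c a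
      using g by (auto simp: calg_hom_def)
    have zero: "g 0 = 0" using scale[of 0 0] by simp
    have word: "g (abs_presented_alg (Poly_Mapping.single (FWord w) 1)) = prod_list (map f w)" for w
    proof (induction w)
      case Nil
      then show ?case using one by (simp add: one_presented_alg_def flip: zero_fword_def)
    next
      case (Cons a w)
      have "Poly_Mapping.single (FWord (a # w)) (1::complex)
          = free_gen a * Poly_Mapping.single (FWord w) 1"
        by (simp add: free_gen_def mult_single plus_fword_def)
      then show ?case
        using mult[of "pgen a" "abs_presented_alg (Poly_Mapping.single (FWord w) 1)"] Cons
        by (simp add: pgen_def times_presented_alg.abs_eq gen[unfolded pgen_def, simplified])
    qed
    show ?thesis
    proof (induction p rule: poly_mapping_induct)
      case zero
      then show ?case using \<open>g 0 = 0\<close> by (simp add: zero_presented_alg_def)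
    next
      case (add k v p)
      have "Poly_Mapping.single k v = free_const v * Poly_Mapping.single k 1"
        by (simp add: free_const_def mult_single)
      then have "abs_presented_alg (Poly_Mapping.single k v + p) =
          v *\<^sub>C abs_presented_alg (Poly_Mapping.single k 1) + abs_presented_alg p"
        by (simp add: plus_presented_alg.abs_eq cscale_presented_alg.abs_eq)
      then show ?case
        using word[of "letters k"] add by (simp add: \<open>\<And>x y. g (x + y) = g x + g y\<close> scale free_lift_single)
    qed
  qed
  then have "h (abs_presented_alg p) = h' (abs_presented_alg p)" for p using * by metis
  then show "h = h'"
    by (intro ext) (metis Quotient_abs_rep[OF Quotient_presented_alg])
qed

class derivation_ring = ring_1 +
  fixes derivation :: "'a \<Rightarrow> 'a"
  assumes derivation_add: "derivation (x + y) = derivation x + derivation y"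
    and derivation_mult: "derivation (x * y) = derivation x * y + x * derivation y"

text \<open>The library constrains \<^const>\<open>gbinomial\<close> to fields; this is its restriction to the integers
  (the division is exact).\<close>

definition zbinom :: "int \<Rightarrow> nat \<Rightarrow> int"
  where "zbinom r s = (\<Prod>i = 0..<s. r - int i) div fact s"

lemma of_int_zbinom: "of_int (zbinom r s) = (of_int r gchoose s :: 'a::field_char_0)"
  using of_int_gbinomial[of r s, unfolded gbinomial_prod_rev[where ?'a = int]]
  by (simp add: zbinom_def)

lemma zbinom_simps [simp]: "zbinom r 0 = 1" "zbinom 0 s = (if s = 0 then 1 else 0)"
proof -
  show "zbinom r 0 = 1" by (simp add: zbinom_def)
  have "(of_int (zbinom 0 s) :: rat) = of_int (if s = 0 then 1 else 0)"
    by (simp add: of_int_zbinom gbinomial_0_left)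
  then show "zbinom 0 s = (if s = 0 then 1 else 0)" by (simp only: of_int_eq_iff)
qed

typedef (overloaded) 'a pdo = "{f :: int \<Rightarrow> 'a::zero. \<exists>N. \<forall>r>N. f r = 0}"
  morphisms pdo_nth Abs_pdo
  by (rule exI[of _ "\<lambda>_. 0"]) simp

setup_lifting type_definition_pdo

lemma pdo_eqI: "(\<And>r. pdo_nth P r = pdo_nth Q r) \<Longrightarrow> P = Q"
  by (simp add: pdo_nth_inject[symmetric] fun_eq_iff)

lemma pdo_nth_Abs: "(\<And>r. r > N \<Longrightarrow> f r = 0) \<Longrightarrow> pdo_nth (Abs_pdo f) = f"
  by (rule Abs_pdo_inverse) auto

lemma pdo_bound: obtains N where "\<And>r. pdo_nth P r \<noteq> 0 \<Longrightarrow> r \<le> N"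
  using pdo_nth[of P] by (auto simp: not_less[symmetric])

lemma derivation_zero [simp]: "derivation (0 :: 'a::derivation_ring) = 0"
  using derivation_add[of "0::'a" 0] by simp

lemma derivation_one [simp]: "derivation (1 :: 'a::derivation_ring) = 0"
  using derivation_mult[of "1::'a" 1] by simp

lemma derivation_pow_zero [simp]: "(derivation ^^ s) (0 :: 'a::derivation_ring) = 0"
  by (induction s) simp_all

lemma derivation_pow_one: "(derivation ^^ s) (1 :: 'a::derivation_ring) = (if s = 0 then 1 else 0)"
  by (induction s) (simp_all del: funpow.simps add: funpow_Suc_right)

lemma derivation_pow_add:
  "(derivation ^^ s) (x + y :: 'a::derivation_ring) = (derivation ^^ s) x + (derivation ^^ s) y"
  by (induction s) (simp_all add: derivation_add)

lemma derivation_pow_sum: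
  "(derivation ^^ s) (\<Sum>i\<in>A. f i :: 'a::derivation_ring) = (\<Sum>i\<in>A. (derivation ^^ s) (f i))"
  by (induction A rule: infinite_finite_induct) (simp_all add: derivation_pow_add)

lemma derivation_of_int_mult:
  "derivation (of_int k * x :: 'a::derivation_ring) = of_int k * derivation x"
proof -
  have minus: "derivation (- y) = - derivation y" for y :: 'a
    using derivation_add[of y "- y"] by (simp add: eq_neg_iff_add_eq_0 add.commute)
  have nat: "derivation (of_nat n :: 'a) = 0" for n
    by (induction n) (simp_all add: derivation_add)
  have "derivation (of_int k :: 'a) = 0"
    by (cases k rule: int_cases2) (simp_all add: nat minus)
  then show ?thesis by (simp add: derivation_mult)
qed

lemma derivation_pow_of_int_mult:
  "(derivation ^^ s) (of_int k * x :: 'a::derivation_ring) = of_int k * (derivation ^^ s) x"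
  by (induction s) (simp_all add: derivation_of_int_mult)

lemma derivation_pow_mult:
  "(derivation ^^ s) (x * y :: 'a::derivation_ring) =
    (\<Sum>j\<le>s. of_nat (s choose j) * ((derivation ^^ j) x * (derivation ^^ (s - j)) y))"
proof (induction s)
  case 0
  then show ?case by simp
next
  case (Suc s)
  let ?g = "\<lambda>j k. (derivation ^^ j) x * (derivation ^^ k) y"
  have 1: "derivation (of_nat c * z) = of_nat c * derivation z" for c and z :: 'a
    using derivation_of_int_mult[of "int c" z] by simp
  have D: "derivation (\<Sum>j\<in>A. h j) = (\<Sum>j\<in>A. derivation (h j))" for A and h :: "nat \<Rightarrow> 'a"
    using derivation_pow_sum[of 1 h A] by simp
  have "(derivation ^^ Suc s) (x * y) =
      (\<Sum>j\<le>s. of_nat (s choose j) * (?g (Suc j) (s - j) + ?g j (Suc (s - j))))"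
    by (simp add: Suc D 1 derivation_mult[of "(derivation ^^ i) x" "(derivation ^^ k) y" for i k])
  also have "\<dots> = (\<Sum>j\<le>s. of_nat (s choose j) * ?g (Suc j) (s - j))
      + (\<Sum>j\<le>s. of_nat (s choose j) * ?g j (Suc s - j))"
    by (simp add: distrib_left sum.distrib Suc_diff_le)
  also have "(\<Sum>j\<le>s. of_nat (s choose j) * ?g j (Suc s - j)) =
      ?g 0 (Suc s) + (\<Sum>j\<le>s. of_nat (s choose Suc j) * ?g (Suc j) (s - j))"
  proof -
    have "(\<Sum>j\<le>s. of_nat (s choose j) * ?g j (Suc s - j)) =
        (\<Sum>j\<le>Suc s. of_nat (s choose j) * ?g j (Suc s - j))"
      by (simp add: binomial_eq_0)
    also have "\<dots> = ?g 0 (Suc s) + (\<Sum>j\<le>s. of_nat (s choose Suc j) * ?g (Suc j) (s - j))"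
      by (subst sum.atMost_Suc_shift) simp
    finally show ?thesis .
  qed
  also have "(\<Sum>j\<le>s. of_nat (s choose j) * ?g (Suc j) (s - j)) +
      (?g 0 (Suc s) + (\<Sum>j\<le>s. of_nat (s choose Suc j) * ?g (Suc j) (s - j))) =
      ?g 0 (Suc s) + (\<Sum>j\<le>s. of_nat (Suc s choose Suc j) * ?g (Suc j) (s - j))"
    by (simp add: distrib_right sum.distrib add_ac)
  also have "\<dots> = (\<Sum>j\<le>Suc s. of_nat (Suc s choose j) * ?g j (Suc s - j))"
    by (simp add: sum.atMost_Suc_shift del: sum.atMost_Suc binomial_Suc_Suc)
  finally show ?case .
qed

instantiation pdo :: (derivation_ring) "{zero, one, plus, minus, uminus, times}"
begin

lift_definition zero_pdo :: "'a pdo" is "\<lambda>_. 0" by simp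
lift_definition one_pdo :: "'a pdo" is "\<lambda>r. if r = 0 then 1 else 0" by (auto intro!: exI[of _ 0])
lift_definition plus_pdo :: "'a pdo \<Rightarrow> 'a pdo \<Rightarrow> 'a pdo" is "\<lambda>f g r. f r + g r"
proof -
  fix f g :: "int \<Rightarrow> 'a"
  assume "\<exists>N. \<forall>r>N. f r = 0" "\<exists>N. \<forall>r>N. g r = 0"
  then obtain M N where "\<forall>r>M. f r = 0" "\<forall>r>N. g r = 0" by blast
  then show "\<exists>N. \<forall>r>N. f r + g r = 0" by (auto intro!: exI[of _ "max M N"])
qed
lift_definition minus_pdo :: "'a pdo \<Rightarrow> 'a pdo \<Rightarrow> 'a pdo" is "\<lambda>f g r. f r - g r"
proof -
  fix f g :: "int \<Rightarrow> 'a"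
  assume "\<exists>N. \<forall>r>N. f r = 0" "\<exists>N. \<forall>r>N. g r = 0"
  then obtain M N where "\<forall>r>M. f r = 0" "\<forall>r>N. g r = 0" by blast
  then show "\<exists>N. \<forall>r>N. f r - g r = 0" by (auto intro!: exI[of _ "max M N"])
qed
lift_definition uminus_pdo :: "'a pdo \<Rightarrow> 'a pdo" is "\<lambda>f r. - f r" by auto

text \<open>The term \<open>a\<^sub>r\<close> \<open>\<partial>\<^sup>r\<close> \<open>b\<^sub>q\<close> \<open>\<partial>\<^sup>q\<close> contributes
  \<open>binom(r,s) a\<^sub>r (b\<^sub>q)\<^bsub>(s)\<^esub>\<close> to the coefficient of \<open>\<partial>\<^bsup>r+q-s\<^esup>\<close>; here \<open>q = N - r + s\<close>.\<close>

lift_definition times_pdo :: "'a pdo \<Rightarrow> 'a pdo \<Rightarrow> 'a pdo" is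
  "\<lambda>f g (N::int). \<Sum>(r::int, s) \<in> {(r, s). f r \<noteq> 0 \<and> g (N - r + int s) \<noteq> 0}.
    of_int (zbinom r s) * (f r * (derivation ^^ s) (g (N - r + int s)))"
proof -
  fix f g :: "int \<Rightarrow> 'a"
  assume "\<exists>N. \<forall>r>N. f r = 0" "\<exists>N. \<forall>r>N. g r = 0"
  then obtain A B where "\<forall>r>A. f r = 0" "\<forall>r>B. g r = 0" by blast
  then have "{(r, s). f r \<noteq> 0 \<and> g (N - r + int s) \<noteq> 0} = {}" if "N > A + B" for N
    using that by (force simp: not_less)
  then show "\<exists>N. \<forall>r>N. (\<Sum>(ra, s) \<in> {(ra, s). f ra \<noteq> 0 \<and> g (r - ra + int s) \<noteq> 0}.
    of_int (zbinom ra s) * (f ra * (derivation ^^ s) (g (r - ra + int s)))) = 0"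
    by (intro exI[of _ "A + B"]) (auto simp only: sum.empty)
qed

instance ..

end

lemma pdo_nth_simps [simp]:
  "pdo_nth 0 r = 0"
  "pdo_nth 1 r = (if r = 0 then 1 else 0)"
  "pdo_nth (P + Q) r = pdo_nth P r + pdo_nth Q r"
  "pdo_nth (P - Q) r = pdo_nth P r - pdo_nth Q r"
  "pdo_nth (- P) r = - pdo_nth P r"
  by (transfer; simp)+

lemma pdo_nth_times:
  assumes "finite A"
    and "\<And>r s. pdo_nth P r \<noteq> 0 \<Longrightarrow> pdo_nth Q (N - r + int s) \<noteq> 0 \<Longrightarrow> (r, s) \<in> A"
  shows "pdo_nth (P * Q) N = (\<Sum>(r, s) \<in> A.
    of_int (zbinom r s) * (pdo_nth P r * (derivation ^^ s) (pdo_nth Q (N - r + int s))))"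
  unfolding times_pdo.rep_eq
  by (rule sum.mono_neutral_left) (use assms in \<open>auto split: prod.splits\<close>)

lemma pdo_nth_times_box:
  assumes "\<And>r. pdo_nth P r \<noteq> 0 \<Longrightarrow> r \<le> A" "\<And>r. pdo_nth Q r \<noteq> 0 \<Longrightarrow> r \<le> B"
    and "L \<le> N - B" "A \<le> R" "A + B - N \<le> int S"
  shows "pdo_nth (P * Q) N = (\<Sum>r\<in>{L..R}. \<Sum>s\<le>S.
    of_int (zbinom r s) * (pdo_nth P r * (derivation ^^ s) (pdo_nth Q (N - r + int s))))"
proof -
  have "pdo_nth (P * Q) N = (\<Sum>(r, s) \<in> {L..R} \<times> {..S}.
    of_int (zbinom r s) * (pdo_nth P r * (derivation ^^ s) (pdo_nth Q (N - r + int s))))"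
  proof (rule pdo_nth_times)
    fix r s
    assume "pdo_nth P r \<noteq> 0" "pdo_nth Q (N - r + int s) \<noteq> 0"
    then have "r \<le> A" "N - r + int s \<le> B" using assms(1,2) by blast+
    then show "(r, s) \<in> {L..R} \<times> {..S}" using assms(3-5) by simp
  qed simp
  then show ?thesis by (simp add: sum.cartesian_product)
qed

lemma zbinom_Vandermonde:
  "(\<Sum>j\<le>t. (zbinom x j) * (zbinom y (t - j))) = (zbinom (x + y :: int) t)"
proof -
  have "of_int (\<Sum>j\<le>t. (zbinom x j) * (zbinom y (t - j))) = (of_int (zbinom (x + y) t) :: rat)"
    by (simp add: of_int_zbinom gbinomial_Vandermonde[symmetric] atMost_atLeast0)
  then show ?thesis by (simp only: of_int_eq_iff)
qed

lemma zbinom_trinomial: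
  "(zbinom (x :: int) (s + j)) * int ((s + j) choose s) = (zbinom x s) * (zbinom (x - int s) j)"
proof -
  have "of_int ((zbinom x (s + j)) * int ((s + j) choose s)) =
      (of_int ((zbinom x s) * (zbinom (x - int s) j)) :: rat)"
    using gbinomial_trinomial_revision[of s "s + j" "of_int x :: rat"]
    by (simp add: of_int_zbinom binomial_gbinomial)
  then show ?thesis by (simp only: of_int_eq_iff)
qed

lemma pdo_assoc_aux:
  fixes T :: "nat \<Rightarrow> nat \<Rightarrow> 'a::ring_1" and r q :: int
  assumes T: "\<And>s t. s + t > S \<Longrightarrow> T s t = 0"
  shows "(\<Sum>s'\<le>S. \<Sum>t'\<le>S. \<Sum>s\<le>s'.
      of_int ((zbinom r s') * (zbinom q t') * int (s' choose s)) * T s (s' - s + t')) =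
    (\<Sum>s\<le>S. \<Sum>t\<le>S. of_int ((zbinom (q + r - int s) t) * (zbinom r s)) * T s t)"
proof -
  let ?F = "\<lambda>s' t' s. of_int ((zbinom r s') * (zbinom q t') * int (s' choose s)) * T s (s' - s + t')"
  have "(\<Sum>s'\<le>S. \<Sum>t'\<le>S. \<Sum>s\<le>s'. ?F s' t' s) = (\<Sum>s'\<le>S. \<Sum>s\<le>s'. \<Sum>t'\<le>S. ?F s' t' s)"
    by (intro sum.cong refl sum.swap)
  also have "\<dots> = (\<Sum>s'\<le>S. \<Sum>s\<le>s'. (\<lambda>s j. \<Sum>t'\<le>S. ?F (s + j) t' s) s (s' - s))"
    by (intro sum.cong refl) auto
  also have "\<dots> = (\<Sum>(s, j) \<in> {(s, j). s + j \<le> S}. \<Sum>t'\<le>S. ?F (s + j) t' s)"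
    by (rule sum.triangle_reindex_eq[symmetric])
  also have "{(s, j). s + j \<le> S} = Sigma {..S} (\<lambda>s. {..S - s})" by auto
  also have "(\<Sum>(s, j) \<in> \<dots>. \<Sum>t'\<le>S. ?F (s + j) t' s) = (\<Sum>s\<le>S. \<Sum>j\<le>S - s. \<Sum>t'\<le>S. ?F (s + j) t' s)"
    by (rule sum.Sigma[symmetric]) auto
  also have "\<dots> = (\<Sum>s\<le>S. \<Sum>t\<le>S. of_int ((zbinom (q + r - int s) t) * (zbinom r s)) * T s t)"
  proof (rule sum.cong[OF refl])
    fix s assume "s \<in> {..S}"
    then have s: "s \<le> S" by simp
    let ?G = "\<lambda>j t'. of_int ((zbinom r s) * (zbinom (r - int s) j) * (zbinom q t')) * T s (j + t')"
    have G: "j + t' \<le> S - s" if "?G j t' \<noteq> 0" for j t'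
      using T[of s "j + t'"] that by (cases "j + t' \<le> S - s") auto
    have "(\<Sum>j\<le>S - s. \<Sum>t'\<le>S. ?F (s + j) t' s) = (\<Sum>j\<le>S - s. \<Sum>t'\<le>S. ?G j t')"
    proof (intro sum.cong refl)
      fix j t'
      have "(zbinom r (s + j)) * (zbinom q t') * int ((s + j) choose s)
          = (zbinom r s) * (zbinom (r - int s) j) * (zbinom q t')"
        using zbinom_trinomial[of r s j] by (simp add: mult_ac)
      then show "?F (s + j) t' s = ?G j t'" by (simp only: add_diff_cancel_left')
    qed
    also have "\<dots> = (\<Sum>(j, t') \<in> {..S - s} \<times> {..S}. ?G j t')"
      by (simp add: sum.cartesian_product)
    also have "\<dots> = (\<Sum>(j, t') \<in> {(j, t'). j + t' \<le> S - s}. ?G j t')"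
      by (rule sum.mono_neutral_right) (auto simp del: of_int_mult dest!: G)
    also have "\<dots> = (\<Sum>t\<le>S - s. \<Sum>j\<le>t. ?G j (t - j))"
      by (rule sum.triangle_reindex_eq)
    also have "\<dots> = (\<Sum>t\<le>S - s. of_int ((zbinom (q + r - int s) t) * (zbinom r s)) * T s t)"
    proof (rule sum.cong[OF refl])
      fix t
      have "(\<Sum>j\<le>t. ?G j (t - j)) =
          of_int (\<Sum>j\<le>t. (zbinom r s) * ((zbinom (r - int s) j) * (zbinom q (t - j)))) * T s t"
        by (simp add: sum_distrib_right mult.assoc)
      also have "(\<Sum>j\<le>t. (zbinom r s) * ((zbinom (r - int s) j) * (zbinom q (t - j)))) =
          (zbinom (q + r - int s) t) * (zbinom r s)"
        unfolding sum_distrib_left[symmetric] zbinom_Vandermonde by (simp add: algebra_simps)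
      finally show "(\<Sum>j\<le>t. ?G j (t - j)) =
          of_int ((zbinom (q + r - int s) t) * (zbinom r s)) * T s t" .
    qed
    also have "\<dots> = (\<Sum>t\<le>S. of_int ((zbinom (q + r - int s) t) * (zbinom r s)) * T s t)"
    proof (rule sum.mono_neutral_left)
      show "\<forall>t\<in>{..S} - {..S - s}. of_int ((zbinom (q + r - int s) t) * (zbinom r s)) * T s t = 0"
      proof
        fix t assume "t \<in> {..S} - {..S - s}"
        then have "T s t = 0" using s by (intro T) auto
        then show "of_int ((zbinom (q + r - int s) t) * (zbinom r s)) * T s t = 0" by simp
      qed
    qed (use s in auto)
    finally show "(\<Sum>j\<le>S - s. \<Sum>t'\<le>S. ?F (s + j) t' s) =
        (\<Sum>t\<le>S. of_int ((zbinom (q + r - int s) t) * (zbinom r s)) * T s t)" .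
  qed
  finally show ?thesis .
qed

lemma pdo_mult_assoc:
  fixes P Q R :: "'a::derivation_ring pdo"
  shows "(P * Q) * R = P * (Q * R)"
proof (rule pdo_eqI)
  fix N
  obtain A where A: "\<And>r. pdo_nth P r \<noteq> 0 \<Longrightarrow> r \<le> A" using pdo_bound[of P] by metis
  obtain B where B: "\<And>r. pdo_nth Q r \<noteq> 0 \<Longrightarrow> r \<le> B" using pdo_bound[of Q] by metis
  obtain C where C: "\<And>r. pdo_nth R r \<noteq> 0 \<Longrightarrow> r \<le> C" using pdo_bound[of R] by metis
  have order: "r \<le> a + b"
    if ab: "\<And>r. pdo_nth X r \<noteq> 0 \<Longrightarrow> r \<le> a" "\<And>r. pdo_nth Y r \<noteq> 0 \<Longrightarrow> r \<le> b"
      and "pdo_nth (X * Y) r \<noteq> 0" for X Y :: "'a pdo" and a b r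
  proof (rule ccontr)
    assume "\<not> r \<le> a + b"
    then have "pdo_nth (X * Y) r = (\<Sum>(r', s) \<in> {}. of_int (zbinom r' s) * (pdo_nth X r' * (derivation ^^ s) (pdo_nth Y (r - r' + int s))))"
      by (intro pdo_nth_times) (force dest: ab)+
    with that(3) show False by simp
  qed
  define S where "S = nat (A + B + C - N)"
  have S: "A + B + C - N \<le> int S" by (simp add: S_def)
  define a where "a = pdo_nth P"
  define b where "b = pdo_nth Q"
  define c where "c = pdo_nth R"
  define T where "T r q s t = a r * ((derivation ^^ s) (b q) * (derivation ^^ t) (c (N - q - r + int s + int t)))"
    for r q s t
  let ?I = "{N - B - C..A}" and ?J = "{N - A - C..B}"
  have T0: "T r q s t = 0" if "r \<le> A" "q \<le> B" "s + t > S" for r q s t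
  proof -
    have "N - q - r + int s + int t > C" using that S by linarith
    then have "c (N - q - r + int s + int t) = 0" using C unfolding c_def by force
    then show ?thesis by (simp add: T_def)
  qed
  have "pdo_nth (P * (Q * R)) N = (\<Sum>r\<in>?I. \<Sum>s'\<le>S.
      of_int (zbinom r s') * (a r * (derivation ^^ s') (pdo_nth (Q * R) (N - r + int s'))))"
    unfolding a_def by (rule pdo_nth_times_box[OF A order[OF B C]]) (use S in auto)
  also have "\<dots> = (\<Sum>r\<in>?I. \<Sum>s'\<le>S. \<Sum>q\<in>?J. \<Sum>t'\<le>S. \<Sum>s\<le>s'.
      of_int ((zbinom r s') * (zbinom q t') * int (s' choose s)) * T r q s (s' - s + t'))"
  proof (intro sum.cong refl)
    fix r s' assume r: "r \<in> ?I" and "s' \<in> {..S}"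
    have "pdo_nth (Q * R) (N - r + int s') = (\<Sum>q\<in>?J. \<Sum>t'\<le>S.
        of_int (zbinom q t') * (b q * (derivation ^^ t') (c (N - r + int s' - q + int t'))))"
      unfolding b_def c_def by (rule pdo_nth_times_box[OF B C]) (use S r in auto)
    then have "of_int (zbinom r s') * (a r * (derivation ^^ s') (pdo_nth (Q * R) (N - r + int s'))) =
        (\<Sum>q\<in>?J. \<Sum>t'\<le>S. \<Sum>s\<le>s'. of_int (zbinom r s') * (a r * (of_int (zbinom q t') *
          (of_nat (s' choose s) * ((derivation ^^ s) (b q) *
            (derivation ^^ (s' - s)) ((derivation ^^ t') (c (N - r + int s' - q + int t'))))))))"
      by (simp add: derivation_pow_sum derivation_pow_of_int_mult derivation_pow_mult[of s' "b i" for i] sum_distrib_left)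
    also have "\<dots> = (\<Sum>q\<in>?J. \<Sum>t'\<le>S. \<Sum>s\<le>s'.
      of_int ((zbinom r s') * (zbinom q t') * int (s' choose s)) * T r q s (s' - s + t'))"
    proof (intro sum.cong refl)
      fix q t' s assume "s \<in> {..s'}"
      then have "s \<le> s'" by simp
      then have e: "N - r + int s' - q + int t' = N - q - r + int s + int (s' - s + t')" by simp
      have "a r * (of_int i * (of_nat n * x)) = of_int (i * int n) * (a r * x)" for i n x
        by (metis (no_types, lifting) mult.assoc mult_of_int_commute of_int_mult of_int_of_nat_eq)
      then show "of_int (zbinom r s') * (a r * (of_int (zbinom q t') *
          (of_nat (s' choose s) * ((derivation ^^ s) (b q) *
            (derivation ^^ (s' - s)) ((derivation ^^ t') (c (N - r + int s' - q + int t'))))))) =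
        of_int ((zbinom r s') * (zbinom q t') * int (s' choose s)) * T r q s (s' - s + t')"
        by (simp add: T_def e funpow_add mult.assoc del: of_nat_add)
    qed
    finally show "of_int (zbinom r s') * (a r * (derivation ^^ s') (pdo_nth (Q * R) (N - r + int s'))) =
        (\<Sum>q\<in>?J. \<Sum>t'\<le>S. \<Sum>s\<le>s'.
      of_int ((zbinom r s') * (zbinom q t') * int (s' choose s)) * T r q s (s' - s + t'))" .
  qed
  also have "\<dots> = (\<Sum>r\<in>?I. \<Sum>q\<in>?J. \<Sum>s'\<le>S. \<Sum>t'\<le>S. \<Sum>s\<le>s'.
      of_int ((zbinom r s') * (zbinom q t') * int (s' choose s)) * T r q s (s' - s + t'))"
    by (intro sum.cong refl sum.swap)
  also have "\<dots> = (\<Sum>r\<in>?I. \<Sum>q\<in>?J. \<Sum>s\<le>S. \<Sum>t\<le>S.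
      of_int ((zbinom (q + r - int s) t) * (zbinom r s)) * T r q s t)"
    by (intro sum.cong refl pdo_assoc_aux) (auto simp: T0)
  finally have right: "pdo_nth (P * (Q * R)) N = \<dots>" .
  let ?U = "\<lambda>p t r s. of_int ((zbinom p t) * (zbinom r s)) * T r (p - r + int s) s t"
  have "pdo_nth ((P * Q) * R) N = (\<Sum>p\<in>{N - C..A + B}. \<Sum>t\<le>S.
      of_int (zbinom p t) * (pdo_nth (P * Q) p * (derivation ^^ t) (c (N - p + int t))))"
    unfolding c_def by (rule pdo_nth_times_box[OF order[OF A B] C]) (use S in auto)
  also have "\<dots> = (\<Sum>p\<in>{N - C..A + B}. \<Sum>t\<le>S. \<Sum>r\<in>?I. \<Sum>s\<le>S. ?U p t r s)"
  proof (intro sum.cong refl)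
    fix p t assume p: "p \<in> {N - C..A + B}" and "t \<in> {..S}"
    have "pdo_nth (P * Q) p = (\<Sum>r\<in>?I. \<Sum>s\<le>S.
        of_int (zbinom r s) * (a r * (derivation ^^ s) (b (p - r + int s))))"
      unfolding a_def b_def by (rule pdo_nth_times_box[OF A B]) (use S p in auto)
    then show "of_int (zbinom p t) * (pdo_nth (P * Q) p * (derivation ^^ t) (c (N - p + int t))) =
        (\<Sum>r\<in>?I. \<Sum>s\<le>S. ?U p t r s)"
      by (simp add: sum_distrib_left sum_distrib_right T_def mult.assoc)
  qed
  also have "\<dots> = (\<Sum>r\<in>?I. \<Sum>s\<le>S. \<Sum>t\<le>S. \<Sum>p\<in>{N - C..A + B}. ?U p t r s)"
  proof -
    have "(\<Sum>p\<in>X. \<Sum>t\<in>Y. \<Sum>r\<in>Z. \<Sum>s\<in>Y. f p t r s) = (\<Sum>r\<in>Z. \<Sum>s\<in>Y. \<Sum>t\<in>Y. \<Sum>p\<in>X. f p t r s)"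
      for X Z :: "int set" and Y :: "nat set" and f :: "int \<Rightarrow> nat \<Rightarrow> int \<Rightarrow> nat \<Rightarrow> 'a"
    proof -
      have "(\<Sum>p\<in>X. \<Sum>t\<in>Y. \<Sum>r\<in>Z. \<Sum>s\<in>Y. f p t r s) = (\<Sum>p\<in>X. \<Sum>r\<in>Z. \<Sum>t\<in>Y. \<Sum>s\<in>Y. f p t r s)"
        by (intro sum.cong refl sum.swap)
      also have "\<dots> = (\<Sum>p\<in>X. \<Sum>r\<in>Z. \<Sum>s\<in>Y. \<Sum>t\<in>Y. f p t r s)"
        by (intro sum.cong refl sum.swap)
      also have "\<dots> = (\<Sum>r\<in>Z. \<Sum>p\<in>X. \<Sum>s\<in>Y. \<Sum>t\<in>Y. f p t r s)"
        by (rule sum.swap)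
      also have "\<dots> = (\<Sum>r\<in>Z. \<Sum>s\<in>Y. \<Sum>p\<in>X. \<Sum>t\<in>Y. f p t r s)"
        by (intro sum.cong refl sum.swap)
      also have "\<dots> = (\<Sum>r\<in>Z. \<Sum>s\<in>Y. \<Sum>t\<in>Y. \<Sum>p\<in>X. f p t r s)"
        by (intro sum.cong refl sum.swap)
      finally show ?thesis .
    qed
    then show ?thesis .
  qed
  also have "\<dots> = (\<Sum>r\<in>?I. \<Sum>s\<le>S. \<Sum>t\<le>S. \<Sum>q\<in>?J.
      of_int ((zbinom (q + r - int s) t) * (zbinom r s)) * T r q s t)"
  proof (rule sum.cong[OF refl], rule sum.cong[OF refl], rule sum.cong[OF refl])
    fix r s t assume r: "r \<in> ?I" and "s \<in> {..S}" "t \<in> {..S}"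
    let ?V = "\<lambda>q. of_int ((zbinom (q + r - int s) t) * (zbinom r s)) * T r q s t"
    let ?K = "{N - C - r + int s..A + B - r + int s}"
    have "(\<Sum>p\<in>{N - C..A + B}. ?U p t r s) = (\<Sum>q\<in>?K. ?V q)"
      by (rule sum.reindex_bij_witness[of _ "\<lambda>q. q + r - int s" "\<lambda>p. p - r + int s"]) auto
    also have "\<dots> = (\<Sum>q\<in>?K \<inter> ?J. ?V q)"
    proof (rule sum.mono_neutral_right)
      show "\<forall>q\<in>?K - ?K \<inter> ?J. ?V q = 0"
      proof
        fix q assume q: "q \<in> ?K - ?K \<inter> ?J"
        then have "q > B" using r by auto
        then have "b q = 0" using B unfolding b_def by force
        then show "?V q = 0" by (simp add: T_def)
      qed
    qed auto
    also have "\<dots> = (\<Sum>q\<in>?J. ?V q)"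
    proof (rule sum.mono_neutral_left)
      show "\<forall>q\<in>?J - ?K \<inter> ?J. ?V q = 0"
      proof
        fix q assume q: "q \<in> ?J - ?K \<inter> ?J"
        then have "N - q - r + int s + int t > C" using r by auto
        then have "c (N - q - r + int s + int t) = 0" using C unfolding c_def by force
        then show "?V q = 0" by (simp add: T_def)
      qed
    qed auto
    finally show "(\<Sum>p\<in>{N - C..A + B}. ?U p t r s) = (\<Sum>q\<in>?J. ?V q)" .
  qed
  also have "\<dots> = (\<Sum>r\<in>?I. \<Sum>q\<in>?J. \<Sum>s\<le>S. \<Sum>t\<le>S.
      of_int ((zbinom (q + r - int s) t) * (zbinom r s)) * T r q s t)"
  proof (intro sum.cong refl)
    fix r
    let ?V = "\<lambda>s t q. of_int ((zbinom (q + r - int s) t) * (zbinom r s)) * T r q s t"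
    have "(\<Sum>s\<le>S. \<Sum>t\<le>S. \<Sum>q\<in>?J. ?V s t q) = (\<Sum>s\<le>S. \<Sum>q\<in>?J. \<Sum>t\<le>S. ?V s t q)"
      by (intro sum.cong refl sum.swap)
    also have "\<dots> = (\<Sum>q\<in>?J. \<Sum>s\<le>S. \<Sum>t\<le>S. ?V s t q)" by (rule sum.swap)
    finally show "(\<Sum>s\<le>S. \<Sum>t\<le>S. \<Sum>q\<in>?J. ?V s t q) = (\<Sum>q\<in>?J. \<Sum>s\<le>S. \<Sum>t\<le>S. ?V s t q)" .
  qed
  finally show "pdo_nth ((P * Q) * R) N = pdo_nth (P * (Q * R)) N" using right by simp
qed

instance pdo :: (derivation_ring) ring_1
proof
  fix P Q R :: "'a pdo"
  obtain A where A: "\<And>r. pdo_nth P r \<noteq> 0 \<Longrightarrow> r \<le> A" using pdo_bound[of P] by metis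
  obtain B where B: "\<And>r. pdo_nth Q r \<noteq> 0 \<Longrightarrow> r \<le> B" using pdo_bound[of Q] by metis
  obtain C where C: "\<And>r. pdo_nth R r \<noteq> 0 \<Longrightarrow> r \<le> C" using pdo_bound[of R] by metis
  define D where "D = Max {0, A, B, C}"
  have D: "pdo_nth P r \<noteq> 0 \<Longrightarrow> r \<le> D" "pdo_nth Q r \<noteq> 0 \<Longrightarrow> r \<le> D" "pdo_nth R r \<noteq> 0 \<Longrightarrow> r \<le> D" for r
    using A[of r] B[of r] C[of r] by (auto simp: D_def)
  have D': "pdo_nth (P + Q) r \<noteq> 0 \<Longrightarrow> r \<le> D" "pdo_nth (Q + R) r \<noteq> 0 \<Longrightarrow> r \<le> D" for r
    by (metis D add_0 pdo_nth_simps(3))+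
  have X: "r \<le> D" if "X \<in> {P, P + Q, Q}" "pdo_nth X r \<noteq> 0" for X r
    using that D(1,2)[of r] D'(1)[of r] by blast
  have Y: "r \<le> D" if "Y \<in> {Q, Q + R, R}" "pdo_nth Y r \<noteq> 0" for Y r
    using that D(2,3)[of r] D'(2)[of r] by blast
  have box: "pdo_nth (X * Y) N = (\<Sum>r\<in>{N - D..D}. \<Sum>s\<le>nat (D + D - N).
      of_int (zbinom r s) * (pdo_nth X r * (derivation ^^ s) (pdo_nth Y (N - r + int s))))"
    if "X \<in> {P, P + Q, Q}" "Y \<in> {Q, Q + R, R}" for X Y N
    by (rule pdo_nth_times_box[of _ D _ D]) (use X[OF that(1)] Y[OF that(2)] in auto)
  show "P + Q + R = P + (Q + R)" by (rule pdo_eqI) (simp add: add.assoc)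
  show "P + Q = Q + P" by (rule pdo_eqI) (simp add: add.commute)
  show "0 + P = P" by (rule pdo_eqI) simp
  show "- P + P = 0" by (rule pdo_eqI) simp
  show "P - Q = P + - Q" by (rule pdo_eqI) simp
  show "(0 :: 'a pdo) \<noteq> 1" by (metis pdo_nth_simps(1,2) zero_neq_one)
  show "P * Q * R = P * (Q * R)" by (rule pdo_mult_assoc)
  have mem: "P \<in> {P, P + Q, Q}" "Q \<in> {P, P + Q, Q}" "P + Q \<in> {P, P + Q, Q}"
    "Q \<in> {Q, Q + R, R}" "R \<in> {Q, Q + R, R}" "Q + R \<in> {Q, Q + R, R}" by blast+
  show "(P + Q) * R = P * R + Q * R"
    by (rule pdo_eqI) (simp only: pdo_nth_simps(3) box[OF mem(1,5)] box[OF mem(2,5)] box[OF mem(3,5)]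
      distrib_left distrib_right sum.distrib)
  show "P * (Q + R) = P * Q + P * R"
    by (rule pdo_eqI) (simp only: pdo_nth_simps(3) box[OF mem(1,4)] box[OF mem(1,5)] box[OF mem(1,6)]
      distrib_left distrib_right sum.distrib derivation_pow_add)
  show "1 * P = P"
  proof (rule pdo_eqI)
    fix N
    have "pdo_nth (1 * P) N = (\<Sum>(r, s) \<in> {0} \<times> {..nat (D - N)}.
      of_int (zbinom r s) * (pdo_nth 1 r * (derivation ^^ s) (pdo_nth P (N - r + int s))))"
      by (rule pdo_nth_times) (auto split: if_splits dest!: D(1))
    also have "\<dots> = (\<Sum>s\<le>nat (D - N). of_int (zbinom 0 s) * (derivation ^^ s) (pdo_nth P (N + int s)))"
      by (simp only: sum.cartesian_product[symmetric]) (simp del: zbinom_simps)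
    also have "\<dots> = (\<Sum>s\<le>nat (D - N). if s = 0 then pdo_nth P N else 0)"
      by (rule sum.cong) auto
    finally show "pdo_nth (1 * P) N = pdo_nth P N" by simp
  qed
  show "P * 1 = P"
  proof (rule pdo_eqI)
    fix N
    have "pdo_nth (P * 1) N = (\<Sum>(r, s) \<in> (\<lambda>s. (N + int s, s)) ` {..nat (D - N)}.
      of_int (zbinom r s) * (pdo_nth P r * (derivation ^^ s) (pdo_nth 1 (N - r + int s))))"
    proof (rule pdo_nth_times)
      fix r s assume "pdo_nth P r \<noteq> 0" "pdo_nth 1 (N - r + int s) \<noteq> (0 :: 'a)"
      then have "r \<le> D" "r = N + int s" using D(1) by (auto split: if_splits)
      then show "(r, s) \<in> (\<lambda>s. (N + int s, s)) ` {..nat (D - N)}" by auto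
    qed simp
    also have "\<dots> = (\<Sum>s\<le>nat (D - N). if s = 0 then pdo_nth P N else 0)"
    proof (subst sum.reindex)
      show "inj_on (\<lambda>s. (N + int s, s)) {..nat (D - N)}" by (auto intro: inj_onI)
    qed (rule sum.cong, auto simp: derivation_pow_one)
    finally show "pdo_nth (P * 1) N = pdo_nth P N" by simp
  qed
qed

text \<open>We read \<^typ>\<open>'a fls\<close> as \<open>A((v\<^sup>-\<^sup>1))\<close>: \<^term>\<open>fls_X\<close> stands for \<open>v\<^sup>-\<^sup>1\<close> and \<^term>\<open>fls_X_inv\<close>
  for \<open>v\<close>, so the coefficient of \<open>v\<^sup>r\<close> in \<open>F\<close> is \<open>fls_nth F (- r)\<close>, and
  \<open>d/dv = - X\<^sup>2 d/dX\<close>.\<close>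

instantiation fls :: (ring_1) derivation_ring
begin

definition derivation_fls :: "'a fls \<Rightarrow> 'a fls"
  where "derivation_fls f = - (fls_X ^ 2 * fls_deriv f)"

instance
proof
  fix f g :: "'a fls"
  have "fls_X ^ 2 * h = h * fls_X ^ 2" for h :: "'a fls"
    by (simp add: fls_X_power_times_conv_shift)
  then have "fls_X ^ 2 * (f * fls_deriv g) = f * (fls_X ^ 2 * fls_deriv g)"
    by (metis mult.assoc)
  then show "derivation (f * g) = derivation f * g + f * derivation g"
    by (simp add: derivation_fls_def distrib_left mult.assoc)
  show "derivation (f + g) = derivation f + derivation g"
    by (simp add: derivation_fls_def distrib_left)
qed

end

lemma derivation_fls_X_inv: "derivation (fls_X_inv :: 'a::ring_1 fls) = 1"
  by (simp add: derivation_fls_def fls_X_power_times_conv_shift fls_X_inv_power_conv_shift_1)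

definition fls_map :: "('a::zero \<Rightarrow> 'b::zero) \<Rightarrow> 'a fls \<Rightarrow> 'b fls"
  where "fls_map f F = Abs_fls (\<lambda>n. f (fls_nth F n))"

definition pdo_map :: "('a::zero \<Rightarrow> 'b::zero) \<Rightarrow> 'a pdo \<Rightarrow> 'b pdo"
  where "pdo_map f P = Abs_pdo (\<lambda>r. f (pdo_nth P r))"

definition pdo_const :: "'a::zero \<Rightarrow> 'a pdo"
  where "pdo_const a = Abs_pdo (\<lambda>r. if r = 0 then a else 0)"

definition pdo_partial :: "'a::zero_neq_one pdo"
  where "pdo_partial = Abs_pdo (\<lambda>r. if r = 1 then 1 else 0)"

text \<open>The coefficient of \<open>v\<^sup>r \<partial>\<^sub>v\<^sup>s\<close>.\<close>

definition pdo_coeff2 :: "'a::zero fls pdo \<Rightarrow> int \<Rightarrow> int \<Rightarrow> 'a"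
  where "pdo_coeff2 P r s = fls_nth (pdo_nth P s) (- r)"

lemma fls_nth_map: "f 0 = 0 \<Longrightarrow> fls_nth (fls_map f F) n = f (fls_nth F n)"
proof -
  assume f: "f 0 = 0"
  obtain N where "\<forall>n<N. fls_nth F n = 0" by (elim fls_nth_vanishes_belowE)
  then show ?thesis using f by (simp add: fls_map_def nth_Abs_fls_lower_bound[of N])
qed

lemma pdo_nth_map: "f 0 = 0 \<Longrightarrow> pdo_nth (pdo_map f P) r = f (pdo_nth P r)"
proof -
  assume f: "f 0 = 0"
  obtain N where N: "\<And>r. pdo_nth P r \<noteq> 0 \<Longrightarrow> r \<le> N" using pdo_bound[of P] by metis
  then have "pdo_nth (Abs_pdo (\<lambda>r. f (pdo_nth P r))) = (\<lambda>r. f (pdo_nth P r))"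
  proof (intro pdo_nth_Abs[of N])
    fix r assume "r > N"
    then have "pdo_nth P r = 0" using N[of r] by force
    then show "f (pdo_nth P r) = 0" using f by simp
  qed
  then show ?thesis by (simp add: pdo_map_def)
qed

lemma pdo_nth_const: "pdo_nth (pdo_const a) r = (if r = 0 then a else 0)"
  unfolding pdo_const_def by (subst pdo_nth_Abs[of 0]) auto

lemma pdo_nth_partial: "pdo_nth pdo_partial r = (if r = 1 then 1 else 0)"
  unfolding pdo_partial_def by (subst pdo_nth_Abs[of 1]) auto

lemma pdo_partial_const:
  fixes a :: "'a::derivation_ring"
  shows "pdo_partial * pdo_const a = pdo_const a * pdo_partial + pdo_const (derivation a)"
proof (rule pdo_eqI)
  fix N
  have z: "zbinom 1 (Suc 0) = 1" by (simp add: zbinom_def)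
  have "pdo_nth (pdo_partial * pdo_const a) N = (\<Sum>(r, s) \<in> {1} \<times> {nat (1 - N)}.
      of_int (zbinom r s) * (pdo_nth pdo_partial r *
        (derivation ^^ s) (pdo_nth (pdo_const a) (N - r + int s))))"
    by (rule pdo_nth_times) (auto simp: pdo_nth_partial pdo_nth_const split: if_splits)
  moreover have "of_int (zbinom 1 (nat (1 - N))) = (0 :: 'a)" if "N < 0"
  proof -
    have "(of_int (zbinom 1 (nat (1 - N))) :: rat) = 0"
      using that binomial_gbinomial[of 1 "nat (1 - N)", where ?'a = rat]
      by (simp add: of_int_zbinom binomial_eq_0)
    then show ?thesis by simp
  qed
  moreover have "N < 0 \<or> N = 0 \<or> N = 1 \<or> N > 1" by arith
  moreover have "pdo_nth (pdo_const a * pdo_partial) N = (\<Sum>(r, s) \<in> {0} \<times> {nat (1 - N)}.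
      of_int (zbinom r s) * (pdo_nth (pdo_const a) r *
        (derivation ^^ s) (pdo_nth pdo_partial (N - r + int s))))"
    by (rule pdo_nth_times) (auto simp: pdo_nth_partial pdo_nth_const split: if_splits)
  ultimately show "pdo_nth (pdo_partial * pdo_const a) N =
      pdo_nth (pdo_const a * pdo_partial + pdo_const (derivation a)) N"
    by (auto simp: pdo_nth_partial pdo_nth_const z)
qed

instantiation complex :: complex_algebra
begin
definition cscale_complex :: "complex \<Rightarrow> complex \<Rightarrow> complex" where "cscale_complex c x = c * x"
instance by standard (simp_all add: cscale_complex_def algebra_simps)
end

text \<open>The ranks \<open>m, n, k\<close> are the numbers \<open>CARD('m)\<close>, \<open>CARD('n)\<close>, \<open>CARD('k)\<close> for arbitrary types
  \<open>'m, 'n, 'k\<close>. The cardinality of an infinite type is \<open>0\<close>, so the rank \<open>0\<close> is not excluded; in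
  particular \<open>CARD(0) = 0\<close> for the numeral type \<open>0\<close>. All indices start at \<open>0\<close>: \<open>i, j\<close> run
  through \<open>0, \<dots>, m + n - 1\<close>, those below \<open>m\<close> being even, and \<open>a, b\<close> through \<open>0, \<dots>, k - 1\<close>.\<close>

definition parity :: "nat \<Rightarrow> nat \<Rightarrow> nat"
  where "parity m i = (if i < m then 0 else 1)"

text \<open>\<open>GlGen i j r\<close> is \<open>e\<^sub>i\<^sub>j \<otimes> t\<^sup>r\<close>. The enveloping superalgebra of the current algebra is the free algebra
  on this basis modulo \<open>x y - (-1)\<^bsup>|x| |y|\<^esup> y x - [x, y]\<close> for basis elements \<open>x, y\<close>. Generators with an index
  outside the range are set to \<open>0\<close>, which removes them.\<close>

datatype ('m, 'n) gl_gen = GlGen nat nat nat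

instantiation gl_gen :: (type, type) relations
begin

definition relators_gl_gen :: "('a, 'b) gl_gen free_alg set" where
  "relators_gl_gen = (let m = CARD('a); N = CARD('a) + CARD('b) in
    {free_gen (GlGen i j r) | i j r. \<not> (i < N \<and> j < N)} \<union>
    {free_gen (GlGen i j r) * free_gen (GlGen p q s)
       - free_const ((- 1) ^ ((parity m i + parity m j) * (parity m p + parity m q)))
           * (free_gen (GlGen p q s) * free_gen (GlGen i j r))
       - ((if j = p then free_gen (GlGen i q (r + s)) else 0)
          - free_const ((- 1) ^ ((parity m i + parity m j) * (parity m p + parity m q)))
              * (if i = q then free_gen (GlGen p j (r + s)) else 0))
     | i j p q r s. i < N \<and> j < N \<and> p < N \<and> q < N})"

instance
proof
  show "(1 :: ('a, 'b) gl_gen free_alg) \<notin> two_sided_ideal relators"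
  proof
    assume "(1 :: ('a, 'b) gl_gen free_alg) \<in> two_sided_ideal relators"
    then have "free_lift (\<lambda>_ :: ('a, 'b) gl_gen. 0 :: complex) 1 = 0"
      by (rule free_lift_ideal[rotated]) (auto simp: relators_gl_gen_def Let_def)
    then show False by simp
  qed
qed

end

type_synonym ('m, 'n) U_gl_current = "('m, 'n) gl_gen presented_alg"

text \<open>\<open>WX i a\<close> and \<open>WD i a\<close> are \<open>x\<^sub>i\<^sub>a\<close> and \<open>\<partial>\<^sub>i\<^sub>a\<close>; again, indices outside the range give \<open>0\<close>.\<close>

datatype ('m, 'n, 'k) weyl_gen = WX nat nat | WD nat nat

text \<open>The operators below are needed only to show that the relations of the Weyl superalgebra do not
  force \<open>1 = 0\<close>.\<close>

typedef 'a lin_op = "{f :: ('a \<Rightarrow> complex) \<Rightarrow> 'a \<Rightarrow> complex.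
    (\<forall>F G. f (\<lambda>x. F x + G x) = (\<lambda>x. f F x + f G x)) \<and> (\<forall>c F. f (\<lambda>x. c * F x) = (\<lambda>x. c * f F x))}"
  by (rule exI[of _ "\<lambda>F. F"]) simp

setup_lifting type_definition_lin_op

instantiation lin_op :: (type) complex_algebra
begin

lift_definition zero_lin_op :: "'a lin_op" is "\<lambda>F x. 0" by simp
lift_definition one_lin_op :: "'a lin_op" is "\<lambda>F. F" by simp
lift_definition plus_lin_op :: "'a lin_op \<Rightarrow> 'a lin_op \<Rightarrow> 'a lin_op" is "\<lambda>f g F x. f F x + g F x"
  by (simp add: algebra_simps)
lift_definition minus_lin_op :: "'a lin_op \<Rightarrow> 'a lin_op \<Rightarrow> 'a lin_op" is "\<lambda>f g F x. f F x - g F x"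
  by (simp add: algebra_simps)
lift_definition uminus_lin_op :: "'a lin_op \<Rightarrow> 'a lin_op" is "\<lambda>f F x. - f F x"
  by (simp add: algebra_simps)
lift_definition times_lin_op :: "'a lin_op \<Rightarrow> 'a lin_op \<Rightarrow> 'a lin_op" is "\<lambda>f g F. f (g F)"
  by simp
lift_definition cscale_lin_op :: "complex \<Rightarrow> 'a lin_op \<Rightarrow> 'a lin_op" is "\<lambda>c f F x. c * f F x"
  by (simp add: algebra_simps)

instance
proof
  fix a b c :: "'a lin_op" and r s :: complex
  show "a + b + c = a + (b + c)" by transfer (simp add: add.assoc)
  show "a + b = b + a" by transfer (simp add: add.commute)
  show "0 + a = a" by transfer simp
  show "- a + a = 0" by transfer simp
  show "a - b = a + - b" by transfer simp
  show "a * b * c = a * (b * c)" by transfer simp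
  show "(a + b) * c = a * c + b * c" by transfer simp
  show "a * (b + c) = a * b + a * c" by transfer simp
  show "(0 :: 'a lin_op) \<noteq> 1" by transfer (metis zero_neq_one)
  show "1 * a = a" "a * 1 = a" by (transfer; simp)+
  show "r *\<^sub>C (a + b) = r *\<^sub>C a + r *\<^sub>C b" by transfer (simp add: algebra_simps)
  show "(r + s) *\<^sub>C a = r *\<^sub>C a + s *\<^sub>C a" by transfer (simp add: algebra_simps)
  show "r *\<^sub>C (s *\<^sub>C a) = (r * s) *\<^sub>C a" by transfer (simp add: algebra_simps)
  show "1 *\<^sub>C a = a" by transfer simp
  show "(r *\<^sub>C a) * b = r *\<^sub>C (a * b)" by transfer simp
  show "a * (r *\<^sub>C b) = r *\<^sub>C (a * b)" by transfer simp
qed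

end

text \<open>Multiplication and derivation operators on coefficient functions on exponent vectors; \<open>od p\<close> says
  that variable number \<open>p\<close> is odd, in which case only the parity of its exponent matters.\<close>

definition wsign :: "(nat \<Rightarrow> bool) \<Rightarrow> nat \<Rightarrow> (nat \<Rightarrow> nat) \<Rightarrow> complex"
  where "wsign od p \<beta> = (if od p then (- 1) ^ (\<Sum>q<p. if od q then \<beta> q else 0) else 1)"

lift_definition x_op :: "(nat \<Rightarrow> bool) \<Rightarrow> nat \<Rightarrow> (nat \<Rightarrow> nat) lin_op" is
  "\<lambda>od p F \<beta>. if \<beta> p = 0 \<or> (od p \<and> even (\<beta> p)) then 0
    else wsign od p \<beta> * F (\<beta>(p := \<beta> p - 1))"
  by (auto simp: fun_eq_iff algebra_simps)

lift_definition d_op :: "(nat \<Rightarrow> bool) \<Rightarrow> nat \<Rightarrow> (nat \<Rightarrow> nat) lin_op" is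
  "\<lambda>od p F \<beta>. wsign od p \<beta> * (if od p then if even (\<beta> p) then 1 else 0 else of_nat (Suc (\<beta> p)))
    * F (\<beta>(p := Suc (\<beta> p)))"
  by (auto simp: fun_eq_iff algebra_simps)

lemma wsign_inc: "wsign od q (\<beta>(p := Suc (\<beta> p))) =
    (if od q \<and> od p \<and> p < q then - 1 else 1) * wsign od q \<beta>"
proof (cases "p < q")
  case True
  have "(\<Sum>r<q. if od r then (\<beta>(p := Suc (\<beta> p))) r else 0) =
      (\<Sum>r<q. (if od r then \<beta> r else 0) + (if r = p then if od p then 1 else 0 else 0))"
    by (rule sum.cong) auto
  also have "\<dots> = (\<Sum>r<q. if od r then \<beta> r else 0) + (if od p then 1 else 0)"
    using True by (simp add: sum.distrib)
  finally show ?thesis using True by (simp add: wsign_def)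
next
  case False
  then have "(\<Sum>r<q. if od r then (\<beta>(p := Suc (\<beta> p))) r else 0) = (\<Sum>r<q. if od r then \<beta> r else 0)"
    by (intro sum.cong) auto
  then show ?thesis using False by (simp add: wsign_def)
qed

lemma wsign_dec:
  assumes "\<beta> p \<noteq> 0"
  shows "wsign od q (\<beta>(p := \<beta> p - 1)) = (if od q \<and> od p \<and> p < q then - 1 else 1) * wsign od q \<beta>"
proof -
  have "(\<beta>(p := \<beta> p - 1))(p := Suc ((\<beta>(p := \<beta> p - 1)) p)) = \<beta>" using assms by auto
  then show ?thesis using wsign_inc[of od q "\<beta>(p := \<beta> p - 1)" p] by auto
qed

lemma wsign_sq: "wsign od q \<beta> * x * (wsign od q \<beta> * y) = x * y"
    "wsign od q \<beta> * (wsign od q \<beta> * x * y) = x * y"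
proof -
  have 1: "wsign od q \<beta> * wsign od q \<beta> = 1"
    by (simp add: wsign_def flip: power_add)
  have "wsign od q \<beta> * x * (wsign od q \<beta> * y) = (wsign od q \<beta> * wsign od q \<beta>) * (x * y)"
    by (simp only: mult_ac)
  then show "wsign od q \<beta> * x * (wsign od q \<beta> * y) = x * y" by (simp only: 1 mult_1)
  have "wsign od q \<beta> * (wsign od q \<beta> * x * y) = (wsign od q \<beta> * wsign od q \<beta>) * (x * y)"
    by (simp only: mult_ac)
  then show "wsign od q \<beta> * (wsign od q \<beta> * x * y) = x * y" by (simp only: 1 mult_1)
qed

lemma lin_op_eqI: "(\<And>F x. Rep_lin_op a F x = Rep_lin_op b F x) \<Longrightarrow> a = b"
  by (simp add: Rep_lin_op_inject[symmetric] fun_eq_iff)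

lemmas lin_op_rep = times_lin_op.rep_eq plus_lin_op.rep_eq cscale_lin_op.rep_eq one_lin_op.rep_eq
  zero_lin_op.rep_eq x_op.rep_eq d_op.rep_eq

lemma x_op_x_op: "x_op od p * x_op od q = (if od p \<and> od q then - 1 else 1) *\<^sub>C (x_op od q * x_op od p)"
proof (rule lin_op_eqI)
  fix F \<beta>
  consider "p = q" | "p < q" | "q < p" by linarith
  then show "Rep_lin_op (x_op od p * x_op od q) F \<beta> =
      Rep_lin_op ((if od p \<and> od q then - 1 else 1) *\<^sub>C (x_op od q * x_op od p)) F \<beta>"
  proof cases
    case 1
    then show ?thesis by (auto simp: lin_op_rep)
  next
    case 2
    then have "p \<noteq> q" by simp
    from 2 show ?thesis by (auto simp: lin_op_rep wsign_dec[unfolded One_nat_def] fun_upd_twist[OF \<open>p \<noteq> q\<close>])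
  next
    case 3
    then have "p \<noteq> q" by simp
    from 3 show ?thesis by (auto simp: lin_op_rep wsign_dec[unfolded One_nat_def] fun_upd_twist[OF \<open>p \<noteq> q\<close>])
  qed
qed

lemma d_op_d_op: "d_op od p * d_op od q = (if od p \<and> od q then - 1 else 1) *\<^sub>C (d_op od q * d_op od p)"
proof (rule lin_op_eqI)
  fix F \<beta>
  consider "p = q" | "p < q" | "q < p" by linarith
  then show "Rep_lin_op (d_op od p * d_op od q) F \<beta> =
      Rep_lin_op ((if od p \<and> od q then - 1 else 1) *\<^sub>C (d_op od q * d_op od p)) F \<beta>"
  proof cases
    case 1
    then show ?thesis by (auto simp: lin_op_rep)
  next
    case 2
    then have "p \<noteq> q" by simp
    from 2 show ?thesis by (auto simp: lin_op_rep wsign_inc fun_upd_twist[OF \<open>p \<noteq> q\<close>])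
  next
    case 3
    then have "p \<noteq> q" by simp
    from 3 show ?thesis by (auto simp: lin_op_rep wsign_inc fun_upd_twist[OF \<open>p \<noteq> q\<close>])
  qed
qed

lemma d_op_x_op: "d_op od p * x_op od q =
  (if od p \<and> od q then - 1 else 1) *\<^sub>C (x_op od q * d_op od p) + (if p = q then 1 else 0)"
proof (rule lin_op_eqI)
  fix F \<beta>
  consider "p = q" | "p < q" | "q < p" by linarith
  then show "Rep_lin_op (d_op od p * x_op od q) F \<beta> =
      Rep_lin_op ((if od p \<and> od q then - 1 else 1) *\<^sub>C (x_op od q * d_op od p) + (if p = q then 1 else 0)) F \<beta>"
  proof cases
    case 1
    have w: "wsign od q (\<beta>(q := n)) = wsign od q \<beta>" for n
    proof -
      have "(\<Sum>r<q. if od r then (\<beta>(q := n)) r else 0) = (\<Sum>r<q. if od r then \<beta> r else 0)"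
        by (rule sum.cong) auto
      then show ?thesis by (simp add: wsign_def)
    qed
    show ?thesis
    proof (cases "\<beta> q")
      case 0
      then have "\<beta>(q := 0) = \<beta>" by auto
      then show ?thesis using 0 1 by (simp add: lin_op_rep w wsign_sq wsign_sq(1)[where x = 1, simplified])
    next
      case (Suc n)
      then have "\<beta>(q := Suc n) = \<beta>" by auto
      then show ?thesis using Suc 1
        by (simp add: lin_op_rep w wsign_sq wsign_sq(1)[where x = 1, simplified] distrib_right)
    qed
  next
    case 2
    then have "p \<noteq> q" by simp
    from 2 show ?thesis by (auto simp: lin_op_rep wsign_inc wsign_dec[unfolded One_nat_def] fun_upd_twist[OF \<open>p \<noteq> q\<close>])
  next
    case 3
    then have "p \<noteq> q" by simp
    from 3 show ?thesis by (auto simp: lin_op_rep wsign_inc wsign_dec[unfolded One_nat_def] fun_upd_twist[OF \<open>p \<noteq> q\<close>])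
  qed
qed

instantiation weyl_gen :: (type, type, type) relations
begin

definition relators_weyl_gen :: "('a, 'b, 'c) weyl_gen free_alg set" where
  "relators_weyl_gen = (let m = CARD('a); N = CARD('a) + CARD('b); K = CARD('c) in
    {free_gen (WX i a) | i a. \<not> (i < N \<and> a < K)} \<union>
    {free_gen (WD i a) | i a. \<not> (i < N \<and> a < K)} \<union>
    {free_gen (WX i a) * free_gen (WX j b)
       - free_const ((- 1) ^ (parity m i * parity m j)) * (free_gen (WX j b) * free_gen (WX i a))
     | i j a b. i < N \<and> j < N \<and> a < K \<and> b < K} \<union>
    {free_gen (WD i a) * free_gen (WD j b)
       - free_const ((- 1) ^ (parity m i * parity m j)) * (free_gen (WD j b) * free_gen (WD i a))
     | i j a b. i < N \<and> j < N \<and> a < K \<and> b < K} \<union>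
    {free_gen (WD i a) * free_gen (WX j b)
       - free_const ((- 1) ^ (parity m i * parity m j)) * (free_gen (WX j b) * free_gen (WD i a))
       - (if i = j \<and> a = b then 1 else 0)
     | i j a b. i < N \<and> j < N \<and> a < K \<and> b < K})"

instance
proof
  let ?m = "CARD('a)" and ?N = "CARD('a) + CARD('b)" and ?K = "CARD('c)"
  define od :: "nat \<Rightarrow> bool" where "od p \<longleftrightarrow> parity ?m (fst (prod_decode p)) = 1" for p
  define f :: "('a, 'b, 'c) weyl_gen \<Rightarrow> (nat \<Rightarrow> nat) lin_op" where
    "f g = (case g of
        WX i a \<Rightarrow> if i < ?N \<and> a < ?K then x_op od (prod_encode (i, a)) else 0
      | WD i a \<Rightarrow> if i < ?N \<and> a < ?K then d_op od (prod_encode (i, a)) else 0)" for g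
  have od: "od (prod_encode (i, a)) \<longleftrightarrow> parity ?m i = 1" for i a by (simp add: od_def)
  have sign: "(- 1 :: complex) ^ (parity ?m i * parity ?m j) =
      (if parity ?m i = 1 \<and> parity ?m j = 1 then - 1 else 1)" for i j
    by (simp add: parity_def)
  let ?c = "\<lambda>i j. (- 1 :: complex) ^ (parity ?m i * parity ?m j)"
  have xx: "f (WX i a) * f (WX j b) = of_cx (?c i j) * (f (WX j b) * f (WX i a))" for i j a b
    by (simp add: f_def sign od of_cx_def mult_cscale_left
        x_op_x_op[of od "prod_encode (i, a)" "prod_encode (j, b)"])
  have dd: "f (WD i a) * f (WD j b) = of_cx (?c i j) * (f (WD j b) * f (WD i a))" for i j a b
    by (simp add: f_def sign od of_cx_def mult_cscale_left
        d_op_d_op[of od "prod_encode (i, a)" "prod_encode (j, b)"])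
  have dx: "f (WD i a) * f (WX j b) =
      of_cx (?c i j) * (f (WX j b) * f (WD i a)) + (if i = j \<and> a = b then 1 else 0)"
    if "i < ?N" "j < ?N" "a < ?K" "b < ?K" for i j a b
    using that by (simp add: f_def sign od of_cx_def mult_cscale_left prod_encode_eq d_op_x_op)
  show "(1 :: ('a, 'b, 'c) weyl_gen free_alg) \<notin> two_sided_ideal relators"
  proof
    assume "(1 :: ('a, 'b, 'c) weyl_gen free_alg) \<in> two_sided_ideal relators"
    then have "free_lift f 1 = 0"
    proof (rule free_lift_ideal[rotated])
      fix r :: "('a, 'b, 'c) weyl_gen free_alg"
      assume "r \<in> relators"
      then show "free_lift f r = 0"
        unfolding relators_weyl_gen_def Let_def
      proof (elim UnE CollectE exE conjE)
        fix i a assume "r = free_gen (WX i a)" "\<not> (i < ?N \<and> a < ?K)"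
        then show "free_lift f r = 0" by (auto simp: f_def)
      next
        fix i a assume "r = free_gen (WD i a)" "\<not> (i < ?N \<and> a < ?K)"
        then show "free_lift f r = 0" by (auto simp: f_def)
      next
        fix i j a b
        assume "r = free_gen (WX i a) * free_gen (WX j b)
          - free_const (?c i j) * (free_gen (WX j b) * free_gen (WX i a))"
        then show "free_lift f r = 0" using xx[of i a j b] by simp
      next
        fix i j a b
        assume "r = free_gen (WD i a) * free_gen (WD j b)
          - free_const (?c i j) * (free_gen (WD j b) * free_gen (WD i a))"
        then show "free_lift f r = 0" using dd[of i a j b] by simp
      next
        fix i j a b
        assume "r = free_gen (WD i a) * free_gen (WX j b)
            - free_const (?c i j) * (free_gen (WX j b) * free_gen (WD i a))
            - (if i = j \<and> a = b then 1 else 0)"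
          and "i < ?N" "j < ?N" "a < ?K" "b < ?K"
        then show "free_lift f r = 0" using dx[of i j a b] by simp
      qed
    qed
    then show False by simp
  qed
qed

end

type_synonym ('m, 'n, 'k) weyl = "('m, 'n, 'k) weyl_gen presented_alg"

definition wx :: "nat \<Rightarrow> nat \<Rightarrow> ('m, 'n, 'k) weyl" where "wx i a = pgen (WX i a)"

definition wd :: "nat \<Rightarrow> nat \<Rightarrow> ('m, 'n, 'k) weyl" where "wd i a = pgen (WD i a)"

definition e_series :: "nat \<Rightarrow> nat \<Rightarrow> ('m, 'n) U_gl_current fls"
  where "e_series i j = Abs_fls (\<lambda>p. if p \<ge> 1 then pgen (GlGen i j (nat (p - 1))) else 0)"

text \<open>Both homomorphisms exist and are unique, see \<open>pi_gl_ex1\<close> and \<open>pi_k_ex1\<close>. The fractions are taken in the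
  field of complex Laurent series in \<open>v\<^sup>-\<^sup>1\<close>, that is, expanded in powers of \<open>v\<^sup>-\<^sup>1\<close>.\<close>

definition pi_gl :: "(nat \<Rightarrow> complex) \<Rightarrow> ('m, 'n) U_gl_current \<Rightarrow> ('m, 'n, 'k) weyl"
  where "pi_gl z = (THE h. calg_hom h \<and> (\<forall>i < CARD('m) + CARD('n). \<forall>j < CARD('m) + CARD('n).
    fls_map h (e_series i j) = (\<Sum>a < CARD('k).
      fls_const (wx i a * wd j a) * fls_map of_cx (1 / (fls_X_inv - fls_const (z a))))))"

definition pi_k :: "(nat \<Rightarrow> complex) \<Rightarrow> ('k, 0) U_gl_current \<Rightarrow> ('m, 'n, 'k) weyl"
  where "pi_k \<Lambda> = (THE h. calg_hom h \<and> (\<forall>a < CARD('k). \<forall>b < CARD('k).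
    fls_map h (e_series a b) = (\<Sum>i < CARD('m) + CARD('n).
      fls_const (wx i a * wd i b) * fls_map of_cx (1 / (fls_X_inv - fls_const (\<Lambda> i))))))"

lemma free_lift_pgen: "free_lift pgen p = abs_presented_alg p"
proof (induction p rule: poly_mapping_induct)
  case zero
  then show ?case by (simp add: zero_presented_alg_def)
next
  case (add k v p)
  have "prod_list (map pgen w) = abs_presented_alg (Poly_Mapping.single (FWord w) 1)" for w :: "'a list"
  proof (induction w)
    case Nil
    then show ?case by (simp add: one_presented_alg_def flip: zero_fword_def)
  next
    case (Cons a w)
    then show ?case
      by (simp add: pgen_def times_presented_alg.abs_eq free_gen_def mult_single plus_fword_def)
  qed
  from this[of "letters k"] show ?case using add
    by (simp add: free_lift_single cscale_presented_alg.abs_eq plus_presented_alg.abs_eq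
        free_const_def mult_single)
qed

lemma free_lift_pgen_relators: "r \<in> relators \<Longrightarrow> free_lift pgen r = 0"
  unfolding free_lift_pgen zero_presented_alg_def
  by (simp add: presented_alg.abs_eq_iff two_sided_ideal.rel)

lemma pgen_gl_out: "\<not> (i < CARD('m) + CARD('n) \<and> j < CARD('m) + CARD('n)) \<Longrightarrow>
    pgen (GlGen i j r :: ('m, 'n) gl_gen) = 0"
proof -
  assume "\<not> (i < CARD('m) + CARD('n) \<and> j < CARD('m) + CARD('n))"
  then have "free_gen (GlGen i j r :: ('m, 'n) gl_gen) \<in> relators"
    unfolding relators_gl_gen_def Let_def by blast
  from free_lift_pgen_relators[OF this] show ?thesis by simp
qed

lemma wx_out: "\<not> (i < CARD('m) + CARD('n) \<and> a < CARD('k)) \<Longrightarrow> (wx i a :: ('m, 'n, 'k) weyl) = 0"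
proof -
  assume "\<not> (i < CARD('m) + CARD('n) \<and> a < CARD('k))"
  then have "free_gen (WX i a :: ('m, 'n, 'k) weyl_gen) \<in> relators"
    unfolding relators_weyl_gen_def Let_def by blast
  from free_lift_pgen_relators[OF this] show ?thesis by (simp add: wx_def)
qed

lemma wd_out: "\<not> (i < CARD('m) + CARD('n) \<and> a < CARD('k)) \<Longrightarrow> (wd i a :: ('m, 'n, 'k) weyl) = 0"
proof -
  assume "\<not> (i < CARD('m) + CARD('n) \<and> a < CARD('k))"
  then have "free_gen (WD i a :: ('m, 'n, 'k) weyl_gen) \<in> relators"
    unfolding relators_weyl_gen_def Let_def by blast
  from free_lift_pgen_relators[OF this] show ?thesis by (simp add: wd_def)
qed

lemma wx_wx: "(wx i a * wx j b :: ('m, 'n, 'k) weyl) =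
    (- 1) ^ (parity CARD('m) i * parity CARD('m) j) *\<^sub>C (wx j b * wx i a)"
proof (cases "(i < CARD('m) + CARD('n) \<and> a < CARD('k)) \<and> (j < CARD('m) + CARD('n) \<and> b < CARD('k))")
  case True
  let ?r = "free_gen (WX i a) * free_gen (WX j b)
       - free_const ((- 1) ^ (parity CARD('m) i * parity CARD('m) j)) * (free_gen (WX j b) * free_gen (WX i a))
       :: ('m, 'n, 'k) weyl_gen free_alg"
  have "?r \<in> relators" using True unfolding relators_weyl_gen_def Let_def by blast
  from free_lift_pgen_relators[OF this] show ?thesis
    by (simp add: wx_def of_cx_def mult_cscale_left)
next
  case False
  then show ?thesis using wx_out[where 'm = 'm and 'n = 'n and 'k = 'k] by auto
qed

lemma wd_wd: "(wd i a * wd j b :: ('m, 'n, 'k) weyl) =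
    (- 1) ^ (parity CARD('m) i * parity CARD('m) j) *\<^sub>C (wd j b * wd i a)"
proof (cases "(i < CARD('m) + CARD('n) \<and> a < CARD('k)) \<and> (j < CARD('m) + CARD('n) \<and> b < CARD('k))")
  case True
  let ?r = "free_gen (WD i a) * free_gen (WD j b)
       - free_const ((- 1) ^ (parity CARD('m) i * parity CARD('m) j)) * (free_gen (WD j b) * free_gen (WD i a))
       :: ('m, 'n, 'k) weyl_gen free_alg"
  have "?r \<in> relators" using True unfolding relators_weyl_gen_def Let_def by blast
  from free_lift_pgen_relators[OF this] show ?thesis
    by (simp add: wd_def of_cx_def mult_cscale_left)
next
  case False
  then show ?thesis using wd_out[where 'm = 'm and 'n = 'n and 'k = 'k] by auto
qed

lemma wd_wx:
  assumes "i < CARD('m) + CARD('n)" "a < CARD('k)" "j < CARD('m) + CARD('n)" "b < CARD('k)"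
  shows "(wd i a * wx j b :: ('m, 'n, 'k) weyl) =
    (- 1) ^ (parity CARD('m) i * parity CARD('m) j) *\<^sub>C (wx j b * wd i a)
      + (if i = j \<and> a = b then 1 else 0)"
proof -
  let ?r = "free_gen (WD i a) * free_gen (WX j b)
       - free_const ((- 1) ^ (parity CARD('m) i * parity CARD('m) j)) * (free_gen (WX j b) * free_gen (WD i a))
       - (if i = j \<and> a = b then 1 else 0) :: ('m, 'n, 'k) weyl_gen free_alg"
  have "?r \<in> relators" using assms unfolding relators_weyl_gen_def Let_def by blast
  from free_lift_pgen_relators[OF this] show ?thesis
    by (auto simp: wx_def wd_def of_cx_def mult_cscale_left algebra_simps split: if_splits)
qed

lemma wx_wd_commutator:
  assumes "i < CARD('m) + CARD('n)" "a < CARD('k)" "j < CARD('m) + CARD('n)" "b < CARD('k)"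
    and "p < CARD('m) + CARD('n)" "c < CARD('k)" "q < CARD('m) + CARD('n)" "d < CARD('k)"
  defines "\<epsilon> \<equiv> (- 1) ^ ((parity CARD('m) i + parity CARD('m) j) * (parity CARD('m) p + parity CARD('m) q))"
  shows "((wx i a * wd j b) * (wx p c * wd q d) :: ('m, 'n, 'k) weyl)
      - \<epsilon> *\<^sub>C ((wx p c * wd q d) * (wx i a * wd j b)) =
    (if j = p \<and> b = c then wx i a * wd q d else 0)
      - \<epsilon> *\<^sub>C (if q = i \<and> d = a then wx p c * wd j b else 0)"
proof -
  let ?s = "\<lambda>i j. (- 1 :: complex) ^ (parity CARD('m) i * parity CARD('m) j)"
  let ?x = "wx :: nat \<Rightarrow> nat \<Rightarrow> ('m, 'n, 'k) weyl" and ?d = "wd :: nat \<Rightarrow> nat \<Rightarrow> ('m, 'n, 'k) weyl"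
  have 1: "(?x i a * ?d j b) * (?x p c * ?d q d) =
      ?s j p *\<^sub>C (?x i a * ?x p c * (?d j b * ?d q d)) + (if j = p \<and> b = c then ?x i a * ?d q d else 0)"
  proof -
    have "(?x i a * ?d j b) * (?x p c * ?d q d) = ?x i a * (?d j b * ?x p c) * ?d q d"
      by (simp only: mult.assoc)
    then show ?thesis
      unfolding wd_wx[OF assms(3,4,5,6)]
      by (simp add: distrib_left distrib_right mult_cscale_left mult_cscale_right mult.assoc)
  qed
  have 2: "(?x p c * ?d q d) * (?x i a * ?d j b) =
      ?s q i *\<^sub>C (?x p c * ?x i a * (?d q d * ?d j b)) + (if q = i \<and> d = a then ?x p c * ?d j b else 0)"
  proof -
    have "(?x p c * ?d q d) * (?x i a * ?d j b) = ?x p c * (?d q d * ?x i a) * ?d j b"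
      by (simp only: mult.assoc)
    then show ?thesis
      unfolding wd_wx[OF assms(7,8,1,2)]
      by (simp add: distrib_left distrib_right mult_cscale_left mult_cscale_right mult.assoc)
  qed
  have "\<epsilon> * (?s q i * (?s q j * ?s p i)) = ?s j p"
    by (simp add: \<epsilon>_def parity_def)
  then have "\<epsilon> *\<^sub>C (?s q i *\<^sub>C (?x p c * ?x i a * (?d q d * ?d j b))) =
      ?s j p *\<^sub>C (?x i a * ?x p c * (?d j b * ?d q d))"
    unfolding wx_wx[of p c i a] wd_wd[of q d j b]
    by (simp add: mult_cscale_left mult_cscale_right cscale_cscale mult.assoc)
  then show ?thesis unfolding 1 2 by (simp add: cscale_add_right)
qed

lemma fls_geometric: "fls_nth (1 / (fls_X_inv - fls_const c) :: complex fls) n =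
    (if n \<ge> 1 then c ^ nat (n - 1) else 0)"
proof -
  define G where "G = Abs_fls (\<lambda>n. if n \<ge> 1 then c ^ nat (n - 1) else 0)"
  have G: "fls_nth G n = (if n \<ge> 1 then c ^ nat (n - 1) else 0)" for n
    unfolding G_def by (subst nth_Abs_fls_lower_bound[of 0]) auto
  have "(fls_X_inv - fls_const c) * G = 1"
  proof (rule fls_eqI)
    fix n
    have "c ^ nat n = c * c ^ nat (n - 1)" if "n \<ge> 1"
      using that by (simp add: nat_diff_distrib flip: power_Suc)
    then show "fls_nth ((fls_X_inv - fls_const c) * G) n = fls_nth 1 n"
      by (auto simp: left_diff_distrib fls_X_inv_times_conv_shift G)
  qed
  then have "1 / (fls_X_inv - fls_const c) = G"
    by (metis mult_zero_left nonzero_mult_div_cancel_left zero_neq_one)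
  then show ?thesis by (simp add: G)
qed

lemma fls_nth_e_series: "fls_nth (e_series i j) n = (if n \<ge> 1 then pgen (GlGen i j (nat (n - 1))) else 0)"
  unfolding e_series_def by (subst nth_Abs_fls_lower_bound[of 0]) auto

lemma calg_hom_zero: "calg_hom h \<Longrightarrow> h 0 = 0"
  unfolding calg_hom_def by (metis cscale_zero_left)

lemma fls_map_e_series_iff:
  fixes h :: "('m, 'n) U_gl_current \<Rightarrow> 'd::complex_algebra"
  assumes h: "h 0 = 0"
  shows "fls_map h (e_series i j) = (\<Sum>a\<in>A. fls_const (y a) *
      fls_map of_cx (1 / (fls_X_inv - fls_const (z a)))) \<longleftrightarrow>
    (\<forall>r. h (pgen (GlGen i j r)) = (\<Sum>a\<in>A. z a ^ r *\<^sub>C y a))" (is "?l = ?r \<longleftrightarrow> _")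
proof -
  have l: "fls_nth ?l n = (if n \<ge> 1 then h (pgen (GlGen i j (nat (n - 1)))) else 0)" for n
    using h by (simp add: fls_nth_map fls_nth_e_series)
  have sum: "fls_nth (\<Sum>a\<in>A. F a) n = (\<Sum>a\<in>A. fls_nth (F a) n)" for F :: "_ \<Rightarrow> 'd fls" and n
    by (induction A rule: infinite_finite_induct) auto
  have r: "fls_nth ?r n = (if n \<ge> 1 then \<Sum>a\<in>A. z a ^ nat (n - 1) *\<^sub>C y a else 0)" for n
    by (simp add: sum fls_nth_map fls_geometric of_cx_def mult_cscale_right)
  show ?thesis
  proof
    assume eq: "?l = ?r"
    show "\<forall>r. h (pgen (GlGen i j r)) = (\<Sum>a\<in>A. z a ^ r *\<^sub>C y a)"
    proof
      fix r
      have "fls_nth ?l (int r + 1) = fls_nth ?r (int r + 1)" by (simp only: eq)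
      then show "h (pgen (GlGen i j r)) = (\<Sum>a\<in>A. z a ^ r *\<^sub>C y a)" unfolding l r by simp
    qed
  next
    assume "\<forall>r. h (pgen (GlGen i j r)) = (\<Sum>a\<in>A. z a ^ r *\<^sub>C y a)"
    then show "?l = ?r" by (intro fls_eqI) (simp only: l r)
  qed
qed

lemma U_gl_current_lift_ex1:
  fixes y :: "nat \<Rightarrow> nat \<Rightarrow> 'a \<Rightarrow> 'd::complex_algebra"
  defines "N \<equiv> CARD('m) + CARD('n)"
  defines "\<epsilon> \<equiv> \<lambda>i j p q. (- 1) ^ ((parity CARD('m) i + parity CARD('m) j) * (parity CARD('m) p + parity CARD('m) q))"
  assumes "finite A"
  assumes comm: "\<And>i j p q a b. i < N \<Longrightarrow> j < N \<Longrightarrow> p < N \<Longrightarrow> q < N \<Longrightarrow> a \<in> A \<Longrightarrow> b \<in> A \<Longrightarrow>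
    y i j a * y p q b - \<epsilon> i j p q *\<^sub>C (y p q b * y i j a) =
      (if j = p \<and> a = b then y i q a else 0) - \<epsilon> i j p q *\<^sub>C (if i = q \<and> a = b then y p j a else 0)"
  shows "\<exists>!h :: ('m, 'n) U_gl_current \<Rightarrow> 'd. calg_hom h \<and> (\<forall>i<N. \<forall>j<N.
    fls_map h (e_series i j) = (\<Sum>a\<in>A. fls_const (y i j a) *
      fls_map of_cx (1 / (fls_X_inv - fls_const (z a)))))"
proof -
  define f where "f g = (case g :: ('m, 'n) gl_gen of GlGen i j r \<Rightarrow>
    if i < N \<and> j < N then \<Sum>a\<in>A. z a ^ r *\<^sub>C y i j a else 0)" for g
  have "(calg_hom h \<and> (\<forall>i<N. \<forall>j<N. fls_map h (e_series i j) = (\<Sum>a\<in>A. fls_const (y i j a) *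
      fls_map of_cx (1 / (fls_X_inv - fls_const (z a)))))) \<longleftrightarrow> (calg_hom h \<and> (\<forall>x. h (pgen x) = f x))"
    for h :: "('m, 'n) U_gl_current \<Rightarrow> 'd"
  proof (cases "calg_hom h")
    case True
    then have h: "h 0 = 0" by (rule calg_hom_zero)
    have "(\<forall>x. h (pgen x) = f x) \<longleftrightarrow>
        (\<forall>i<N. \<forall>j<N. \<forall>r. h (pgen (GlGen i j r)) = (\<Sum>a\<in>A. z a ^ r *\<^sub>C y i j a))"
    proof safe
      fix i j r assume "\<forall>x. h (pgen x) = f x" "i < N" "j < N"
      then show "h (pgen (GlGen i j r)) = (\<Sum>a\<in>A. z a ^ r *\<^sub>C y i j a)" by (simp add: f_def)
    next
      fix x :: "('m, 'n) gl_gen"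
      assume "\<forall>i<N. \<forall>j<N. \<forall>r. h (pgen (GlGen i j r)) = (\<Sum>a\<in>A. z a ^ r *\<^sub>C y i j a)"
      then show "h (pgen x) = f x"
        using h by (cases x) (auto simp: f_def N_def pgen_gl_out)
    qed
    then show ?thesis using True h by (simp add: fls_map_e_series_iff)
  qed simp
  moreover have "\<exists>!h. calg_hom h \<and> (\<forall>x. h (pgen x) = f x)"
  proof (rule presented_alg_lift_ex1)
    have rel: "f (GlGen i j r) * f (GlGen p q s) - \<epsilon> i j p q *\<^sub>C (f (GlGen p q s) * f (GlGen i j r)) =
        (if j = p then f (GlGen i q (r + s)) else 0) -
          \<epsilon> i j p q *\<^sub>C (if i = q then f (GlGen p j (r + s)) else 0)"
      if N: "i < N" "j < N" "p < N" "q < N" for i j p q r s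
    proof -
      have "f (GlGen i j r) * f (GlGen p q s) - \<epsilon> i j p q *\<^sub>C (f (GlGen p q s) * f (GlGen i j r)) =
          (\<Sum>a\<in>A. \<Sum>b\<in>A. (z a ^ r * z b ^ s) *\<^sub>C (y i j a * y p q b)) -
          (\<Sum>a\<in>A. \<Sum>b\<in>A. (z a ^ r * z b ^ s) *\<^sub>C (\<epsilon> i j p q *\<^sub>C (y p q b * y i j a)))"
      proof -
        have "f (GlGen p q s) * f (GlGen i j r) =
            (\<Sum>a\<in>A. \<Sum>b\<in>A. (z a ^ r * z b ^ s) *\<^sub>C (y p q b * y i j a))"
          using N by (simp add: f_def sum_product mult_cscale_left mult_cscale_right cscale_cscale)
            (subst sum.swap, simp add: mult.commute[where 'a = complex])
        then show ?thesis using N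
          by (simp add: f_def sum_product mult_cscale_left mult_cscale_right cscale_cscale
              cscale_sum_right mult.commute[where 'a = complex])
      qed
      also have "\<dots> = (\<Sum>a\<in>A. \<Sum>b\<in>A. (z a ^ r * z b ^ s) *\<^sub>C
          (y i j a * y p q b - \<epsilon> i j p q *\<^sub>C (y p q b * y i j a)))"
        by (simp add: cscale_diff_right sum_subtractf)
      also have "\<dots> = (\<Sum>a\<in>A. \<Sum>b\<in>A. (z a ^ r * z b ^ s) *\<^sub>C
          ((if j = p \<and> a = b then y i q a else 0) - \<epsilon> i j p q *\<^sub>C (if i = q \<and> a = b then y p j a else 0)))"
        by (intro sum.cong refl arg_cong2[where f = cscale] comm N)
      also have "\<dots> = (\<Sum>a\<in>A. \<Sum>b\<in>A. if b = a then z a ^ (r + s) *\<^sub>C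
          ((if j = p then y i q a else 0) - \<epsilon> i j p q *\<^sub>C (if i = q then y p j a else 0)) else 0)"
        by (intro sum.cong refl) (auto simp: power_add)
      also have "\<dots> = (\<Sum>a\<in>A. z a ^ (r + s) *\<^sub>C
          ((if j = p then y i q a else 0) - \<epsilon> i j p q *\<^sub>C (if i = q then y p j a else 0)))"
        using \<open>finite A\<close> by simp
      also have "\<dots> = (if j = p then f (GlGen i q (r + s)) else 0) -
          \<epsilon> i j p q *\<^sub>C (if i = q then f (GlGen p j (r + s)) else 0)"
        using N by (auto simp: f_def cscale_diff_right sum_subtractf cscale_sum_right cscale_cscale
            mult.commute[where 'a = complex] sum_negf cscale_minus_right)
      finally show ?thesis .
    qed
    fix r :: "('m, 'n) gl_gen free_alg"
    assume "r \<in> relators"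
    then show "free_lift f r = 0"
      unfolding relators_gl_gen_def Let_def
    proof (elim UnE CollectE exE conjE)
      fix i j s assume "r = free_gen (GlGen i j s)" "\<not> (i < CARD('m) + CARD('n) \<and> j < CARD('m) + CARD('n))"
      then show "free_lift f r = 0" by (auto simp: f_def N_def)
    next
      fix i j p q s t
      let ?c = "(- 1 :: complex) ^ ((parity CARD('m) i + parity CARD('m) j) * (parity CARD('m) p + parity CARD('m) q))"
      assume r: "r = free_gen (GlGen i j s) * free_gen (GlGen p q t) -
            free_const ?c * (free_gen (GlGen p q t) * free_gen (GlGen i j s)) -
            ((if j = p then free_gen (GlGen i q (s + t)) else 0) -
             free_const ?c * (if i = q then free_gen (GlGen p j (s + t)) else 0))"
        and N: "i < CARD('m) + CARD('n)" "j < CARD('m) + CARD('n)" "p < CARD('m) + CARD('n)" "q < CARD('m) + CARD('n)"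
      show "free_lift f r = 0"
        using rel[of i j p q s t] N unfolding r \<epsilon>_def N_def
        by (auto simp: of_cx_def mult_cscale_left)
    qed
  qed
  ultimately show ?thesis by simp
qed

lemma pi_gl_ex1: "\<exists>!h :: ('m, 'n) U_gl_current \<Rightarrow> ('m, 'n, 'k) weyl. calg_hom h \<and>
    (\<forall>i < CARD('m) + CARD('n). \<forall>j < CARD('m) + CARD('n).
      fls_map h (e_series i j) = (\<Sum>a < CARD('k).
        fls_const (wx i a * wd j a) * fls_map of_cx (1 / (fls_X_inv - fls_const (z a)))))"
  by (rule U_gl_current_lift_ex1) (auto simp: wx_wd_commutator)

lemma pi_k_ex1: "\<exists>!h :: ('k, 0) U_gl_current \<Rightarrow> ('m, 'n, 'k) weyl. calg_hom h \<and>
    (\<forall>a < CARD('k). \<forall>b < CARD('k).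
      fls_map h (e_series a b) = (\<Sum>i < CARD('m) + CARD('n).
        fls_const (wx i a * wd i b) * fls_map of_cx (1 / (fls_X_inv - fls_const (\<Lambda> i)))))"
proof -
  have even: "(- 1 :: complex) ^ ((parity CARD('m) i + parity CARD('m) i) * n) = 1" for i n
    by (simp add: parity_def)
  have comm: "wx a i * wd a j * (wx b p * wd b q) -
      (- 1) ^ ((parity CARD('k) i + parity CARD('k) j) * (parity CARD('k) p + parity CARD('k) q)) *\<^sub>C
        (wx b p * wd b q * (wx a i * wd a j) :: ('m, 'n, 'k) weyl) =
      (if j = p \<and> a = b then wx a i * wd a q else 0) -
      (- 1) ^ ((parity CARD('k) i + parity CARD('k) j) * (parity CARD('k) p + parity CARD('k) q)) *\<^sub>C
        (if i = q \<and> a = b then wx a p * wd a j else 0)"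
    if "i < CARD('k) + CARD(0)" "j < CARD('k) + CARD(0)" "p < CARD('k) + CARD(0)" "q < CARD('k) + CARD(0)"
      "a \<in> {..<CARD('m) + CARD('n)}" "b \<in> {..<CARD('m) + CARD('n)}" for i j p q a b
  proof -
    have "parity CARD('k) i = 0" "parity CARD('k) j = 0" using that by (simp_all add: parity_def)
    then show ?thesis
      using that wx_wd_commutator[where 'm = 'm and 'n = 'n and 'k = 'k, of a i a j b p b q]
      by (auto simp: even cscale_one)
  qed
  from U_gl_current_lift_ex1[where 'm = 'k and 'n = 0 and A = "{..<CARD('m) + CARD('n)}"
      and y = "\<lambda>a b i. (wx i a * wd i b :: ('m, 'n, 'k) weyl)" and z = \<Lambda>, OF finite_lessThan comm]
  show ?thesis by simp
qed

definition ring_inv :: "'a::ring_1 \<Rightarrow> 'a"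
  where "ring_inv x = (THE y. x * y = 1 \<and> y * x = 1)"

definition mat_inv :: "'a::ring_1 mat \<Rightarrow> 'a mat"
  where "mat_inv A = (THE C. C \<in> carrier_mat (dim_row A) (dim_row A) \<and> inverts_mat A C \<and> inverts_mat C A)"

text \<open>The \<open>i\<close>-th principal quasi-minor, \<open>1 \<le> i\<close>; its entry \<open>(i, i)\<close> has index \<open>(i - 1, i - 1)\<close> here.\<close>

definition quasi_minor :: "'a::ring_1 mat \<Rightarrow> nat \<Rightarrow> 'a"
  where "quasi_minor A i =
    ring_inv (index_mat (mat_inv (mat i i (\<lambda>(p, q). index_mat A (p, q)))) (i - 1, i - 1))"

definition berezinian :: "nat \<Rightarrow> nat \<Rightarrow> 'a::ring_1 mat \<Rightarrow> 'a"
  where "berezinian m n A =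
    prod_list (map (quasi_minor A) [1..<m + 1]) *
    prod_list (map (\<lambda>i. ring_inv (quasi_minor A i)) [m + 1..<m + n + 1])"

definition cdet :: "'a::ring_1 mat \<Rightarrow> 'a"
  where "cdet A = (\<Sum>\<sigma> | \<sigma> permutes {..<dim_col A}.
    of_int (sign \<sigma>) * prod_list (map (\<lambda>a. index_mat A (\<sigma> a, a)) [0..<dim_col A]))"

definition B_mat :: "(nat \<Rightarrow> complex) \<Rightarrow> ('m, 'n) U_gl_current fls pdo mat"
  where "B_mat \<Lambda> = mat (CARD('m) + CARD('n)) (CARD('m) + CARD('n)) (\<lambda>(i, j).
    (if i = j then pdo_partial - pdo_const (fls_const (of_cx (\<Lambda> i))) else 0)
      - pdo_const ((- 1) ^ parity CARD('m) i * e_series i j))"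

definition G_mat :: "(nat \<Rightarrow> complex) \<Rightarrow> ('k, 0) U_gl_current fls pdo mat"
  where "G_mat z = mat CARD('k) CARD('k) (\<lambda>(a, b).
    (if a = b then pdo_partial - pdo_const (fls_const (of_cx (z a))) else 0)
      - pdo_const (e_series a b))"

definition Ber_B :: "(nat \<Rightarrow> complex) \<Rightarrow> ('m, 'n) U_gl_current fls pdo"
  where "Ber_B \<Lambda> = berezinian CARD('m) CARD('n) (B_mat \<Lambda>)"

definition bethe_gl :: "(nat \<Rightarrow> complex) \<Rightarrow> ('m, 'n) U_gl_current set"
  where "bethe_gl \<Lambda> = unital_subalgebra
    {pdo_coeff2 (Ber_B \<Lambda>) p r | p r. r \<le> int CARD('m) - int CARD('n)}"

definition bethe_k :: "(nat \<Rightarrow> complex) \<Rightarrow> ('k, 0) U_gl_current set"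
  where "bethe_k z = unital_subalgebra
    {pdo_coeff2 (cdet (G_mat z)) p s | p s. 0 \<le> s \<and> s \<le> int CARD('k)}"

end

theory Submission
  imports Defs
begin

text \<open>The block matrix with diagonal blocks \<open>diag (v - z\<^sub>a)\<close> and \<open>diag (\<partial>\<^sub>v - \<Lambda>\<^sub>i)\<close> and off-diagonal blocks
  \<open>(\<partial>\<^sub>i\<^sub>a)\<close> and \<open>(\<plusminus> x\<^sub>i\<^sub>a)\<close> is a Manin supermatrix, one of whose Schur complements is the image of \<open>B(\<Lambda>)\<close>. The product
  of its quasi-minors, inverted for odd indices, does not change when neighbours in the elimination order
  are exchanged. Eliminating the \<open>v - z\<^sub>a\<close> first gives \<open>\<Prod>(v - z\<^sub>a)\<close> times the Berezinian; eliminating the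
  \<open>\<partial>\<^sub>v - \<Lambda>\<^sub>i\<close> first gives a function of \<open>\<partial>\<^sub>v\<close> times a \<open>k \<times> k\<close> column determinant. Bringing that determinant
  and \<open>cdet G(z)\<close> to normal order replaces both by ordinary determinants of commuting operators that
  multiply from the left and from the right, and these two correspond to each other under
  \<open>u\<^sup>r \<partial>\<^sub>u\<^sup>s \<mapsto> v\<^sup>s \<partial>\<^sub>v\<^sup>r\<close>.\<close>

text \<open>The correspondence of monomials reverses products of functions and derivatives but
  leaves the order of the oscillators alone. It is therefore neither a homomorphism nor an
  antihomomorphism, and it cannot be applied to a determinant factor by factor. Once functions act
  only from the left and derivatives only from the right, it can be checked for each multiplication
  separately; this is the purpose of the normal ordering.

  The exchange of neighbours is one identity between four quasi-minors, proved when a single row of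
  oscillators is adjoined. The Manin relation treats rows and columns differently, and so bosons and
  fermions differ: the Schur complement commutes with the column \<open>L y\<close> for bosons and
  with the row \<open>x L\<close> for fermions, and denominators are cleared on opposite sides.

  Eliminating the derivatives first leaves a matrix with y to the left of x. Reordering it creates
  terms that form the logarithmic derivative of a product of factors \<open>\<tau>\<close> or
  \<open>1 / \<tau>\<close>. Conjugation by this product removes them, and the same product
  corresponds to the rational prefactor in u.\<close>

class two_torsion_free = ring_1 +
  assumes double_eq_0D: "x + x = 0 \<Longrightarrow> x = 0"

section \<open>Units of a noncommutative ring\<close>

definition two_sided_unit :: "'a::ring_1 \<Rightarrow> bool"
  where "two_sided_unit a \<longleftrightarrow> (\<exists>b. a * b = 1 \<and> b * a = 1)"

lemma two_sided_unitI: "a * b = 1 \<Longrightarrow> b * a = 1 \<Longrightarrow> two_sided_unit a"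
  by (auto simp: two_sided_unit_def)

lemma ring_inv_eqI:
  assumes "a * b = 1" "b * a = 1"
  shows "ring_inv a = b"
  unfolding ring_inv_def
proof (rule the_equality)
  fix y assume "a * y = 1 \<and> y * a = 1"
  then show "y = b" using assms by (metis mult.assoc mult_1_left mult_1_right)
qed (use assms in simp)

lemma right_ring_inv [simp]: "two_sided_unit a \<Longrightarrow> a * ring_inv a = 1"
  and left_ring_inv [simp]: "two_sided_unit a \<Longrightarrow> ring_inv a * a = 1"
  by (auto simp: two_sided_unit_def ring_inv_eqI)

lemma ring_inv_cancel [simp]:
  assumes "two_sided_unit a"
  shows "a * (ring_inv a * c) = c" "ring_inv a * (a * c) = c"
  using assms by (simp_all flip: mult.assoc)

lemma two_sided_unit_ring_inv [simp]: "two_sided_unit a \<Longrightarrow> two_sided_unit (ring_inv a)"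
  by (rule two_sided_unitI[of _ a]) simp_all

lemma ring_inv_ring_inv [simp]: "two_sided_unit a \<Longrightarrow> ring_inv (ring_inv a) = a"
  by (rule ring_inv_eqI) simp_all

lemma two_sided_unit_one [simp]: "two_sided_unit 1"
  by (rule two_sided_unitI[of _ 1]) simp_all

lemma two_sided_unit_mult: "two_sided_unit a \<Longrightarrow> two_sided_unit b \<Longrightarrow> two_sided_unit (a * b)"
  by (rule two_sided_unitI[of _ "ring_inv b * ring_inv a"]) (simp_all add: mult.assoc)

lemma two_sided_unit_prod_list:
  "(\<And>a. a \<in> set as \<Longrightarrow> two_sided_unit a) \<Longrightarrow> two_sided_unit (prod_list as)"
  by (induction as) (simp_all add: two_sided_unit_mult)

lemma ring_inv_commute:
  assumes "two_sided_unit a" "a * c = c * a"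
  shows "ring_inv a * c = c * ring_inv a"
proof -
  have "ring_inv a * (c * a) * ring_inv a = c * ring_inv a"
    using assms by (simp add: mult.assoc flip: assms(2))
  then show ?thesis using assms(1) by (simp add: mult.assoc)
qed

lemma unit_right_cancel: "two_sided_unit a \<Longrightarrow> b * a = c * a \<Longrightarrow> b = c"
  by (metis mult.assoc mult_1_right right_ring_inv)

lemma unit_left_cancel: "two_sided_unit a \<Longrightarrow> a * b = a * c \<Longrightarrow> b = c"
  by (metis ring_inv_cancel(2))

lemma prod_list_commute:
  fixes c :: "'a::monoid_mult"
  assumes "\<And>a. a \<in> set as \<Longrightarrow> a * c = c * a"
  shows "prod_list as * c = c * prod_list as"
  using assms
proof (induction as)
  case (Cons a as)
  then show ?case by (metis list.set_intros mult.assoc prod_list.Cons)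
qed simp

subsection \<open>Matrices over a ring and quasi-minors\<close>

text \<open>The size is separate from the entries, so that leading blocks of all sizes share one
  function and no submatrices have to be formed. Entries with an index from \<open>n\<close> on are
  unconstrained.\<close>

definition mat_inverse_on :: "nat \<Rightarrow> (nat \<Rightarrow> nat \<Rightarrow> 'a::ring_1) \<Rightarrow> (nat \<Rightarrow> nat \<Rightarrow> 'a) \<Rightarrow> bool"
  where "mat_inverse_on n A C \<longleftrightarrow> (\<forall>i<n. \<forall>j<n.
    (\<Sum>l<n. A i l * C l j) = (if i = j then 1 else 0) \<and>
    (\<Sum>l<n. C i l * A l j) = (if i = j then 1 else 0))"

lemma mat_inverse_onD:
  assumes "mat_inverse_on n A C" "i < n" "j < n"
  shows "(\<Sum>l<n. A i l * C l j) = (if i = j then 1 else 0)"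
    "(\<Sum>l<n. C i l * A l j) = (if i = j then 1 else 0)"
  using assms by (auto simp: mat_inverse_on_def)

lemma sum_delta_mult:
  fixes f :: "nat \<Rightarrow> 'a::ring_1"
  shows "i < n \<Longrightarrow> (\<Sum>l<n. (if i = l then 1 else 0) * f l) = f i"
    "j < n \<Longrightarrow> (\<Sum>l<n. f l * (if l = j then 1 else 0)) = f j"
  by (simp_all add: if_distribR if_distrib cong: if_cong)

lemma mat_inverse_on_unique:
  assumes "mat_inverse_on n A C" "mat_inverse_on n A D" "i < n" "j < n"
  shows "C i j = D i j"
proof -
  have "C i j = (\<Sum>l<n. C i l * (\<Sum>p<n. A l p * D p j))"
    using assms by (simp add: mat_inverse_onD sum_delta_mult)
  also have "\<dots> = (\<Sum>p<n. (\<Sum>l<n. C i l * A l p) * D p j)"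
    by (simp add: sum_distrib_left sum_distrib_right mult.assoc) (rule sum.swap)
  also have "\<dots> = D i j"
    using assms by (simp add: mat_inverse_onD sum_delta_mult)
  finally show ?thesis .
qed

text \<open>Here \<open>C\<close> is the inverse of the upper left block, and \<open>d\<close> is its Schur complement.\<close>

definition bordered_inverse ::
    "nat \<Rightarrow> (nat \<Rightarrow> nat \<Rightarrow> 'a::ring_1) \<Rightarrow> (nat \<Rightarrow> 'a) \<Rightarrow> (nat \<Rightarrow> 'a) \<Rightarrow> 'a \<Rightarrow> nat \<Rightarrow> nat \<Rightarrow> 'a"
  where "bordered_inverse n C r c d p q =
    (if p < n \<and> q < n then C p q + (\<Sum>l<n. C p l * c l) * ring_inv d * (\<Sum>l<n. r l * C l q)
     else if p < n then - ((\<Sum>l<n. C p l * c l) * ring_inv d)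
     else if q < n then - (ring_inv d * (\<Sum>l<n. r l * C l q))
     else ring_inv d)"

text \<open>Block inversion by elimination. With \<open>u\<close> and \<open>w\<close> the border
  column and row multiplied by \<open>C\<close>, the matrix sends \<open>u\<close> back to the
  border column, and both corner products equal \<open>A n n - D\<close>; everything else
  cancels.\<close>

lemma mat_inverse_on_bordered:
  fixes A :: "nat \<Rightarrow> nat \<Rightarrow> 'a::ring_1"
  defines "d \<equiv> \<lambda>n C. A n n - (\<Sum>p<n. \<Sum>q<n. A n p * C p q * A q n)"
  assumes C: "mat_inverse_on n A C" and unit: "two_sided_unit (d n C)"
  shows "mat_inverse_on (Suc n) A (bordered_inverse n C (A n) (\<lambda>p. A p n) (d n C))"
proof -
  define u where "u p = (\<Sum>l<n. C p l * A l n)" for p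
  define w where "w q = (\<Sum>l<n. A n l * C l q)" for q
  define D where "D = d n C"
  define E where "E = ring_inv D"
  have DE: "D * E = 1" "E * D = 1" using unit by (simp_all add: D_def E_def)
  let ?B = "bordered_inverse n C (A n) (\<lambda>p. A p n) (d n C)"
  have B: "p < n \<Longrightarrow> q < n \<Longrightarrow> ?B p q = C p q + u p * E * w q"
    "p < n \<Longrightarrow> ?B p n = - (u p * E)" "q < n \<Longrightarrow> ?B n q = - (E * w q)" "?B n n = E" for p q
    by (simp_all add: bordered_inverse_def u_def w_def E_def D_def)
  have Au: "(\<Sum>l<n. A i l * u l) = A i n" if "i < n" for i
  proof -
    have "(\<Sum>l<n. A i l * u l) = (\<Sum>p<n. (\<Sum>l<n. A i l * C l p) * A p n)"
      unfolding u_def by (simp add: sum_distrib_left sum_distrib_right mult.assoc) (rule sum.swap)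
    then show ?thesis using that C by (simp add: mat_inverse_onD sum_delta_mult)
  qed
  have wA: "(\<Sum>l<n. w l * A l j) = A n j" if "j < n" for j
  proof -
    have "(\<Sum>l<n. w l * A l j) = (\<Sum>p<n. A n p * (\<Sum>l<n. C p l * A l j))"
      unfolding w_def by (simp add: sum_distrib_left sum_distrib_right mult.assoc) (rule sum.swap)
    then show ?thesis using that C by (simp add: mat_inverse_onD sum_delta_mult)
  qed
  have Anu: "(\<Sum>l<n. A n l * u l) = A n n - D"
    unfolding u_def D_def d_def by (simp add: sum_distrib_left mult.assoc)
  have wAn: "(\<Sum>l<n. w l * A l n) = A n n - D"
  proof -
    have "(\<Sum>l<n. w l * A l n) = (\<Sum>p<n. \<Sum>q<n. A n p * C p q * A q n)"
      unfolding w_def by (simp add: sum_distrib_right) (rule sum.swap)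
    then show ?thesis by (simp add: D_def d_def)
  qed
  have pull: "(\<Sum>l<n. a l * (b l * c)) = (\<Sum>l<n. a l * b l) * c" for a b :: "nat \<Rightarrow> 'a" and c
    by (simp add: sum_distrib_right mult.assoc)
  have pull': "(\<Sum>l<n. c * a l * b l) = c * (\<Sum>l<n. a l * b l)" for a b :: "nat \<Rightarrow> 'a" and c
    by (simp add: sum_distrib_left mult.assoc)
  show ?thesis
    unfolding mat_inverse_on_def
  proof (intro allI impI conjI)
    fix i j assume ij: "i < Suc n" "j < Suc n"
    then consider "i < n" "j < n" | "i < n" "j = n" | "i = n" "j < n" | "i = n" "j = n" by linarith
    then show "(\<Sum>l<Suc n. A i l * ?B l j) = (if i = j then 1 else 0)"
    proof cases
      case 1
      then have "(\<Sum>l<Suc n. A i l * ?B l j) =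
          (\<Sum>l<n. A i l * C l j) + (\<Sum>l<n. A i l * u l) * (E * w j) - A i n * (E * w j)"
        by (simp add: B distrib_left sum.distrib mult.assoc pull)
      then show ?thesis using 1 C by (simp add: Au mat_inverse_onD)
    next
      case 2
      then have "(\<Sum>l<Suc n. A i l * ?B l j) = - ((\<Sum>l<n. A i l * u l) * E) + A i n * E"
        by (simp add: B sum_negf pull)
      then show ?thesis using 2 by (simp add: Au)
    next
      case 3
      then have "(\<Sum>l<Suc n. A i l * ?B l j) = w j + (\<Sum>l<n. A n l * u l) * (E * w j) - A n n * (E * w j)"
        by (simp add: B distrib_left sum.distrib mult.assoc pull w_def)
      then show ?thesis using 3 DE by (simp add: Anu left_diff_distrib flip: mult.assoc)
    next
      case 4
      then have "(\<Sum>l<Suc n. A i l * ?B l j) = - ((\<Sum>l<n. A n l * u l) * E) + A n n * E"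
        by (simp add: B sum_negf pull)
      then show ?thesis using 4 DE by (simp add: Anu left_diff_distrib)
    qed
    from ij consider "i < n" "j < n" | "i < n" "j = n" | "i = n" "j < n" | "i = n" "j = n" by linarith
    then show "(\<Sum>l<Suc n. ?B i l * A l j) = (if i = j then 1 else 0)"
    proof cases
      case 1
      then have "(\<Sum>l<Suc n. ?B i l * A l j) =
          (\<Sum>l<n. C i l * A l j) + u i * E * (\<Sum>l<n. w l * A l j) - u i * E * A n j"
        by (simp add: B distrib_right sum.distrib pull')
      then show ?thesis using 1 C by (simp add: wA mat_inverse_onD)
    next
      case 2
      then have "(\<Sum>l<Suc n. ?B i l * A l j) = u i + u i * E * (\<Sum>l<n. w l * A l n) - u i * E * A n n"
        by (simp add: B distrib_right sum.distrib pull' flip: u_def)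
      then show ?thesis using 2 DE by (simp add: wAn right_diff_distrib mult.assoc)
    next
      case 3
      then have "(\<Sum>l<Suc n. ?B i l * A l j) = - (E * (\<Sum>l<n. w l * A l j)) + E * A n j"
        by (simp add: B sum_negf pull')
      then show ?thesis using 3 by (simp add: wA)
    next
      case 4
      then have "(\<Sum>l<Suc n. ?B i l * A l j) = - (E * (\<Sum>l<n. w l * A l n)) + E * A n n"
        by (simp add: B sum_negf pull')
      then show ?thesis using 4 DE by (simp add: wAn right_diff_distrib)
    qed
  qed
qed

lemma mat_inverse_on_JNF:
  assumes "mat_inverse_on n (\<lambda>i j. index_mat A (i, j)) C" "A \<in> carrier_mat n n"
  shows "mat_inv A = mat n n (\<lambda>(i, j). C i j)"
proof -
  have inv: "A * mat n n (\<lambda>(i, j). C i j) = 1\<^sub>m n" "mat n n (\<lambda>(i, j). C i j) * A = 1\<^sub>m n"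
    using assms(2) mat_inverse_onD[OF assms(1)]
    by (auto intro!: eq_matI simp: scalar_prod_def atLeast0LessThan)
  show ?thesis
    unfolding mat_inv_def
  proof (rule the_equality)
    show "mat n n (\<lambda>(i, j). C i j) \<in> carrier_mat (dim_row A) (dim_row A) \<and>
        inverts_mat A (mat n n (\<lambda>(i, j). C i j)) \<and> inverts_mat (mat n n (\<lambda>(i, j). C i j)) A"
      using assms(2) inv by (simp add: inverts_mat_def)
    fix D assume D: "D \<in> carrier_mat (dim_row A) (dim_row A) \<and> inverts_mat A D \<and> inverts_mat D A"
    then have D': "D \<in> carrier_mat n n" "A * D = 1\<^sub>m n" "D * A = 1\<^sub>m n"
      using assms(2) by (auto simp: inverts_mat_def)
    have "D = (mat n n (\<lambda>(i, j). C i j) * A) * D" using D' by (simp add: inv)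
    also have "\<dots> = mat n n (\<lambda>(i, j). C i j) * (A * D)"
      using D' assms(2) by (intro assoc_mult_mat) auto
    also have "\<dots> = mat n n (\<lambda>(i, j). C i j)" by (simp add: D')
    finally show "D = mat n n (\<lambda>(i, j). C i j)" .
  qed
qed

text \<open>Quasi-minors are numbered from 1, so the one of the block of size \<open>Suc i\<close>
  sits at the entry \<open>(i, i)\<close>. Since inverses are unique, any inverse in function form
  may be used for the description in \<open>mat_inv\<close>.\<close>

lemma quasi_minor_eq:
  assumes "mat_inverse_on (Suc i) A C" "i < n"
  shows "quasi_minor (mat n n (\<lambda>(p, q). A p q)) (Suc i) = ring_inv (C i i)"
proof -
  have "mat_inverse_on (Suc i) (\<lambda>p q. index_mat (mat (Suc i) (Suc i)
      (\<lambda>(p, q). index_mat (mat n n (\<lambda>(p, q). A p q)) (p, q))) (p, q)) C"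
    using assms by (simp add: mat_inverse_on_def)
  from mat_inverse_on_JNF[OF this] show ?thesis
    by (simp add: quasi_minor_def)
qed

subsection \<open>Alternating sums\<close>

definition alt_sum :: "nat \<Rightarrow> ((nat \<Rightarrow> nat) \<Rightarrow> 'a::ring_1) \<Rightarrow> 'a"
  where "alt_sum n F = (\<Sum>\<sigma> | \<sigma> permutes {..<n}. of_int (sign \<sigma>) * F \<sigma>)"

lemma alt_sum_cong: "(\<And>\<sigma>. \<sigma> permutes {..<n} \<Longrightarrow> F \<sigma> = G \<sigma>) \<Longrightarrow> alt_sum n F = alt_sum n G"
  unfolding alt_sum_def by (rule sum.cong) simp_all

lemma alt_sum_diff: "alt_sum n (\<lambda>\<sigma>. F \<sigma> - G \<sigma>) = alt_sum n F - alt_sum n G"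
  by (simp add: alt_sum_def right_diff_distrib sum_subtractf)

lemma alt_sum_inverse: "alt_sum n (\<lambda>\<sigma>. F (inv_into UNIV \<sigma>)) = alt_sum n F"
proof -
  have "alt_sum n (\<lambda>\<sigma>. F (inv_into UNIV \<sigma>)) =
      (\<Sum>\<sigma> | \<sigma> permutes {..<n}. of_int (sign (inv_into UNIV \<sigma>)) * F (inv_into UNIV \<sigma>))"
    unfolding alt_sum_def
    by (intro sum.cong refl)
      (metis (no_types, lifting) finite_lessThan mem_Collect_eq permutes_imp_permutation sign_inverse)
  also have "\<dots> = alt_sum n F"
    unfolding alt_sum_def by (rule sum_permutations_inverse[symmetric])
  finally show ?thesis .
qed

text \<open>Composing with the transposition shows that the sum equals its own negative. This is
  where 2-torsion has to be excluded.\<close>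

lemma alt_sum_symmetric_eq_0:
  fixes F :: "(nat \<Rightarrow> nat) \<Rightarrow> 'a::two_torsion_free"
  assumes "c < n" "d < n" "c \<noteq> d"
    and sym: "\<And>\<sigma>. \<sigma> permutes {..<n} \<Longrightarrow> F (\<sigma> \<circ> Transposition.transpose c d) = F \<sigma>"
  shows "alt_sum n F = 0"
proof -
  let ?t = "Transposition.transpose c d"
  have t: "?t permutes {..<n}" using assms by (intro permutes_swap_id) auto
  have "alt_sum n F = (\<Sum>\<sigma> | \<sigma> permutes {..<n}. of_int (sign (\<sigma> \<circ> ?t)) * F (\<sigma> \<circ> ?t))"
    unfolding alt_sum_def by (rule sum_permutations_compose_right[OF t])
  also have "\<dots> = (\<Sum>\<sigma> | \<sigma> permutes {..<n}. - (of_int (sign \<sigma>) * F \<sigma>))"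
  proof (intro sum.cong refl)
    fix \<sigma> assume "\<sigma> \<in> {\<sigma>. \<sigma> permutes {..<n}}"
    then have s: "\<sigma> permutes {..<n}" by simp
    have "sign (\<sigma> \<circ> ?t) = - sign \<sigma>"
      using permutes_imp_permutation[OF finite_lessThan s] permutes_imp_permutation[OF finite_lessThan t]
        assms(3) by (simp add: sign_compose sign_swap_id)
    then show "of_int (sign (\<sigma> \<circ> ?t)) * F (\<sigma> \<circ> ?t) = - (of_int (sign \<sigma>) * F \<sigma>)"
      by (simp add: sym[OF s])
  qed
  also have "\<dots> = - alt_sum n F" by (simp add: alt_sum_def sum_negf)
  finally show ?thesis by (rule double_eq_0D[OF iffD1[OF eq_neg_iff_add_eq_0]])
qed

text \<open>In an alternating sum a factor may be moved past the others as soon as its commutators with them are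
  symmetric in the two row indices. The additive context \<open>\<Phi>\<close> carries the columns not involved.\<close>

lemma alt_sum_move:
  fixes A :: "nat \<Rightarrow> nat \<Rightarrow> 'a::two_torsion_free" and \<Phi> :: "(nat \<Rightarrow> nat) \<Rightarrow> 'a \<Rightarrow> 'a"
  assumes "distinct (c0 # cs)" "set (c0 # cs) \<subseteq> {..<n}"
    and "\<And>\<sigma> u v. \<Phi> \<sigma> (u + v) = \<Phi> \<sigma> u + \<Phi> \<sigma> v"
    and "\<And>\<sigma> c u. c \<in> set cs \<Longrightarrow> \<Phi> (\<sigma> \<circ> Transposition.transpose c c0) u = \<Phi> \<sigma> u"
    and comm: "\<And>a b c. a < n \<Longrightarrow> b < n \<Longrightarrow> c < n \<Longrightarrow>
      X a * A b c - A b c * X a = X b * A a c - A a c * X b"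
  shows "alt_sum n (\<lambda>\<sigma>. \<Phi> \<sigma> (X (\<sigma> c0) * prod_list (map (\<lambda>c. A (\<sigma> c) c) cs))) =
    alt_sum n (\<lambda>\<sigma>. \<Phi> \<sigma> (prod_list (map (\<lambda>c. A (\<sigma> c) c) cs) * X (\<sigma> c0)))"
  using assms(1-4)
proof (induction cs arbitrary: \<Phi>)
  case Nil
  then show ?case by simp
next
  case (Cons c cs)
  let ?P = "\<lambda>\<sigma>. prod_list (map (\<lambda>c. A (\<sigma> c) c) cs)"
  have diff: "\<Phi> \<sigma> (u - v) = \<Phi> \<sigma> u - \<Phi> \<sigma> v" for \<sigma> u v
    using Cons.prems(3)[of \<sigma> "u - v" v] by simp
  have "alt_sum n (\<lambda>\<sigma>. \<Phi> \<sigma> (X (\<sigma> c0) * (A (\<sigma> c) c * ?P \<sigma>))) -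
      alt_sum n (\<lambda>\<sigma>. \<Phi> \<sigma> (A (\<sigma> c) c * (X (\<sigma> c0) * ?P \<sigma>))) =
      alt_sum n (\<lambda>\<sigma>. \<Phi> \<sigma> ((X (\<sigma> c0) * A (\<sigma> c) c - A (\<sigma> c) c * X (\<sigma> c0)) * ?P \<sigma>))"
    unfolding alt_sum_diff[symmetric] left_diff_distrib diff mult.assoc ..
  \<comment> \<open>\<open>comm\<close> says that the commutator keeps its value when the rows
    \<open>\<sigma> c0\<close> and \<open>\<sigma> c\<close> are exchanged.\<close>
  also have "\<dots> = 0"
  proof (rule alt_sum_symmetric_eq_0[of c n c0])
    fix \<sigma> assume s: "\<sigma> permutes {..<n}"
    have lt: "\<sigma> c0 < n" "\<sigma> c < n" "c < n"
      using Cons.prems(2) permutes_in_image[OF s] by auto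
    have "?P (\<sigma> \<circ> Transposition.transpose c c0) = ?P \<sigma>"
      using Cons.prems(1) by (intro arg_cong[where f = prod_list] map_cong refl)
        (auto simp: Transposition.transpose_def)
    then show "\<Phi> (\<sigma> \<circ> Transposition.transpose c c0)
        ((X ((\<sigma> \<circ> Transposition.transpose c c0) c0) * A ((\<sigma> \<circ> Transposition.transpose c c0) c) c -
          A ((\<sigma> \<circ> Transposition.transpose c c0) c) c * X ((\<sigma> \<circ> Transposition.transpose c c0) c0)) *
          ?P (\<sigma> \<circ> Transposition.transpose c c0)) =
        \<Phi> \<sigma> ((X (\<sigma> c0) * A (\<sigma> c) c - A (\<sigma> c) c * X (\<sigma> c0)) * ?P \<sigma>)"
      unfolding Cons.prems(4)[OF list.set_intros(1)] using comm[OF lt(2,1,3)] by simp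
  qed (use Cons.prems(1,2) in auto)
  finally have "alt_sum n (\<lambda>\<sigma>. \<Phi> \<sigma> (X (\<sigma> c0) * (A (\<sigma> c) c * ?P \<sigma>))) =
      alt_sum n (\<lambda>\<sigma>. \<Phi> \<sigma> (A (\<sigma> c) c * (X (\<sigma> c0) * ?P \<sigma>)))" by simp
  \<comment> \<open>The factor just passed joins the context \<open>\<Phi>\<close>. Later
    transpositions leave it alone, because \<open>c\<close> is neither \<open>c0\<close> nor in
    \<open>cs\<close>.\<close>
  also have "\<dots> = alt_sum n (\<lambda>\<sigma>. \<Phi> \<sigma> (A (\<sigma> c) c * (?P \<sigma> * X (\<sigma> c0))))"
  proof (rule Cons.IH)
    fix \<sigma> c' u assume "c' \<in> set cs"
    then show "\<Phi> (\<sigma> \<circ> Transposition.transpose c' c0)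
        (A ((\<sigma> \<circ> Transposition.transpose c' c0) c) c * u) = \<Phi> \<sigma> (A (\<sigma> c) c * u)"
      using Cons.prems(1) unfolding Cons.prems(4)[OF list.set_intros(2)[OF \<open>c' \<in> set cs\<close>]]
      by (auto simp: Transposition.transpose_def)
  next
    show "distinct (c0 # cs)" "set (c0 # cs) \<subseteq> {..<n}" using Cons.prems(1,2) by auto
    show "\<Phi> \<sigma> (A (\<sigma> c) c * (u + v)) = \<Phi> \<sigma> (A (\<sigma> c) c * u) + \<Phi> \<sigma> (A (\<sigma> c) c * v)" for \<sigma> u v
      by (simp add: distrib_left Cons.prems(3))
  qed
  finally show ?case by (simp add: mult.assoc)
qed

subsection \<open>Rank-one updates of Manin matrices\<close>

text \<open>The relation distinguishes columns from rows: entries of one column commute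
  (\<open>manin_column\<close>), while for two entries of one row it is void. The asymmetry between
  \<open>x\<close> and \<open>y\<close> below originates here.\<close>

definition manin :: "nat \<Rightarrow> (nat \<Rightarrow> nat \<Rightarrow> 'a::ring_1) \<Rightarrow> bool"
  where "manin n A \<longleftrightarrow> (\<forall>a<n. \<forall>b<n. \<forall>c<n. \<forall>e<n.
    A a b * A c e - A c e * A a b = A c b * A a e - A a e * A c b)"

lemma maninD: "manin n A \<Longrightarrow> a < n \<Longrightarrow> b < n \<Longrightarrow> c < n \<Longrightarrow> e < n \<Longrightarrow>
    A a b * A c e - A c e * A a b = A c b * A a e - A a e * A c b"
  by (simp add: manin_def)

lemma eq_neg_self_0: "(x :: 'a::two_torsion_free) = - x \<Longrightarrow> x = 0"
  by (rule double_eq_0D[OF iffD1[OF eq_neg_iff_add_eq_0]])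

lemma manin_column:
  fixes A :: "nat \<Rightarrow> nat \<Rightarrow> 'a::two_torsion_free"
  assumes "manin n A" "a < n" "b < n" "c < n"
  shows "A a b * A c b = A c b * A a b"
proof -
  have "A a b * A c b - A c b * A a b = - (A a b * A c b - A c b * A a b)"
    using maninD[OF assms(1), of a b c b] assms(2-4) by simp
  from eq_neg_self_0[OF this] show ?thesis by simp
qed

definition row_times :: "nat \<Rightarrow> (nat \<Rightarrow> 'a::ring_1) \<Rightarrow> (nat \<Rightarrow> nat \<Rightarrow> 'a) \<Rightarrow> nat \<Rightarrow> 'a"
  where "row_times n x L b = (\<Sum>a<n. x a * L a b)"

definition times_col :: "nat \<Rightarrow> (nat \<Rightarrow> nat \<Rightarrow> 'a::ring_1) \<Rightarrow> (nat \<Rightarrow> 'a) \<Rightarrow> nat \<Rightarrow> 'a"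
  where "times_col n L y a = (\<Sum>b<n. L a b * y b)"

definition schur :: "nat \<Rightarrow> (nat \<Rightarrow> nat \<Rightarrow> 'a::ring_1) \<Rightarrow> (nat \<Rightarrow> 'a) \<Rightarrow> (nat \<Rightarrow> 'a) \<Rightarrow> 'a \<Rightarrow> 'a"
  where "schur n L x y \<tau> = \<tau> - (\<Sum>a<n. \<Sum>b<n. x a * L a b * y b)"

text \<open>If \<open>L\<close> is the inverse of \<open>A\<close>, this is the inverse of \<open>A - y \<tau>\<^sup>-\<^sup>1 x\<close>.\<close>

definition rank_one_update ::
    "nat \<Rightarrow> (nat \<Rightarrow> nat \<Rightarrow> 'a::ring_1) \<Rightarrow> (nat \<Rightarrow> 'a) \<Rightarrow> (nat \<Rightarrow> 'a) \<Rightarrow> 'a \<Rightarrow> nat \<Rightarrow> nat \<Rightarrow> 'a"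
  where "rank_one_update n L x y \<tau> a b =
    L a b + times_col n L y a * ring_inv (schur n L x y \<tau>) * row_times n x L b"

text \<open>The entries of \<open>x\<close> and \<open>y\<close> are bosonic oscillators, or fermionic ones if \<open>od\<close> holds. In the fermionic case
  \<open>x\<close> includes the sign of the parity, which makes the right-hand side of the relation \<open>y x + x y = - 1\<close> negative.\<close>

locale rank_one_step =
  fixes j :: nat and L :: "nat \<Rightarrow> nat \<Rightarrow> 'r::two_torsion_free" and x y :: "nat \<Rightarrow> 'r"
    and \<tau> :: 'r and od :: bool
  assumes xL: "\<And>a b c. a < j \<Longrightarrow> b < j \<Longrightarrow> c < j \<Longrightarrow> x a * L b c = L b c * x a"
    and yL: "\<And>a b c. a < j \<Longrightarrow> b < j \<Longrightarrow> c < j \<Longrightarrow> y a * L b c = L b c * y a"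
    and \<tau>x: "\<And>a. \<tau> * x a = x a * \<tau>"
    and \<tau>y: "\<And>a. \<tau> * y a = y a * \<tau>"
    and xx: "\<And>a b. x a * x b = (if od then - (x b * x a) else x b * x a)"
    and yy: "\<And>a b. y a * y b = (if od then - (y b * y a) else y b * y a)"
    and yx: "\<And>a b. a < j \<Longrightarrow> b < j \<Longrightarrow> y a * x b =
      (if od then - (x b * y a) - (if a = b then 1 else 0) else x b * y a + (if a = b then 1 else 0))"
    and \<tau>L: "\<And>a b. a < j \<Longrightarrow> b < j \<Longrightarrow> \<tau> * L a b = L a b * \<tau> - (\<Sum>c<j. L a c * L c b)"
    and maninL: "manin j L"
begin

abbreviation "X \<equiv> row_times j x L"
abbreviation "Y \<equiv> times_col j L y"
abbreviation "d \<equiv> schur j L x y \<tau>"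
abbreviation "L' \<equiv> rank_one_update j L x y \<tau>"

lemmas X_def = row_times_def[of j x L]
lemmas Y_def = times_col_def[of j L y]
lemmas d_def = schur_def[of j L x y \<tau>]
lemmas L'_def = rank_one_update_def[of j L x y \<tau>]

lemma d_X: "d = \<tau> - (\<Sum>b<j. X b * y b)"
  unfolding d_def X_def by (subst sum.swap) (simp add: sum_distrib_right)

lemma d_Y: "d = \<tau> - (\<Sum>a<j. x a * Y a)"
  unfolding d_def Y_def by (simp add: sum_distrib_left mult.assoc)

lemma yX: "r < j \<Longrightarrow> b < j \<Longrightarrow> y r * X b = (if od then - (X b * y r) - L r b else X b * y r + L r b)"
proof -
  assume rb: "r < j" "b < j"
  have "y r * X b = (\<Sum>a<j. (y r * x a) * L a b)" by (simp add: X_def sum_distrib_left mult.assoc)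
  also have "\<dots> = (\<Sum>a<j. if od then - (x a * L a b * y r) - (if r = a then 1 else 0) * L a b
      else x a * L a b * y r + (if r = a then 1 else 0) * L a b)"
    using rb by (intro sum.cong refl)
      (simp only: yx yL[symmetric] lessThan_iff mult.assoc left_diff_distrib distrib_right minus_mult_left split: if_splits, simp)
  also have "\<dots> = (if od then - (X b * y r) - L r b else X b * y r + L r b)"
    using rb unfolding X_def
    by (simp add: sum_subtractf sum_negf sum.distrib sum_delta_mult sum_distrib_right)
  finally show ?thesis .
qed

lemma Yx: "r < j \<Longrightarrow> b < j \<Longrightarrow> Y r * x b = (if od then - (x b * Y r) - L r b else x b * Y r + L r b)"
proof -
  assume rb: "r < j" "b < j"
  have "Y r * x b = (\<Sum>a<j. L r a * (y a * x b))" by (simp add: Y_def sum_distrib_right mult.assoc)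
  also have "\<dots> = (\<Sum>a<j. if od then - (x b * (L r a * y a)) - L r a * (if a = b then 1 else 0)
      else x b * (L r a * y a) + L r a * (if a = b then 1 else 0))"
  proof (intro sum.cong refl)
    fix a assume "a \<in> {..<j}"
    then have a: "a < j" by simp
    have "L r a * (x b * y a) = x b * (L r a * y a)"
      using xL[OF rb(2) rb(1) a] by (simp flip: mult.assoc)
    then show "L r a * (y a * x b) = (if od then - (x b * (L r a * y a)) - L r a * (if a = b then 1 else 0)
      else x b * (L r a * y a) + L r a * (if a = b then 1 else 0))"
      using yx[OF a rb(2)] by (simp add: distrib_left right_diff_distrib)
  qed
  also have "\<dots> = (if od then - (x b * Y r) - L r b else x b * Y r + L r b)"
    using rb unfolding Y_def
    by (simp add: sum_subtractf sum_negf sum.distrib sum_delta_mult sum_distrib_left)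
  finally show ?thesis .
qed

text \<open>Under exchange of the summation indices, the commutator of the two entries of
  \<open>L\<close> changes sign by the Manin relation while the product of two bosonic
  \<open>y\<close> does not. The difference \<open>D\<close> of the two products is thus its own
  negative.\<close>

lemma YY:
  assumes "\<not> od" "a < j" "c < j"
  shows "Y a * Y c = Y c * Y a"
proof -
  define D where "D = (\<Sum>p<j. \<Sum>r<j. (L a p * L c r - L c r * L a p) * (y p * y r))"
  have 1: "Y a * Y c = (\<Sum>p<j. \<Sum>r<j. (L a p * L c r) * (y p * y r))"
  proof -
    have "Y a * Y c = (\<Sum>p<j. \<Sum>r<j. L a p * (y p * L c r) * y r)"
      by (simp add: Y_def sum_product mult.assoc)
    then show ?thesis using assms by (simp add: yL mult.assoc)
  qed
  have 2: "Y c * Y a = (\<Sum>p<j. \<Sum>r<j. (L c r * L a p) * (y p * y r))"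
  proof -
    have "Y c * Y a = (\<Sum>r<j. \<Sum>p<j. L c r * (y r * L a p) * y p)"
      by (simp add: Y_def sum_product mult.assoc)
    also have "\<dots> = (\<Sum>p<j. \<Sum>r<j. L c r * (y r * L a p) * y p)" by (rule sum.swap)
    also have "\<dots> = (\<Sum>p<j. \<Sum>r<j. (L c r * L a p) * (y p * y r))"
    proof (intro sum.cong refl)
      fix p r assume "p \<in> {..<j}" "r \<in> {..<j}"
      then show "L c r * (y r * L a p) * y p = (L c r * L a p) * (y p * y r)"
        using assms yy[of r p] by (simp add: yL mult.assoc)
    qed
    finally show ?thesis .
  qed
  have "D = (\<Sum>p<j. \<Sum>r<j. - ((L a r * L c p - L c p * L a r) * (y r * y p)))"
    unfolding D_def
  proof (intro sum.cong refl)
    fix p r assume "p \<in> {..<j}" "r \<in> {..<j}"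
    then have "L a p * L c r - L c r * L a p = L c p * L a r - L a r * L c p"
      using maninD[OF maninL] assms by simp
    moreover have "y p * y r = y r * y p" using yy[of p r] assms by simp
    ultimately show "(L a p * L c r - L c r * L a p) * (y p * y r) =
        - ((L a r * L c p - L c p * L a r) * (y r * y p))"
      by (simp only: minus_mult_left minus_diff_eq)
  qed
  also have "\<dots> = - D" unfolding D_def by (subst sum.swap) (simp add: sum_negf)
  finally have "D = 0" by (rule eq_neg_self_0)
  then show ?thesis unfolding 1 2 D_def by (simp add: left_diff_distrib sum_subtractf)
qed

text \<open>Symmetrizing two entries of \<open>L\<close> in their columns makes them symmetric in
  their rows as well, by the Manin relation. Paired with anticommuting \<open>x\<close>, such an
  expression vanishes.\<close>

lemma XX:
  assumes "od" "b < j" "c < j"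
  shows "X b * X c = - (X c * X b)"
proof -
  define D where "D = (\<Sum>a<j. \<Sum>p<j. (x a * x p) * (L a b * L p c + L a c * L p b))"
  have 1: "X u * X v = (\<Sum>a<j. \<Sum>p<j. (x a * x p) * (L a u * L p v))" if "u < j" "v < j" for u v
  proof -
    have "X u * X v = (\<Sum>a<j. \<Sum>p<j. x a * (L a u * x p) * L p v)"
      by (simp add: X_def sum_product mult.assoc)
    then show ?thesis using that by (simp add: xL[symmetric] mult.assoc)
  qed
  have "D = (\<Sum>a<j. \<Sum>p<j. - ((x p * x a) * (L p b * L a c + L p c * L a b)))"
    unfolding D_def
  proof (intro sum.cong refl)
    fix a p assume "a \<in> {..<j}" "p \<in> {..<j}"
    then have "L a b * L p c - L p c * L a b = L p b * L a c - L a c * L p b"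
      using maninD[OF maninL] assms by simp
    then have "L a b * L p c + L a c * L p b = L p b * L a c + L p c * L a b"
      by (simp add: algebra_simps)
    moreover have "x a * x p = - (x p * x a)" using xx[of a p] assms by simp
    ultimately show "(x a * x p) * (L a b * L p c + L a c * L p b) =
        - ((x p * x a) * (L p b * L a c + L p c * L a b))"
      by (simp only: minus_mult_left)
  qed
  also have "\<dots> = - D" unfolding D_def by (subst sum.swap) (simp add: sum_negf)
  finally have "D = 0" by (rule eq_neg_self_0)
  moreover have "D = X b * X c + X c * X b"
    using assms by (simp add: 1 D_def distrib_left sum.distrib)
  ultimately show ?thesis by (simp add: eq_neg_iff_add_eq_0)
qed

text \<open>The Manin relation brings the first of two factors \<open>L\<close> to the left of
  \<open>x\<close>. Moving \<open>y\<close> past \<open>X b\<close> then contributes a sum of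
  products \<open>L L\<close>, which cancels the one coming from \<open>\<tau>L\<close>; only
  products of \<open>X\<close> and \<open>Y\<close> survive.\<close>

lemma dL:
  assumes "a < j" "b < j"
  shows "d * L a b = L a b * d + X b * Y a - (if od then - (Y a * X b) else Y a * X b)"
proof -
  have 1: "d * L a b = L a b * \<tau> - (\<Sum>c<j. L a c * L c b) -
      (\<Sum>p<j. \<Sum>r<j. x p * (L p r * L a b) * y r)"
    using assms by (simp add: d_def left_diff_distrib sum_distrib_right \<tau>L yL mult.assoc)
  have 2: "L a b * d = L a b * \<tau> - (\<Sum>p<j. \<Sum>r<j. x p * (L a b * L p r) * y r)"
  proof -
    have "L a b * d = L a b * \<tau> - (\<Sum>p<j. \<Sum>r<j. (L a b * x p) * L p r * y r)"
      by (simp add: d_def right_diff_distrib sum_distrib_left mult.assoc)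
    then show ?thesis using assms by (simp add: xL[symmetric] mult.assoc)
  qed
  have "(\<Sum>p<j. \<Sum>r<j. x p * (L p r * L a b) * y r) - (\<Sum>p<j. \<Sum>r<j. x p * (L a b * L p r) * y r) =
      (\<Sum>p<j. \<Sum>r<j. x p * (L a r * L p b) * y r) - (\<Sum>p<j. \<Sum>r<j. x p * (L p b * L a r) * y r)"
    unfolding sum_subtractf[symmetric] left_diff_distrib[symmetric] right_diff_distrib[symmetric]
    using assms maninD[OF maninL] by simp
  also have "(\<Sum>p<j. \<Sum>r<j. x p * (L a r * L p b) * y r) = (\<Sum>r<j. L a r * (X b * y r))"
  proof -
    have "(\<Sum>p<j. \<Sum>r<j. x p * (L a r * L p b) * y r) = (\<Sum>r<j. \<Sum>p<j. (x p * L a r) * L p b * y r)"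
      by (subst sum.swap) (simp add: mult.assoc)
    then show ?thesis using assms
      by (simp add: X_def xL sum_distrib_left sum_distrib_right mult.assoc)
  qed
  also have "(\<Sum>p<j. \<Sum>r<j. x p * (L p b * L a r) * y r) = X b * Y a"
    by (simp add: X_def Y_def sum_product mult.assoc)
  also have "(\<Sum>r<j. L a r * (X b * y r)) =
      (\<Sum>r<j. L a r * ((if od then - (y r * X b) else y r * X b) - L r b))"
    using assms yX by (intro sum.cong refl arg_cong2[where f = "(*)"]) simp
  also have "\<dots> = (if od then - (Y a * X b) else Y a * X b) - (\<Sum>c<j. L a c * L c b)"
    by (simp add: Y_def right_diff_distrib sum_subtractf sum_negf sum_distrib_right mult.assoc)
  finally show ?thesis unfolding 1 2 by (simp add: algebra_simps)
qed

text \<open>The term created when \<open>\<tau>\<close> passes \<open>L\<close> inside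
  \<open>Y\<close> is cancelled by the contraction of \<open>Y\<close> with \<open>x\<close> inside
  \<open>d\<close>. For fermions, \<open>dX\<close> is the same cancellation on the side of the
  row.\<close>

lemma dY:
  assumes "\<not> od" "b < j"
  shows "d * Y b = Y b * d"
proof -
  have "\<tau> * Y b = (\<Sum>c<j. L b c * \<tau> * y c - (\<Sum>r<j. L b r * L r c) * y c)"
    using assms by (simp add: Y_def sum_distrib_left \<tau>L left_diff_distrib flip: mult.assoc)
  also have "\<dots> = Y b * \<tau> - (\<Sum>c<j. \<Sum>r<j. L b r * L r c * y c)"
    by (simp add: Y_def sum_subtractf sum_distrib_right \<tau>y mult.assoc)
  also have "(\<Sum>c<j. \<Sum>r<j. L b r * L r c * y c) = (\<Sum>r<j. L b r * Y r)"
    by (subst sum.swap) (simp add: Y_def sum_distrib_left mult.assoc)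
  finally have 1: "\<tau> * Y b = Y b * \<tau> - (\<Sum>r<j. L b r * Y r)" .
  have "Y b * d = Y b * \<tau> - (\<Sum>a<j. (Y b * x a) * Y a)"
    by (simp add: d_Y right_diff_distrib sum_distrib_left mult.assoc)
  also have "(\<Sum>a<j. (Y b * x a) * Y a) = (\<Sum>a<j. x a * (Y a * Y b) + L b a * Y a)"
    using assms by (intro sum.cong refl) (simp add: Yx YY distrib_right mult.assoc)
  finally show ?thesis
    by (simp add: d_Y left_diff_distrib 1 sum.distrib sum_distrib_right mult.assoc)
qed

lemma dX:
  assumes "od" "b < j"
  shows "d * X b = X b * d"
proof -
  have "\<tau> * X b = (\<Sum>a<j. x a * (L a b * \<tau>) - x a * (\<Sum>r<j. L a r * L r b))"
  proof -
    have "\<tau> * X b = (\<Sum>a<j. (\<tau> * x a) * L a b)" by (simp add: X_def sum_distrib_left mult.assoc)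
    also have "\<dots> = (\<Sum>a<j. x a * (\<tau> * L a b))" by (simp only: \<tau>x mult.assoc)
    also have "\<dots> = (\<Sum>a<j. x a * (L a b * \<tau>) - x a * (\<Sum>r<j. L a r * L r b))"
      using assms by (intro sum.cong refl) (simp add: \<tau>L right_diff_distrib)
    finally show ?thesis .
  qed
  also have "\<dots> = X b * \<tau> - (\<Sum>a<j. \<Sum>r<j. x a * L a r * L r b)"
    by (simp add: X_def sum_subtractf sum_distrib_left sum_distrib_right mult.assoc)
  also have "(\<Sum>a<j. \<Sum>r<j. x a * L a r * L r b) = (\<Sum>r<j. X r * L r b)"
    by (subst sum.swap) (simp add: X_def sum_distrib_right)
  finally have 1: "\<tau> * X b = X b * \<tau> - (\<Sum>r<j. X r * L r b)" .
  have "d * X b = \<tau> * X b - (\<Sum>c<j. X c * (y c * X b))"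
    by (simp add: d_X left_diff_distrib sum_distrib_right mult.assoc)
  also have "(\<Sum>c<j. X c * (y c * X b)) = (\<Sum>c<j. X b * (X c * y c) - X c * L c b)"
  proof (intro sum.cong refl)
    fix c assume "c \<in> {..<j}"
    then have c: "c < j" by simp
    have "X c * (y c * X b) = - (X c * X b) * y c - X c * L c b"
      using yX[OF c assms(2)] assms(1) by (simp add: right_diff_distrib mult.assoc)
    then show "X c * (y c * X b) = X b * (X c * y c) - X c * L c b"
      using XX[OF assms(1,2) c] by (simp flip: mult.assoc)
  qed
  finally show ?thesis
    by (simp add: d_X right_diff_distrib 1 sum_subtractf sum_distrib_left)
qed

lemma manin_swap: "a < j \<Longrightarrow> b < j \<Longrightarrow> c < j \<Longrightarrow> e < j \<Longrightarrow>
    L a b * L c e - L c b * L a e = L c e * L a b - L a e * L c b"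
  using maninD[OF maninL, of a b c e] by (simp add: algebra_simps)

text \<open>The Manin relation contracted with \<open>y\<close> in a column index;
  \<open>XL_swap\<close> contracts a row index with \<open>x\<close>. Both hold for either
  statistics, because \<open>x\<close> and \<open>y\<close> commute with \<open>L\<close>.\<close>

lemma YL_swap:
  assumes "a < j" "b < j" "c < j"
  shows "Y a * L c b - Y c * L a b = L c b * Y a - L a b * Y c"
proof -
  have "Y a * L c b - Y c * L a b = (\<Sum>p<j. (L a p * L c b - L c p * L a b) * y p)"
    using assms by (simp add: Y_def sum_distrib_right sum_subtractf left_diff_distrib yL mult.assoc)
  also have "\<dots> = (\<Sum>p<j. (L c b * L a p - L a b * L c p) * y p)"
    using assms manin_swap by (intro sum.cong refl) simp
  also have "\<dots> = L c b * Y a - L a b * Y c"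
    by (simp add: Y_def sum_distrib_left sum_subtractf left_diff_distrib mult.assoc)
  finally show ?thesis .
qed

lemma XL_swap:
  assumes "b < j" "e < j" "c < j"
  shows "X b * L c e + X e * L c b = L c b * X e + L c e * X b"
proof -
  have "X b * L c e + X e * L c b = (\<Sum>p<j. x p * (L p b * L c e + L p e * L c b))"
    by (simp add: X_def sum_distrib_right sum.distrib distrib_left mult.assoc)
  also have "\<dots> = (\<Sum>p<j. x p * (L c b * L p e + L c e * L p b))"
  proof (intro sum.cong refl arg_cong2[where f = "(*)"])
    fix p assume "p \<in> {..<j}"
    then show "L p b * L c e + L p e * L c b = L c b * L p e + L c e * L p b"
      using maninD[OF maninL, of p b c e] assms by (simp add: algebra_simps)
  qed
  also have "\<dots> = (\<Sum>p<j. (x p * L c b) * L p e) + (\<Sum>p<j. (x p * L c e) * L p b)"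
    by (simp add: sum.distrib distrib_left mult.assoc)
  also have "\<dots> = L c b * X e + L c e * X b"
    using assms by (simp add: X_def sum_distrib_left xL mult.assoc)
  finally show ?thesis .
qed

text \<open>The denominator of \<open>L'\<close> can be cleared only on the side where
  \<open>d\<close> commutes with its neighbour: from the right for fermions (\<open>dX\<close>),
  from the left for bosons (\<open>dY\<close>). The result lets the next row of oscillators be
  adjoined under the same hypotheses.\<close>

lemma manin_L':
  assumes unit: "two_sided_unit d"
  shows "manin j L'"
  unfolding manin_def
proof (intro allI impI)
  fix a b c e assume *: "a < j" "b < j" "c < j" "e < j"
  \<comment> \<open>\<open>M\<close> is \<open>L'\<close> with \<open>d\<close> cleared. By
    \<open>dL\<close> it has two expressions: the one with \<open>d\<close> on the inner side
    cancels the denominator of the neighbouring \<open>L'\<close>, the other pulls \<open>d\<close>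
    out of the product.\<close>
  define M where "M a b = (if od then L a b * d + Y a * X b else d * L a b + Y a * X b)" for a b
  have M: "M a b = (if od then d * L a b - X b * Y a else L a b * d + X b * Y a)"
    if "a < j" "b < j" for a b
    using dL[OF that] by (simp add: M_def)
  text \<open>The Manin relation says that the part of \<open>L'\<^sub>a\<^sub>b L'\<^sub>c\<^sub>e\<close> symmetric in \<open>b, e\<close> and antisymmetric in \<open>a, c\<close>
    vanishes. Clearing the denominator \<open>d\<close> on one side, it becomes a relation between \<open>L\<close>, \<open>X\<close>, \<open>Y\<close>.\<close>
  define E where "E f a b c e = f a b c e + f a e c b - f c b a e - f c e a b"
    for f :: "nat \<Rightarrow> nat \<Rightarrow> nat \<Rightarrow> nat \<Rightarrow> 'r" and a b c e
  have LL: "E (\<lambda>a b c e. L a b * L c e) a b c e = 0"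
    using maninD[OF maninL *] by (simp add: E_def algebra_simps)
  have YL: "Y a * L c b = Y c * L a b + L c b * Y a - L a b * Y c" "Y a * L c e = Y c * L a e + L c e * Y a - L a e * Y c"
    using YL_swap[of a b c] YL_swap[of a e c] * by (simp_all add: algebra_simps)
  have XL: "X b * L c e = L c b * X e + L c e * X b - X e * L c b"
    "X b * L a e = L a b * X e + L a e * X b - X e * L a b"
    using XL_swap[of b e c] XL_swap[of b e a] * by (simp_all add: algebra_simps)
  have main: "E (\<lambda>a b c e. L' a b * L' c e) a b c e = 0"
  proof (cases od)
    case True
    have L': "L' a b * d = M a b" if "a < j" "b < j" for a b
    proof -
      have "ring_inv d * X b = X b * ring_inv d"
        using ring_inv_commute[OF unit dX[OF True that(2)]] .
      then show ?thesis using True unit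
        by (simp add: L'_def M_def distrib_right mult.assoc)
    qed
    \<comment> \<open>The quartic terms cancel in \<open>E\<close>, which is symmetric in
      \<open>b\<close> and \<open>e\<close>, because the two \<open>X\<close> anticommute.\<close>
    have XdX: "Y u * ring_inv d * X v * (X w * Y t) = - (Y u * ring_inv d * X w * (X v * Y t))"
      if "v < j" "w < j" for u v w t
      using XX[OF True that] by (simp add: mult.assoc) (simp flip: mult.assoc)
    have YdX: "Y a * ring_inv d * X b * (d * L c e) = Y a * X b * L c e" if "b < j" for a b c e
      using ring_inv_commute[OF unit dX[OF True that]] unit dX[OF True that] by (simp add: mult.assoc)
    have "E (\<lambda>a b c e. L' a b * L' c e) a b c e * d = E (\<lambda>a b c e. L' a b * M c e) a b c e"
      using * by (simp add: E_def left_diff_distrib distrib_right mult.assoc L')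
    also have "\<dots> = E (\<lambda>a b c e. L a b * (d * L c e - X e * Y c) +
        (Y a * X b * L c e - Y a * ring_inv d * X b * (X e * Y c))) a b c e"
      using * True unfolding E_def L'_def
      by (simp add: M distrib_right right_diff_distrib YdX)
    also have "\<dots> = E (\<lambda>a b c e. L a b * (L c e * d + Y c * X e) +
        (Y a * X b * L c e - Y a * ring_inv d * X b * (X e * Y c))) a b c e"
    proof -
      have "d * L a b - X b * Y a = L a b * d + Y a * X b" if "a < j" "b < j" for a b
        using M[OF that] True by (simp add: M_def)
      then show ?thesis using * by (simp add: E_def)
    qed
    also have "\<dots> = E (\<lambda>a b c e. L a b * L c e) a b c e * d + E (\<lambda>a b c e. L a b * Y c * X e + Y a * X b * L c e) a b c e"
      using * XdX[of b e a c] XdX[of b e c a] unfolding E_def by (simp add: algebra_simps)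
    also have "E (\<lambda>a b c e. L a b * Y c * X e + Y a * X b * L c e) a b c e =
       L a b * Y c * X e + L a e * Y c * X b - L c b * Y a * X e - L c e * Y a * X b +
       Y a * (X b * L c e + X e * L c b) - Y c * (X b * L a e + X e * L a b)"
      by (simp add: E_def algebra_simps)
    also have "\<dots> = (L a b * Y c - L c b * Y a + Y a * L c b - Y c * L a b) * X e +
        (L a e * Y c - L c e * Y a + Y a * L c e - Y c * L a e) * X b"
      using * by (simp add: XL algebra_simps)
    also have "\<dots> = 0" by (simp add: YL)
    finally have "E (\<lambda>a b c e. L' a b * L' c e) a b c e * d = 0 * d" by (simp add: LL)
    then show ?thesis using unit by (metis unit_right_cancel)
  next
    case False
    have L': "d * L' a b = M a b" if "a < j" "b < j" for a b
    proof -
      have "d * (Y a * ring_inv d * X b) = Y a * X b"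
        using dY[OF False that(1)] unit by (simp flip: mult.assoc) (simp add: mult.assoc)
      then show ?thesis using False by (simp add: L'_def M_def distrib_left)
    qed
    \<comment> \<open>Now the antisymmetry of \<open>E\<close> in \<open>a\<close> and
      \<open>c\<close>, against commuting \<open>Y\<close>, removes the quartic terms.\<close>
    have YdY: "X t * Y u * (Y v * ring_inv d * X w) = X t * Y v * (Y u * ring_inv d * X w)"
      if "u < j" "v < j" for t u v w
      using YY[OF False that] by (simp add: mult.assoc) (simp flip: mult.assoc)
    have dYX: "L a b * d * (Y c * ring_inv d * X e) = L a b * Y c * X e" if "c < j" for a b c e
    proof -
      have "d * (Y c * (ring_inv d * X e)) = Y c * X e"
        using dY[OF False that] unit by (simp flip: mult.assoc) (simp add: mult.assoc)
      then show ?thesis by (simp add: mult.assoc)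
    qed
    have "d * E (\<lambda>a b c e. L' a b * L' c e) a b c e = E (\<lambda>a b c e. M a b * L' c e) a b c e"
      using * by (simp add: E_def right_diff_distrib distrib_left L' flip: mult.assoc)
    also have "\<dots> = E (\<lambda>a b c e. L a b * d * L c e + L a b * Y c * X e + X b * Y a * L c e +
        X b * Y a * (Y c * ring_inv d * X e)) a b c e"
      using * False unfolding E_def L'_def
      by (simp add: M distrib_right distrib_left dYX add.assoc)
    also have "\<dots> = E (\<lambda>a b c e. L a b * (d * L c e + Y c * X e) + X b * Y a * L c e) a b c e"
      using * YdY[of c a b e] YdY[of c a e b] unfolding E_def by (simp add: algebra_simps)
    also have "\<dots> = E (\<lambda>a b c e. L a b * (L c e * d + X e * Y c) + X b * Y a * L c e) a b c e"
    proof -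
      have "d * L a b + Y a * X b = L a b * d + X b * Y a" if "a < j" "b < j" for a b
        using M[OF that] False by (simp add: M_def)
      then show ?thesis using * by (simp add: E_def)
    qed
    also have "\<dots> = E (\<lambda>a b c e. L a b * L c e) a b c e * d +
       (L a b * X e * Y c + L a e * X b * Y c - L c b * X e * Y a - L c e * X b * Y a +
       X b * (Y a * L c e - Y c * L a e) + X e * (Y a * L c b - Y c * L a b))"
      by (simp add: E_def algebra_simps)
    also have "\<dots> = E (\<lambda>a b c e. L a b * L c e) a b c e * d +
       (L a b * X e + L a e * X b - X b * L a e - X e * L a b) * Y c +
       (X b * L c e + X e * L c b - L c b * X e - L c e * X b) * Y a"
      by (simp add: YL algebra_simps)
    also have "\<dots> = 0" by (simp add: LL XL)
    finally have "d * E (\<lambda>a b c e. L' a b * L' c e) a b c e = d * 0" by simp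
    then show ?thesis using unit by (metis unit_left_cancel)
  qed
  then show "L' a b * L' c e - L' c e * L' a b = L' c b * L' a e - L' a e * L' c b"
    by (simp add: E_def algebra_simps)
qed

text \<open>The bracket is the Schur complement of \<open>\<tau>\<close> over the smaller block
  (\<open>\<delta>_Suc\<close>), so the factors are the last two pivots in both orders of
  elimination. After clearing denominators only \<open>dL\<close> at the entry \<open>(k, k)\<close>
  is left: \<open>X k\<close> commutes with \<open>L k k\<close> because their entries of
  \<open>L\<close> lie in one column, and for fermions \<open>X k * X k = 0\<close> removes the
  quartic term.\<close>

lemma exchange:
  assumes j: "j = Suc k" and unit: "two_sided_unit d" "two_sided_unit (L k k)" "two_sided_unit (L' k k)"
  shows "\<not> od \<Longrightarrow> ring_inv (L k k) * d = (d + X k * ring_inv (L k k) * Y k) * ring_inv (L' k k)"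
    and "od \<Longrightarrow> (d + X k * ring_inv (L k k) * Y k) * ring_inv (L k k) = ring_inv (L' k k) * d"
proof -
  let ?q = "ring_inv (L k k)"
  have k: "k < j" using j by simp
  have XL: "X k * L k k = L k k * X k"
  proof -
    have "X k * L k k = (\<Sum>a<j. x a * (L k k * L a k))"
      using manin_column[OF maninL _ k k] by (simp add: X_def sum_distrib_right mult.assoc)
    also have "\<dots> = (\<Sum>a<j. (x a * L k k) * L a k)" by (simp add: mult.assoc)
    also have "\<dots> = L k k * X k"
      using k by (simp add: xL X_def sum_distrib_left mult.assoc)
    finally show ?thesis .
  qed
  have qX: "?q * X k = X k * ?q"
    using ring_inv_commute[OF unit(2)] XL by simp
  have L': "L' k k = L k k + Y k * ring_inv d * X k" by (simp add: L'_def)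
  {
    assume "\<not> od"
    then have dY: "Y k * d = d * Y k" and dL: "d * L k k = L k k * d + X k * Y k - Y k * X k"
      using dY[OF _ k] dL[OF k k] by simp_all
    have "d * L' k k = d * L k k + Y k * X k"
    proof -
      have "d * (Y k * ring_inv d * X k) = Y k * (d * ring_inv d) * X k"
        by (simp only: dY[symmetric] flip: mult.assoc)
      then show ?thesis using unit(1) by (simp add: L' distrib_left)
    qed
    also have "\<dots> = L k k * d + L k k * (X k * ?q * Y k)"
      using unit(2) by (simp add: dL XL[symmetric] qX[symmetric] flip: mult.assoc)
    finally have "?q * (d * L' k k) = d + X k * ?q * Y k"
      using unit(2) by (simp add: distrib_left)
    then have "(d + X k * ?q * Y k) * ring_inv (L' k k) = ?q * d * (L' k k * ring_inv (L' k k))"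
      by (simp flip: mult.assoc)
    then show "?q * d = (d + X k * ?q * Y k) * ring_inv (L' k k)" using unit(3) by simp
  next
    assume od: "od"
    then have dX: "d * X k = X k * d" and dL: "d * L k k = L k k * d + X k * Y k + Y k * X k"
      and XX: "X k * X k = 0"
      using dX[OF _ k] dL[OF k k] eq_neg_self_0[OF XX[OF od k k]] by simp_all
    have 0: "ring_inv d * X k = X k * ring_inv d" by (rule ring_inv_commute[OF unit(1) dX])
    have "Y k * ring_inv d * X k * (X k * ?q * Y k) = 0"
      using XX by (metis mult.assoc mult_zero_left mult_zero_right)
    then have "L' k k * (d + X k * ?q * Y k) = L k k * d + L k k * (X k * ?q * Y k) + Y k * X k"
      using unit(1) by (simp add: L' distrib_left distrib_right mult.assoc dX[symmetric])
    also have "L k k * (X k * ?q * Y k) = X k * Y k"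
      using unit(2) by (simp add: qX[symmetric] mult.assoc)
    finally have "L' k k * (d + X k * ?q * Y k) = d * L k k" by (simp add: dL)
    then have "L' k k * ((d + X k * ?q * Y k) * ?q) = d"
      using unit(2) by (simp flip: mult.assoc) (simp add: mult.assoc)
    then show "(d + X k * ?q * Y k) * ?q = ring_inv (L' k k) * d"
      using unit(3) by (metis ring_inv_cancel(2))
  }
qed

end

subsection \<open>Column determinants\<close>

definition col_det :: "nat \<Rightarrow> (nat \<Rightarrow> nat \<Rightarrow> 'a::ring_1) \<Rightarrow> 'a"
  where "col_det n A = alt_sum n (\<lambda>\<sigma>. prod_list (map (\<lambda>c. A (\<sigma> c) c) [0..<n]))"

lemma cdet_mat: "cdet (mat n n (\<lambda>(a, b). A a b)) = col_det n A"
  unfolding cdet_def col_det_def alt_sum_def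
proof (simp, intro sum.cong refl arg_cong2[where f = "(*)"] arg_cong[where f = prod_list] map_cong)
  fix \<sigma> a assume "\<sigma> \<in> {\<sigma>. \<sigma> permutes {..<n}}" "a \<in> set [0..<n]"
  then show "mat n n (\<lambda>(a, b). A a b) $$ (\<sigma> a, a) = A (\<sigma> a) a"
    using permutes_in_image[of \<sigma> "{..<n}" a] by simp
qed

text \<open>\<open>alt_sum_move\<close> carries the repeated column next to its twin. Entries of one
  column commute, so the summand is then symmetric in the two rows.\<close>

lemma alt_sum_equal_columns:
  fixes A :: "nat \<Rightarrow> nat \<Rightarrow> 'a::two_torsion_free"
  assumes A: "manin (Suc n) A" and l: "l < n"
  shows "alt_sum (Suc n) (\<lambda>\<sigma>. prod_list (map (\<lambda>c. A (\<sigma> c) c) [0..<n]) * A (\<sigma> n) l) = 0"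
proof -
  have split: "[0..<n] = [0..<l] @ l # [Suc l..<n]"
    using l upt_add_eq_append[of 0 l "n - l"] by (simp add: upt_conv_Cons)
  define P where "P cs \<sigma> = prod_list (map (\<lambda>c. A (\<sigma> c) c) cs)" for cs \<sigma>
  have P_inv: "P cs (\<sigma> \<circ> Transposition.transpose c d) = P cs \<sigma>"
    if "c \<notin> set cs" "d \<notin> set cs" for cs \<sigma> c d
    unfolding P_def using that
    by (intro arg_cong[where f = prod_list] map_cong refl) (auto simp: Transposition.transpose_def)
  have "alt_sum (Suc n) (\<lambda>\<sigma>. P [0..<n] \<sigma> * A (\<sigma> n) l) =
      alt_sum (Suc n) (\<lambda>\<sigma>. P [0..<l] \<sigma> * (A (\<sigma> l) l * (P [Suc l..<n] \<sigma> * A (\<sigma> n) l)))"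
    by (simp add: P_def split mult.assoc)
  also have "\<dots> = alt_sum (Suc n) (\<lambda>\<sigma>. P [0..<l] \<sigma> * (A (\<sigma> l) l * (A (\<sigma> n) l * P [Suc l..<n] \<sigma>)))"
    unfolding P_def[of "[Suc l..<n]"]
  proof (rule alt_sum_move[symmetric, of n "[Suc l..<n]" "Suc n"
        "\<lambda>\<sigma> u. P [0..<l] \<sigma> * (A (\<sigma> l) l * u)" "\<lambda>a. A a l" A])
    fix \<sigma> c u assume "c \<in> set [Suc l..<n]"
    then show "P [0..<l] (\<sigma> \<circ> Transposition.transpose c n) *
        (A ((\<sigma> \<circ> Transposition.transpose c n) l) l * u) = P [0..<l] \<sigma> * (A (\<sigma> l) l * u)"
      using l by (subst P_inv) (auto simp: Transposition.transpose_def)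
  next
    fix a b c assume "a < Suc n" "b < Suc n" "c < Suc n"
    then show "A a l * A b c - A b c * A a l = A b l * A a c - A a c * A b l"
      using maninD[OF A, of a l b c] l by simp
  qed (use l in \<open>auto simp: distrib_left\<close>)
  also have "\<dots> = 0"
  proof (rule alt_sum_symmetric_eq_0[of l "Suc n" n])
    fix \<sigma> assume s: "\<sigma> permutes {..<Suc n}"
    have "\<sigma> l < Suc n" "\<sigma> n < Suc n"
      using permutes_in_image[OF s, of l] permutes_in_image[OF s, of n] l by auto
    then have "A (\<sigma> n) l * A (\<sigma> l) l = A (\<sigma> l) l * A (\<sigma> n) l"
      using manin_column[OF A] l by simp
    then have "A (\<sigma> n) l * (A (\<sigma> l) l * u) = A (\<sigma> l) l * (A (\<sigma> n) l * u)" for u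
      by (simp flip: mult.assoc)
    then show "P [0..<l] (\<sigma> \<circ> Transposition.transpose l n) *
        (A ((\<sigma> \<circ> Transposition.transpose l n) l) l * (A ((\<sigma> \<circ> Transposition.transpose l n) n) l *
          P [Suc l..<n] (\<sigma> \<circ> Transposition.transpose l n))) =
        P [0..<l] \<sigma> * (A (\<sigma> l) l * (A (\<sigma> n) l * P [Suc l..<n] \<sigma>))"
      using l by (simp add: P_inv)
  qed (use l in auto)
  finally show ?thesis by (simp add: P_def)
qed

text \<open>Cramer's rule for the last column, whose cofactors form a left multiple of the last row of the inverse.\<close>

lemma col_det_Suc:
  fixes A :: "nat \<Rightarrow> nat \<Rightarrow> 'a::two_torsion_free"
  assumes A: "manin (Suc n) A" and C: "mat_inverse_on (Suc n) A C"
  shows "col_det (Suc n) A * C n n = col_det n A"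
proof -
  define P where "P \<sigma> = prod_list (map (\<lambda>c. A (\<sigma> c) c) [0..<n])" for \<sigma>
  \<comment> \<open>The terms with \<open>l < n\<close> vanish by
    \<open>alt_sum_equal_columns\<close>. Adding them completes the product of a row of
    \<open>A\<close> with a column of \<open>C\<close>.\<close>
  have "col_det (Suc n) A * C n n = (\<Sum>l<Suc n. alt_sum (Suc n) (\<lambda>\<sigma>. P \<sigma> * A (\<sigma> n) l) * C l n)"
    using alt_sum_equal_columns[OF A] by (simp add: col_det_def P_def)
  also have "\<dots> = (\<Sum>\<sigma> | \<sigma> permutes {..<Suc n}.
      of_int (sign \<sigma>) * (P \<sigma> * (\<Sum>l<Suc n. A (\<sigma> n) l * C l n)))"
    unfolding alt_sum_def sum_distrib_right sum_distrib_left by (subst sum.swap) (simp only: mult.assoc)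
  also have "\<dots> = (\<Sum>\<sigma> | \<sigma> permutes {..<Suc n}.
      if \<sigma> n = n then of_int (sign \<sigma>) * P \<sigma> else 0)"
  proof (intro sum.cong refl)
    fix \<sigma> assume "\<sigma> \<in> {\<sigma>. \<sigma> permutes {..<Suc n}}"
    then have "\<sigma> n < Suc n" using permutes_in_image[of \<sigma> "{..<Suc n}" n] by simp
    then show "of_int (sign \<sigma>) * (P \<sigma> * (\<Sum>l<Suc n. A (\<sigma> n) l * C l n)) =
        (if \<sigma> n = n then of_int (sign \<sigma>) * P \<sigma> else 0)"
      by (simp only: mat_inverse_onD(1)[OF C _ lessI]) simp
  qed
  also have "\<dots> = (\<Sum>\<sigma> | \<sigma> permutes {..<n}. of_int (sign \<sigma>) * P \<sigma>)"
  proof -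
    have "{\<sigma>. \<sigma> permutes {..<n}} = {\<sigma> \<in> {\<sigma>. \<sigma> permutes {..<Suc n}}. \<sigma> n = n}"
      by (auto intro: permutes_subset[of _ "{..<n}"] permutes_superset[of _ "{..<Suc n}"]
        simp: permutes_not_in less_Suc_eq)
    then show ?thesis
      by (simp only:) (rule sum.inter_filter[symmetric], simp add: finite_permutations)
  qed
  finally show ?thesis by (simp add: col_det_def alt_sum_def P_def)
qed

text \<open>Telescoping of \<open>col_det_Suc\<close>, which appends each new pivot on the right;
  the factors need not commute.\<close>

lemma col_det_prod:
  fixes A :: "nat \<Rightarrow> nat \<Rightarrow> 'a::two_torsion_free"
  assumes "manin n A" and "\<And>j. j < n \<Longrightarrow> mat_inverse_on (Suc j) A (C j)"
    and "\<And>j. j < n \<Longrightarrow> two_sided_unit (C j j j)"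
  shows "col_det n A = prod_list (map (\<lambda>j. ring_inv (C j j j)) [0..<n])"
  using assms
proof (induction n)
  case 0
  then show ?case by (simp add: col_det_def alt_sum_def)
next
  case (Suc n)
  have "manin n A" using Suc.prems(1) by (simp add: manin_def)
  then have "col_det n A = prod_list (map (\<lambda>j. ring_inv (C j j j)) [0..<n])"
    using Suc by simp
  moreover have "col_det (Suc n) A = col_det n A * ring_inv (C n n n)"
    using Suc.prems(3) by (simp add: mult.assoc flip: col_det_Suc[OF Suc.prems(1) Suc.prems(2)[OF lessI]])
  ultimately show ?case by simp
qed

subsection \<open>Normal ordering\<close>

lemma additive_sum:
  fixes \<phi> :: "'a::ab_group_add \<Rightarrow> 'b::ab_group_add"
  assumes "\<And>u v. \<phi> (u + v) = \<phi> u + \<phi> v"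
  shows "\<phi> (u - v) = \<phi> u - \<phi> v" "\<phi> (\<Sum>i\<in>I. f i) = (\<Sum>i\<in>I. \<phi> (f i))"
proof -
  have 0: "\<phi> 0 = 0" using assms[of 0 0] by simp
  show "\<phi> (u - v) = \<phi> u - \<phi> v" using assms[of "u - v" v] by simp
  show "\<phi> (\<Sum>i\<in>I. f i) = (\<Sum>i\<in>I. \<phi> (f i))"
    by (induction I rule: infinite_finite_induct) (simp_all add: 0 assms)
qed

lemma alt_sum_sum: "alt_sum n (\<lambda>\<sigma>. \<Sum>i\<in>I. F i \<sigma>) = (\<Sum>i\<in>I. alt_sum n (F i))"
  unfolding alt_sum_def sum_distrib_left by (rule sum.swap)

text \<open>\<open>alt_sum_move\<close> applies only to the factor with the row index. Here this is
  \<open>X\<close>, which goes left past all earlier columns, so the last column is treated first.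
  In the resulting composition of operators the first column is innermost.\<close>

lemma alt_sum_normal_order_left:
  fixes A :: "nat \<Rightarrow> nat \<Rightarrow> 'a::two_torsion_free" and \<Phi> :: "(nat \<Rightarrow> nat) \<Rightarrow> 'a \<Rightarrow> 'a"
    and T :: "nat \<Rightarrow> nat \<Rightarrow> 'a" and X Y :: "nat \<Rightarrow> nat \<Rightarrow> 'a" and N :: nat
  defines "R \<equiv> \<lambda>b c u. u * T b c - (\<Sum>q<N. X q b * u * Y q c)"
  assumes A: "\<And>b c. A b c = T b c - (\<Sum>q<N. X q b * Y q c)"
    and comm: "\<And>q a b c. q < N \<Longrightarrow> a < n \<Longrightarrow> b < n \<Longrightarrow> c < n \<Longrightarrow>
      X q a * A b c - A b c * X q a = X q b * A a c - A a c * X q b"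
    and "distinct cs" "set cs \<subseteq> {..<n}"
    and "\<And>\<sigma> u v. \<Phi> \<sigma> (u + v) = \<Phi> \<sigma> u + \<Phi> \<sigma> v"
    and "\<And>\<sigma> c d u. c \<in> set cs \<Longrightarrow> d \<in> set cs \<Longrightarrow> \<Phi> (\<sigma> \<circ> Transposition.transpose c d) u = \<Phi> \<sigma> u"
  shows "alt_sum n (\<lambda>\<sigma>. \<Phi> \<sigma> (prod_list (map (\<lambda>c. A (\<sigma> c) c) cs))) =
    alt_sum n (\<lambda>\<sigma>. \<Phi> \<sigma> (fold (\<lambda>c. R (\<sigma> c) c) cs 1))"
  using assms(4-7)
proof (induction cs arbitrary: \<Phi> rule: rev_induct)
  case Nil
  then show ?case by simp
next
  case (snoc c cs)
  let ?P = "\<lambda>\<sigma>. prod_list (map (\<lambda>c. A (\<sigma> c) c) cs)"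
  note \<Phi> = snoc.prems(3) additive_sum[of "\<Phi> \<sigma>" for \<sigma>, OF snoc.prems(3)]
  have R_add: "R b c (u + v) = R b c u + R b c v" for b c u v
    by (simp add: R_def distrib_left distrib_right sum.distrib)
  have "alt_sum n (\<lambda>\<sigma>. \<Phi> \<sigma> (?P \<sigma> * A (\<sigma> c) c)) =
      alt_sum n (\<lambda>\<sigma>. \<Phi> \<sigma> (?P \<sigma> * T (\<sigma> c) c)) - (\<Sum>q<N. alt_sum n (\<lambda>\<sigma>. \<Phi> \<sigma> (?P \<sigma> * X q (\<sigma> c) * Y q c)))"
    unfolding alt_sum_sum[symmetric] alt_sum_diff[symmetric]
    by (simp add: A \<Phi> right_diff_distrib sum_distrib_left mult.assoc)
  also have "(\<Sum>q<N. alt_sum n (\<lambda>\<sigma>. \<Phi> \<sigma> (?P \<sigma> * X q (\<sigma> c) * Y q c))) =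
      (\<Sum>q<N. alt_sum n (\<lambda>\<sigma>. \<Phi> \<sigma> (X q (\<sigma> c) * ?P \<sigma> * Y q c)))"
  proof (rule sum.cong[OF refl])
    fix q assume "q \<in> {..<N}"
    then show "alt_sum n (\<lambda>\<sigma>. \<Phi> \<sigma> (?P \<sigma> * X q (\<sigma> c) * Y q c)) =
        alt_sum n (\<lambda>\<sigma>. \<Phi> \<sigma> (X q (\<sigma> c) * ?P \<sigma> * Y q c))"
      using snoc.prems(1,2)
      by (intro alt_sum_move[symmetric, of c cs n "\<lambda>\<sigma> u. \<Phi> \<sigma> (u * Y q c)" "X q" A] snoc.prems(4) comm)
        (auto simp: distrib_right \<Phi>(1))
  qed
  also have "alt_sum n (\<lambda>\<sigma>. \<Phi> \<sigma> (?P \<sigma> * T (\<sigma> c) c)) - \<dots> = alt_sum n (\<lambda>\<sigma>. \<Phi> \<sigma> (R (\<sigma> c) c (?P \<sigma>)))"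
    unfolding alt_sum_sum[symmetric] alt_sum_diff[symmetric] by (simp add: R_def \<Phi>)
  also have "\<dots> = alt_sum n (\<lambda>\<sigma>. \<Phi> \<sigma> (R (\<sigma> c) c (fold (\<lambda>c. R (\<sigma> c) c) cs 1)))"
  proof (rule snoc.IH)
    fix \<sigma> :: "nat \<Rightarrow> nat" and b d u assume "b \<in> set cs" "d \<in> set cs"
    moreover from this have "(\<sigma> \<circ> Transposition.transpose b d) c = \<sigma> c"
      using snoc.prems(1) by (auto simp: Transposition.transpose_def)
    ultimately show "\<Phi> (\<sigma> \<circ> Transposition.transpose b d) (R ((\<sigma> \<circ> Transposition.transpose b d) c) c u) =
        \<Phi> \<sigma> (R (\<sigma> c) c u)"
      by (subst snoc.prems(4)) auto
  qed (use snoc.prems in \<open>auto simp: R_add\<close>)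
  finally show ?case by simp
qed

text \<open>The mirror image for a row index on the right factor \<open>Y\<close>, which goes right
  past all later columns. Now the last column is innermost.\<close>

lemma alt_sum_normal_order_right:
  fixes A :: "nat \<Rightarrow> nat \<Rightarrow> 'a::two_torsion_free" and \<Phi> :: "(nat \<Rightarrow> nat) \<Rightarrow> 'a \<Rightarrow> 'a"
    and T :: "nat \<Rightarrow> nat \<Rightarrow> 'a" and X Y :: "nat \<Rightarrow> nat \<Rightarrow> 'a" and N :: nat
  defines "R \<equiv> \<lambda>b c u. T b c * u - (\<Sum>q<N. X q c * u * Y q b)"
  assumes A: "\<And>b c. A b c = T b c - (\<Sum>q<N. X q c * Y q b)"
    and comm: "\<And>q a b c. q < N \<Longrightarrow> a < n \<Longrightarrow> b < n \<Longrightarrow> c < n \<Longrightarrow>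
      Y q a * A b c - A b c * Y q a = Y q b * A a c - A a c * Y q b"
    and "distinct cs" "set cs \<subseteq> {..<n}"
    and "\<And>\<sigma> u v. \<Phi> \<sigma> (u + v) = \<Phi> \<sigma> u + \<Phi> \<sigma> v"
    and "\<And>\<sigma> c d u. c \<in> set cs \<Longrightarrow> d \<in> set cs \<Longrightarrow> \<Phi> (\<sigma> \<circ> Transposition.transpose c d) u = \<Phi> \<sigma> u"
  shows "alt_sum n (\<lambda>\<sigma>. \<Phi> \<sigma> (prod_list (map (\<lambda>c. A (\<sigma> c) c) cs))) =
    alt_sum n (\<lambda>\<sigma>. \<Phi> \<sigma> (foldr (\<lambda>c. R (\<sigma> c) c) cs 1))"
  using assms(4-7)
proof (induction cs arbitrary: \<Phi>)
  case Nil
  then show ?case by simp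
next
  case (Cons c cs)
  let ?P = "\<lambda>\<sigma>. prod_list (map (\<lambda>c. A (\<sigma> c) c) cs)"
  note \<Phi> = Cons.prems(3) additive_sum[of "\<Phi> \<sigma>" for \<sigma>, OF Cons.prems(3)]
  have R_add: "R b c (u + v) = R b c u + R b c v" for b c u v
    by (simp add: R_def distrib_left distrib_right sum.distrib)
  have "alt_sum n (\<lambda>\<sigma>. \<Phi> \<sigma> (A (\<sigma> c) c * ?P \<sigma>)) =
      alt_sum n (\<lambda>\<sigma>. \<Phi> \<sigma> (T (\<sigma> c) c * ?P \<sigma>)) - (\<Sum>q<N. alt_sum n (\<lambda>\<sigma>. \<Phi> \<sigma> (X q c * (Y q (\<sigma> c) * ?P \<sigma>))))"
    unfolding alt_sum_sum[symmetric] alt_sum_diff[symmetric]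
    by (simp add: A \<Phi> left_diff_distrib sum_distrib_right mult.assoc)
  also have "(\<Sum>q<N. alt_sum n (\<lambda>\<sigma>. \<Phi> \<sigma> (X q c * (Y q (\<sigma> c) * ?P \<sigma>)))) =
      (\<Sum>q<N. alt_sum n (\<lambda>\<sigma>. \<Phi> \<sigma> (X q c * (?P \<sigma> * Y q (\<sigma> c)))))"
  proof (rule sum.cong[OF refl])
    fix q assume "q \<in> {..<N}"
    then show "alt_sum n (\<lambda>\<sigma>. \<Phi> \<sigma> (X q c * (Y q (\<sigma> c) * ?P \<sigma>))) =
        alt_sum n (\<lambda>\<sigma>. \<Phi> \<sigma> (X q c * (?P \<sigma> * Y q (\<sigma> c))))"
      using Cons.prems(1,2)
      by (intro alt_sum_move[of c cs n "\<lambda>\<sigma> u. \<Phi> \<sigma> (X q c * u)" "Y q" A] Cons.prems(4) comm)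
        (auto simp: distrib_left \<Phi>(1))
  qed
  also have "alt_sum n (\<lambda>\<sigma>. \<Phi> \<sigma> (T (\<sigma> c) c * ?P \<sigma>)) - \<dots> = alt_sum n (\<lambda>\<sigma>. \<Phi> \<sigma> (R (\<sigma> c) c (?P \<sigma>)))"
    unfolding alt_sum_sum[symmetric] alt_sum_diff[symmetric] by (simp add: R_def \<Phi> mult.assoc)
  also have "\<dots> = alt_sum n (\<lambda>\<sigma>. \<Phi> \<sigma> (R (\<sigma> c) c (foldr (\<lambda>c. R (\<sigma> c) c) cs 1)))"
  proof (rule Cons.IH)
    fix \<sigma> :: "nat \<Rightarrow> nat" and b d u assume "b \<in> set cs" "d \<in> set cs"
    moreover from this have "(\<sigma> \<circ> Transposition.transpose b d) c = \<sigma> c"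
      using Cons.prems(1) by (auto simp: Transposition.transpose_def)
    ultimately show "\<Phi> (\<sigma> \<circ> Transposition.transpose b d) (R ((\<sigma> \<circ> Transposition.transpose b d) c) c u) =
        \<Phi> \<sigma> (R (\<sigma> c) c u)"
      by (subst Cons.prems(4)) auto
  qed (use Cons.prems in \<open>auto simp: R_add\<close>)
  finally show ?case by simp
qed

text \<open>Both compositions run over the pairs \<open>(\<sigma> c, c)\<close>, one by rows and one
  by columns. Commuting operators see only the multiset of these pairs.\<close>

lemma foldr_inverse_permutes:
  assumes comm: "\<And>a c b e u. f a c (f b e u) = f b e (f a c u)" and s: "\<sigma> permutes {..<n}"
  shows "foldr (\<lambda>c. f c (inv_into UNIV \<sigma> c)) [0..<n] u = fold (\<lambda>c. f (\<sigma> c) c) [0..<n] u"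
proof -
  let ?g = "\<lambda>c. f c (inv_into UNIV \<sigma> c)"
  have "mset (rev [0..<n]) = mset (map \<sigma> [0..<n])"
    using permutes_image_mset[OF s] by (simp add: atLeast0LessThan)
  then have "fold ?g (rev [0..<n]) = fold ?g (map \<sigma> [0..<n])"
    by (intro fold_multiset_equiv) (simp_all add: fun_eq_iff comm)
  also have "\<dots> = fold (\<lambda>c. f (\<sigma> c) c) [0..<n]"
    by (simp add: fold_map comp_def permutes_inverses(2)[OF s])
  finally show ?thesis by (simp add: foldr_conv_fold)
qed

section \<open>Inverses under commutators, rank-one updates and truncation\<close>

lemma mat_inverse_on_intertwine:
  fixes A C E :: "nat \<Rightarrow> nat \<Rightarrow> 'a::ring_1"
  assumes C: "mat_inverse_on n A C" and A: "\<And>a b. a < n \<Longrightarrow> b < n \<Longrightarrow> t * A a b = A a b * t + E a b"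
    and ab: "a < n" "b < n"
  shows "t * C a b = C a b * t - (\<Sum>p<n. \<Sum>q<n. C a p * E p q * C q b)"
proof -
  \<comment> \<open>The derivative of an inverse, with the commutator with \<open>t\<close> as
    derivation: \<open>t A\<close> and \<open>A t\<close> are each enclosed between two copies of
    \<open>C\<close>, and their difference is \<open>C E C\<close>.\<close>
  have 1: "(\<Sum>p<n. \<Sum>q<n. C a p * (t * A p q) * C q b) = C a b * t"
  proof -
    have "(\<Sum>p<n. \<Sum>q<n. C a p * (t * A p q) * C q b) = (\<Sum>p<n. C a p * t * (\<Sum>q<n. A p q * C q b))"
      by (simp add: sum_distrib_left mult.assoc)
    also have "\<dots> = (\<Sum>p<n. (C a p * t) * (if p = b then 1 else 0))"
      using ab by (intro sum.cong refl) (simp add: mat_inverse_onD(1)[OF C])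
    finally show ?thesis using ab(2) by (simp only: sum_delta_mult(2))
  qed
  have 2: "(\<Sum>p<n. \<Sum>q<n. C a p * (A p q * t) * C q b) = t * C a b"
  proof -
    have "(\<Sum>p<n. \<Sum>q<n. C a p * (A p q * t) * C q b) = (\<Sum>q<n. (\<Sum>p<n. C a p * A p q) * (t * C q b))"
      by (subst sum.swap) (simp add: sum_distrib_right mult.assoc)
    also have "\<dots> = (\<Sum>q<n. (if a = q then 1 else 0) * (t * C q b))"
      using ab by (intro sum.cong refl) (simp add: mat_inverse_onD(2)[OF C])
    finally show ?thesis using ab(1) by (simp only: sum_delta_mult(1))
  qed
  have "(\<Sum>p<n. \<Sum>q<n. C a p * (t * A p q) * C q b) =
      (\<Sum>p<n. \<Sum>q<n. C a p * (A p q * t) * C q b + C a p * E p q * C q b)"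
    by (intro sum.cong refl) (simp add: A distrib_left distrib_right)
  then show ?thesis unfolding 1 sum.distrib 2 by (simp add: algebra_simps)
qed

lemma mat_inverse_on_commute:
  fixes A C :: "nat \<Rightarrow> nat \<Rightarrow> 'a::ring_1"
  assumes "mat_inverse_on n A C" "\<And>a b. a < n \<Longrightarrow> b < n \<Longrightarrow> t * A a b = A a b * t" "a < n" "b < n"
  shows "t * C a b = C a b * t"
  using mat_inverse_on_intertwine[of n A C t "\<lambda>_ _. 0"] assms by simp

text \<open>Sherman-Morrison without commutativity. Both \<open>x Y\<close> and \<open>X y\<close>
  equal \<tau> minus the Schur complement; multiplied by the inverses \<open>h\<close> and
  \<open>D\<close> on its two sides, this becomes \<open>D - h\<close>, which cancels the cross
  terms.\<close>

lemma mat_inverse_on_rank_one: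
  fixes A L :: "nat \<Rightarrow> nat \<Rightarrow> 'a::ring_1"
  assumes L: "mat_inverse_on n A L" and unit: "two_sided_unit (schur n L x y \<tau>)" "two_sided_unit \<tau>"
  shows "mat_inverse_on n (\<lambda>a b. A a b - y a * ring_inv \<tau> * x b) (rank_one_update n L x y \<tau>)"
proof -
  define D where "D = ring_inv (schur n L x y \<tau>)"
  define h where "h = ring_inv \<tau>"
  define X where "X = row_times n x L"
  define Y where "Y = times_col n L y"
  note X = X_def[unfolded row_times_def[abs_def]] and Y = Y_def[unfolded times_col_def[abs_def]]
  have L': "rank_one_update n L x y \<tau> a b = L a b + Y a * D * X b" for a b
    by (simp add: rank_one_update_def X_def Y_def D_def)
  have xY: "(\<Sum>a<n. x a * Y a) = \<tau> - schur n L x y \<tau>"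
    by (simp add: schur_def Y sum_distrib_left mult.assoc)
  have Xy: "(\<Sum>a<n. X a * y a) = \<tau> - schur n L x y \<tau>"
    unfolding schur_def X by (simp add: sum_distrib_right) (rule sum.swap)
  have AY: "(\<Sum>l<n. A a l * Y l) = y a" if "a < n" for a
  proof -
    have "(\<Sum>l<n. A a l * Y l) = (\<Sum>b<n. (\<Sum>l<n. A a l * L l b) * y b)"
      unfolding Y by (simp add: sum_distrib_left sum_distrib_right mult.assoc) (rule sum.swap)
    then show ?thesis using that by (simp add: mat_inverse_onD[OF L] sum_delta_mult)
  qed
  have XA: "(\<Sum>l<n. X l * A l b) = x b" if "b < n" for b
  proof -
    have "(\<Sum>l<n. X l * A l b) = (\<Sum>a<n. x a * (\<Sum>l<n. L a l * A l b))"
      unfolding X by (simp add: sum_distrib_left sum_distrib_right mult.assoc) (rule sum.swap)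
    then show ?thesis using that by (simp add: mat_inverse_onD[OF L] sum_delta_mult)
  qed
  have 1: "h * (\<tau> - schur n L x y \<tau>) * D = D - h" "D * (\<tau> - schur n L x y \<tau>) * h = D - h"
    using unit by (simp_all add: left_diff_distrib right_diff_distrib mult.assoc D_def h_def)
  show ?thesis
    unfolding mat_inverse_on_def
  proof (intro allI impI conjI)
    fix a b assume ab: "a < n" "b < n"
    have "(\<Sum>l<n. (A a l - y a * h * x l) * (L l b + Y l * D * X b)) =
        (\<Sum>l<n. A a l * L l b) + (\<Sum>l<n. A a l * Y l) * (D * X b) -
        y a * h * (\<Sum>l<n. x l * L l b) - y a * (h * (\<Sum>l<n. x l * Y l) * D) * X b"
      by (simp add: distrib_left left_diff_distrib sum.distrib sum_subtractf sum_distrib_left sum_distrib_right mult.assoc)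
    also have "\<dots> = (if a = b then 1 else 0) + y a * (D * X b) - y a * h * X b - y a * (D - h) * X b"
      using ab by (simp only: mat_inverse_onD[OF L] AY xY 1) (simp only: X)
    also have "\<dots> = (if a = b then 1 else 0)"
      by (simp add: left_diff_distrib right_diff_distrib mult.assoc)
    finally show "(\<Sum>l<n. (A a l - y a * ring_inv \<tau> * x l) * rank_one_update n L x y \<tau> l b) =
        (if a = b then 1 else 0)" by (simp only: L' h_def)
    have "(\<Sum>l<n. (L a l + Y a * D * X l) * (A l b - y l * h * x b)) =
        (\<Sum>l<n. L a l * A l b) + Y a * D * (\<Sum>l<n. X l * A l b) -
        (\<Sum>l<n. L a l * y l) * (h * x b) - Y a * (D * (\<Sum>l<n. X l * y l) * h) * x b"
      by (simp add: distrib_right right_diff_distrib sum.distrib sum_subtractf sum_distrib_left sum_distrib_right mult.assoc)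
    also have "\<dots> = (if a = b then 1 else 0) + Y a * D * x b - Y a * (h * x b) - Y a * (D - h) * x b"
      using ab by (simp only: mat_inverse_onD[OF L] XA Xy 1) (simp only: Y)
    also have "\<dots> = (if a = b then 1 else 0)"
      by (simp add: left_diff_distrib right_diff_distrib mult.assoc)
    finally show "(\<Sum>l<n. rank_one_update n L x y \<tau> a l * (A l b - y l * ring_inv \<tau> * x b)) =
        (if a = b then 1 else 0)" by (simp only: L' h_def)
  qed
qed

text \<open>The converse of bordering: the Schur complement of the corner of an inverse inverts the
  smaller block. It serves to compare \<open>L j i\<close> with \<open>L (Suc j) i\<close>.\<close>

lemma mat_inverse_on_truncate:
  fixes A M :: "nat \<Rightarrow> nat \<Rightarrow> 'a::ring_1"
  assumes M: "mat_inverse_on (Suc n) A M" and unit: "two_sided_unit (M n n)"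
  shows "mat_inverse_on n A (\<lambda>a b. M a b - M a n * ring_inv (M n n) * M n b)"
proof -
  let ?q = "ring_inv (M n n)"
  have AM: "(\<Sum>l<n. A a l * M l b) = (if a = b then 1 else 0) - A a n * M n b"
    and MA: "(\<Sum>l<n. M a l * A l b) = (if a = b then 1 else 0) - M a n * A n b"
    if "a < Suc n" "b < Suc n" for a b
    using mat_inverse_onD[OF M that] by (simp_all add: eq_diff_eq)
  show ?thesis
    unfolding mat_inverse_on_def
  proof (intro allI impI conjI)
    fix a b assume ab: "a < n" "b < n"
    have "(\<Sum>l<n. A a l * (M l b - M l n * ?q * M n b)) =
        (\<Sum>l<n. A a l * M l b) - (\<Sum>l<n. A a l * M l n) * (?q * M n b)"
      by (simp add: right_diff_distrib sum_subtractf sum_distrib_right mult.assoc)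
    also have "\<dots> = (if a = b then 1 else 0)"
      using ab unit by (simp add: AM mult.assoc)
    finally show "(\<Sum>l<n. A a l * (M l b - M l n * ?q * M n b)) = (if a = b then 1 else 0)" .
    have "(\<Sum>l<n. (M a l - M a n * ?q * M n l) * A l b) =
        (\<Sum>l<n. M a l * A l b) - M a n * ?q * (\<Sum>l<n. M n l * A l b)"
      by (simp add: left_diff_distrib sum_subtractf sum_distrib_left mult.assoc)
    also have "\<dots> = (if a = b then 1 else 0)"
      using ab unit by (simp add: MA mult.assoc)
    finally show "(\<Sum>l<n. (M a l - M a n * ?q * M n l) * A l b) = (if a = b then 1 else 0)" .
  qed
qed

subsection \<open>Howe dual pairs of oscillators\<close>

text \<open>Here \<open>\<alpha> a\<close>, \<open>\<tau> i\<close>, \<open>y i a\<close> stand for \<open>v - z\<^sub>a\<close>, \<open>\<partial>\<^sub>v - \<Lambda>\<^sub>i\<close>, \<open>\<partial>\<^sub>i\<^sub>a\<close>. With the first \<open>i\<close> rows of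
  oscillators and the first \<open>j\<close> of the \<open>\<alpha> a\<close>, \<open>L j i\<close> is the inverse of \<open>K i\<close>, and \<open>\<delta> j i\<close> and \<open>\<kappa> j i\<close> are the
  quasi-minors obtained by adjoining \<open>\<tau> i\<close> or \<open>\<alpha> j\<close>.\<close>

locale howe_pair =
  fixes N k :: nat and x y :: "nat \<Rightarrow> nat \<Rightarrow> 'r::two_torsion_free" and \<alpha> \<tau> :: "nat \<Rightarrow> 'r"
    and od :: "nat \<Rightarrow> bool"
  assumes xx: "\<And>p q a b. x p a * x q b = (if od p \<and> od q then - (x q b * x p a) else x q b * x p a)"
    and yy: "\<And>p q a b. y p a * y q b = (if od p \<and> od q then - (y q b * y p a) else y q b * y p a)"
    and yx: "\<And>p q a b. p < N \<Longrightarrow> q < N \<Longrightarrow> a < k \<Longrightarrow> b < k \<Longrightarrow> y p a * x q b =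
      (if od p \<and> od q then - (x q b * y p a) else x q b * y p a) + (if p = q \<and> a = b then 1 else 0)"
    and \<alpha>x: "\<And>a p b. \<alpha> a * x p b = x p b * \<alpha> a"
    and \<alpha>y: "\<And>a p b. \<alpha> a * y p b = y p b * \<alpha> a"
    and \<tau>x: "\<And>q p b. \<tau> q * x p b = x p b * \<tau> q"
    and \<tau>y: "\<And>q p b. \<tau> q * y p b = y p b * \<tau> q"
    and \<alpha>\<alpha>: "\<And>a b. \<alpha> a * \<alpha> b = \<alpha> b * \<alpha> a"
    and \<tau>\<tau>: "\<And>p q. \<tau> p * \<tau> q = \<tau> q * \<tau> p"
    and \<tau>\<alpha>: "\<And>p a. \<tau> p * \<alpha> a = \<alpha> a * \<tau> p + 1"
    and unit_\<alpha>: "\<And>a. two_sided_unit (\<alpha> a)"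
    and unit_\<tau>: "\<And>p. two_sided_unit (\<tau> p)"
begin

definition h where "h p = ring_inv (\<tau> p)"
text \<open>The row sign of \<open>B_mat\<close>, absorbed into the oscillator. With it the
  contraction of \<open>y\<close> with \<open>x'\<close> is - 1 for odd rows.\<close>

definition x' where "x' p a = (if od p then - x p a else x p a)"

fun L :: "nat \<Rightarrow> nat \<Rightarrow> nat \<Rightarrow> nat \<Rightarrow> 'r" where
  "L j 0 = (\<lambda>a b. if a = b then ring_inv (\<alpha> a) else 0)"
| "L j (Suc i) = rank_one_update j (L j i) (x' i) (y i) (\<tau> i)"

definition \<delta> where "\<delta> j i = schur j (L j i) (x' i) (y i) (\<tau> i)"
definition K where "K i a b = (if a = b then \<alpha> a else 0) - (\<Sum>p<i. y p a * h p * x' p b)"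
definition \<kappa> where "\<kappa> j i = ring_inv (L (Suc j) i j j)"
definition dd where "dd j i = (if od i then ring_inv (\<delta> j i) else \<delta> j i)"

lemma h_comm:
  "h p * x q b = x q b * h p" "h p * y q b = y q b * h p" "h p * \<tau> q = \<tau> q * h p" "h p * h q = h q * h p"
proof -
  note c = ring_inv_commute[OF unit_\<tau>]
  show "h p * x q b = x q b * h p" "h p * y q b = y q b * h p" "h p * \<tau> q = \<tau> q * h p"
    unfolding h_def by (intro c \<tau>x \<tau>y \<tau>\<tau>)+
  then show "h p * h q = h q * h p"
    unfolding h_def by (intro c) (metis c \<tau>\<tau>)
qed

lemma h_\<alpha>: "\<alpha> a * h p = h p * \<alpha> a + h p * h p"
proof -
  have "h p * (\<tau> p * \<alpha> a) * h p = h p * (\<alpha> a * \<tau> p + 1) * h p" by (simp only: \<tau>\<alpha>)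
  moreover have "h p * (\<tau> p * u) = u" "\<tau> p * h p = 1" for u using unit_\<tau> by (simp_all add: h_def)
  ultimately show ?thesis by (simp add: distrib_left distrib_right mult.assoc)
qed

lemma mat_inverse_on_K_0: "mat_inverse_on j (K 0) (L j 0)"
  unfolding mat_inverse_on_def
proof (intro allI impI conjI)
  fix a b assume "a < j" "b < j"
  moreover have "K 0 a l * L j 0 l b = (if l = a then if a = b then 1 else 0 else 0)"
    "L j 0 a l * K 0 l b = (if l = a then if a = b then 1 else 0 else 0)" for l
    using unit_\<alpha>[of b] by (simp_all add: K_def)
  ultimately show "(\<Sum>l<j. K 0 a l * L j 0 l b) = (if a = b then 1 else 0)"
    "(\<Sum>l<j. L j 0 a l * K 0 l b) = (if a = b then 1 else 0)"
    by simp_all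
qed

end

text \<open>Invertibility of the pivots is kept apart from the relations, since it is a question of
  orders of operators; \<open>howe_pair_units_pdo\<close> supplies it.\<close>

locale howe_pair_units = howe_pair N k x y \<alpha> \<tau> od
  for N k and x y :: "nat \<Rightarrow> nat \<Rightarrow> 'r::two_torsion_free" and \<alpha> \<tau> od +
  assumes unit_\<delta>: "\<And>i j. i < N \<Longrightarrow> j \<le> k \<Longrightarrow> two_sided_unit (\<delta> j i)"
    and unit_L: "\<And>i j. i \<le> N \<Longrightarrow> j < k \<Longrightarrow> two_sided_unit (L (Suc j) i j j)"
begin

lemma mat_inverse_on_K: "i \<le> N \<Longrightarrow> j \<le> k \<Longrightarrow> mat_inverse_on j (K i) (L j i)"
proof (induction i)
  case 0
  then show ?case using mat_inverse_on_K_0 by simp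
next
  case (Suc i)
  have "K (Suc i) = (\<lambda>a b. K i a b - y i a * ring_inv (\<tau> i) * x' i b)"
    by (simp add: K_def h_def fun_eq_iff)
  then show ?case
    using mat_inverse_on_rank_one[OF Suc.IH, of "x' i" "y i" "\<tau> i"] Suc.prems unit_\<delta>[of i j] unit_\<tau>
    by (simp add: \<delta>_def)
qed

text \<open>\<open>K i\<close> contains only rows below \<open>i\<close>, and each of its terms has
  one \<open>y\<close> and one \<open>x'\<close> of the same row. The signs acquired in passing the
  two cancel.\<close>

lemma K_comm_x:
  assumes "i \<le> r" "r < N" "a < k" "b < k" "c < k"
  shows "x r c * K i a b = K i a b * x r c" "y r c * K i a b = K i a b * y r c"
proof -
  have "x r c * (y p a * h p * x' p b) = y p a * h p * x' p b * x r c"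
    "y r c * (y p a * h p * x' p b) = y p a * h p * x' p b * y r c" if "p < i" for p
  proof -
    let ?s = "if od p \<and> od r then - 1 else 1 :: 'r"
    have p: "p < N" "p \<noteq> r" using that assms by auto
    have hx: "x r c * (h p * u) = h p * (x r c * u)" "y r c * (h p * u) = h p * (y r c * u)" for u
      by (metis h_comm(1) mult.assoc) (metis h_comm(2) mult.assoc)
    have 1: "x r c * y p a = ?s * (y p a * x r c)" "x' p b * x r c = ?s * (x r c * x' p b)"
      using yx[of p r a c] xx[of p b r c] p assms by (auto simp: x'_def)
    have 2: "y r c * y p a = ?s * (y p a * y r c)" "x' p b * y r c = ?s * (y r c * x' p b)"
      using yy[of r c p a] yx[of r p c b] p assms by (auto simp: x'_def)
    have "x r c * (y p a * h p * x' p b) = ?s * (y p a * (x r c * h p) * x' p b)"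
      by (simp add: 1 flip: mult.assoc)
    also have "\<dots> = y p a * h p * (?s * (x r c * x' p b))" by (simp add: hx mult.assoc)
    finally show "x r c * (y p a * h p * x' p b) = y p a * h p * x' p b * x r c"
      by (simp only: 1 mult.assoc)
    have "y r c * (y p a * h p * x' p b) = ?s * (y p a * (y r c * h p) * x' p b)"
      by (simp add: 2 flip: mult.assoc)
    also have "\<dots> = y p a * h p * (?s * (y r c * x' p b))" by (simp add: hx mult.assoc)
    finally show "y r c * (y p a * h p * x' p b) = y p a * h p * x' p b * y r c"
      by (simp only: 2 mult.assoc)
  qed
  then show "x r c * K i a b = K i a b * x r c" "y r c * K i a b = K i a b * y r c"
    by (simp_all add: K_def left_diff_distrib right_diff_distrib sum_distrib_left sum_distrib_right \<alpha>x \<alpha>y)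
qed

lemma \<tau>K: "\<tau> r * K i a b = K i a b * \<tau> r + (if a = b then 1 else 0)"
proof -
  have "\<tau> r * (y p a * h p * x' p b) = y p a * h p * x' p b * \<tau> r" for p
  proof -
    have "\<tau> r * x' p b = x' p b * \<tau> r" by (simp add: x'_def \<tau>x)
    then show ?thesis by (metis mult.assoc \<tau>y h_comm(3))
  qed
  then show ?thesis
    by (simp add: K_def left_diff_distrib right_diff_distrib sum_distrib_left sum_distrib_right \<tau>\<alpha>)
qed

lemma manin_L_0: "manin j (L j 0)"
proof -
  have "ring_inv (\<alpha> a) * ring_inv (\<alpha> b) = ring_inv (\<alpha> b) * ring_inv (\<alpha> a)" for a b
    by (metis ring_inv_commute unit_\<alpha> \<alpha>\<alpha>)
  then show ?thesis by (simp add: manin_def)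
qed

text \<open>The commutator of \<open>\<tau> i\<close> with \<open>K i\<close> is the identity
  matrix, so its commutator with the inverse \<open>L j i\<close> is minus the square; this is the
  hypothesis \<open>\<tau>L\<close>. The others hold because \<open>K i\<close> does not contain row
  \<open>i\<close>.\<close>

lemma rank_one_step_L:
  assumes i: "i < N" and j: "j \<le> k" and manin: "manin j (L j i)"
  shows "rank_one_step j (L j i) (x' i) (y i) (\<tau> i) (od i)"
proof
  note inv = mat_inverse_on_K[OF less_imp_le[OF i] j]
  fix a b c
  show "x' i a * L j i b c = L j i b c * x' i a" if "a < j" "b < j" "c < j"
  proof -
    have "x i a * L j i b c = L j i b c * x i a"
      using that i j by (intro mat_inverse_on_commute[OF inv] K_comm_x) auto
    then show ?thesis by (simp add: x'_def)
  qed
  show "y i a * L j i b c = L j i b c * y i a" if "a < j" "b < j" "c < j"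
    using that i j by (intro mat_inverse_on_commute[OF inv] K_comm_x) auto
  show "\<tau> i * x' i a = x' i a * \<tau> i" "\<tau> i * y i a = y i a * \<tau> i"
    by (simp_all add: x'_def \<tau>x \<tau>y)
  show "x' i a * x' i b = (if od i then - (x' i b * x' i a) else x' i b * x' i a)"
    using xx[of i a i b] by (simp add: x'_def)
  show "y i a * y i b = (if od i then - (y i b * y i a) else y i b * y i a)"
    using yy[of i a i b] by simp
  show "y i a * x' i b = (if od i then - (x' i b * y i a) - (if a = b then 1 else 0)
      else x' i b * y i a + (if a = b then 1 else 0))" if "a < j" "b < j"
    using yx[of i i a b] that i j by (auto simp: x'_def)
  show "\<tau> i * L j i a b = L j i a b * \<tau> i - (\<Sum>c<j. L j i a c * L j i c b)" if "a < j" "b < j"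
    using mat_inverse_on_intertwine[OF inv, of "\<tau> i" "\<lambda>a b. if a = b then 1 else 0" a b] that
    by (simp add: \<tau>K if_distrib if_distribR cong: if_cong)
  show "manin j (L j i)" by (rule manin)
qed

lemma manin_L: "i \<le> N \<Longrightarrow> j \<le> k \<Longrightarrow> manin j (L j i)"
proof (induction i)
  case 0
  then show ?case by (simp only: manin_L_0)
next
  case (Suc i)
  then interpret rank_one_step j "L j i" "x' i" "y i" "\<tau> i" "od i"
    by (intro rank_one_step_L) auto
  show ?case using manin_L' unit_\<delta>[of i j] Suc.prems by (simp add: \<delta>_def)
qed

end

section \<open>Exchange of neighbouring pivots\<close>

context howe_pair_units
begin

declare L.simps [simp del]

text \<open>Truncating \<open>L (Suc j) i\<close> to the smaller block subtracts a rank-one term,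
  which reappears in the Schur complement as row times pivot times column. This identifies the
  bracket in \<open>exchange\<close>.\<close>

lemma \<delta>_Suc:
  assumes "i < N" "j < k"
  shows "\<delta> j i = \<delta> (Suc j) i +
    row_times (Suc j) (x' i) (L (Suc j) i) j * \<kappa> j i * times_col (Suc j) (L (Suc j) i) (y i) j"
proof -
  let ?M = "L (Suc j) i" and ?x = "x' i" and ?y = "y i"
  have unit: "two_sided_unit (?M j j)" using assms unit_L by simp
  have q: "?M j j * (\<kappa> j i * u) = u" "\<kappa> j i * ?M j j = 1" "?M j j * \<kappa> j i = 1" for u
    using unit by (simp_all add: \<kappa>_def)
  have L: "L j i a b = ?M a b - ?M a j * \<kappa> j i * ?M j b" if "a < j" "b < j" for a b
    unfolding \<kappa>_def
    by (rule mat_inverse_on_unique[OF mat_inverse_on_K mat_inverse_on_truncate[OF mat_inverse_on_K]])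
      (use assms unit that in auto)
  have "row_times (Suc j) ?x ?M j * \<kappa> j i * times_col (Suc j) ?M ?y j =
      (\<Sum>a<Suc j. \<Sum>b<Suc j. ?x a * ?M a j * \<kappa> j i * (?M j b * ?y b))"
    unfolding row_times_def times_col_def sum_distrib_right
    by (simp only: sum_distrib_left mult.assoc)
  then have "\<tau> i - (\<delta> (Suc j) i +
      row_times (Suc j) ?x ?M j * \<kappa> j i * times_col (Suc j) ?M ?y j) =
      (\<Sum>a<Suc j. \<Sum>b<Suc j. ?x a * (?M a b - ?M a j * \<kappa> j i * ?M j b) * ?y b)"
    unfolding \<delta>_def schur_def
    by (simp only: sum_subtractf right_diff_distrib left_diff_distrib mult.assoc) simp
  also have "\<dots> = (\<Sum>a<j. \<Sum>b<j. ?x a * L j i a b * ?y b)"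
    by (simp add: L q mult.assoc)
  finally show ?thesis by (simp add: \<delta>_def schur_def algebra_simps)
qed

text \<open>With \<open>dd\<close> both cases of \<open>exchange\<close> take the same form, the
  fermionic one after multiplication by the inverses of its two \<open>\<delta>\<close>.\<close>

lemma exchange_\<kappa>_dd:
  assumes i: "i < N" and j: "j < k"
  shows "\<kappa> j i * dd (Suc j) i = dd j i * \<kappa> j (Suc i)"
proof -
  interpret rank_one_step "Suc j" "L (Suc j) i" "x' i" "y i" "\<tau> i" "od i"
    using assms by (intro rank_one_step_L manin_L) auto
  have units: "two_sided_unit d" "two_sided_unit (L (Suc j) i j j)" "two_sided_unit (L' j j)"
    "two_sided_unit (\<delta> (Suc j) i)" "two_sided_unit (\<delta> j i)"
    using unit_\<delta>[of i "Suc j"] unit_\<delta>[of i j] unit_L[of i j] unit_L[of "Suc i" j] assms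
    by (simp_all add: \<delta>_def L.simps(2))
  note ex = exchange[OF refl units(1-3)]
  have \<delta>: "d + X j * ring_inv (L (Suc j) i j j) * Y j = \<delta> j i" "d = \<delta> (Suc j) i"
    "ring_inv (L (Suc j) i j j) = \<kappa> j i" "ring_inv (L' j j) = \<kappa> j (Suc i)"
    using \<delta>_Suc[OF assms] by (simp_all add: \<delta>_def \<kappa>_def L.simps(2))
  show ?thesis
  proof (cases "od i")
    case False
    then show ?thesis using ex(1)[OF False] unfolding \<delta>(1) unfolding \<delta>(2-4) by (simp add: dd_def)
  next
    case True
    from ex(2)[OF True] have "\<delta> j i * \<kappa> j i = \<kappa> j (Suc i) * \<delta> (Suc j) i"
      unfolding \<delta>(1) unfolding \<delta>(2-4) .
    then have "ring_inv (\<delta> j i) * (\<delta> j i * \<kappa> j i) * ring_inv (\<delta> (Suc j) i) =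
        ring_inv (\<delta> j i) * (\<kappa> j (Suc i) * \<delta> (Suc j) i) * ring_inv (\<delta> (Suc j) i)" by (rule arg_cong)
    then show ?thesis using True units by (simp add: dd_def mult.assoc)
  qed
qed

lemma exchange_prod_\<kappa>_dd:
  assumes "i < N"
  shows "j \<le> k \<Longrightarrow> prod_list (map (\<lambda>a. \<kappa> a i) [0..<j]) * dd j i =
    dd 0 i * prod_list (map (\<lambda>a. \<kappa> a (Suc i)) [0..<j])"
proof (induction j)
  case (Suc j)
  have "prod_list (map (\<lambda>a. \<kappa> a i) [0..<Suc j]) * dd (Suc j) i =
      prod_list (map (\<lambda>a. \<kappa> a i) [0..<j]) * dd j i * \<kappa> j (Suc i)"
    using exchange_\<kappa>_dd[OF assms] Suc.prems by (simp add: mult.assoc)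
  then show ?case using Suc by (simp add: mult.assoc)
qed simp

text \<open>Without oscillators \<open>\<kappa> a 0\<close> is \<open>\<alpha> a\<close>. Each row
  of oscillators turns \<open>\<kappa> a n\<close> into \<open>\<kappa> a (Suc n)\<close> for all
  \<open>a\<close>, while its own pivot moves from the right end to the left.\<close>

lemma exchange_all:
  "n \<le> N \<Longrightarrow> prod_list (map \<alpha> [0..<k]) * prod_list (map (dd k) [0..<n]) =
    prod_list (map (dd 0) [0..<n]) * prod_list (map (\<lambda>a. \<kappa> a n) [0..<k])"
proof (induction n)
  case 0
  then show ?case using unit_\<alpha> by (simp add: \<kappa>_def L.simps)
next
  case (Suc n)
  have "prod_list (map \<alpha> [0..<k]) * prod_list (map (dd k) [0..<Suc n]) =
      prod_list (map (dd 0) [0..<n]) * (prod_list (map (\<lambda>a. \<kappa> a n) [0..<k]) * dd k n)"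
    using Suc by (simp flip: mult.assoc)
  then show ?case using exchange_prod_\<kappa>_dd[of n k] Suc.prems by (simp add: mult.assoc)
qed

section \<open>The Schur complement left by eliminating the functions of v\<close>

definition B where "B p q = (if p = q then \<tau> p else 0) - (\<Sum>a<k. x' p a * ring_inv (\<alpha> a) * y q a)"

lemma row_times_L_0: "a < k \<Longrightarrow> row_times k u (L k 0) a = u a * ring_inv (\<alpha> a)"
proof -
  have "row_times k u (L k 0) a = (\<Sum>l<k. if l = a then u a * ring_inv (\<alpha> a) else 0)"
    unfolding row_times_def by (intro sum.cong refl) (auto simp: L.simps)
  then show "a < k \<Longrightarrow> ?thesis" by simp
qed

lemma times_col_L_0: "a < k \<Longrightarrow> times_col k (L k 0) u a = ring_inv (\<alpha> a) * u a"
proof -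
  have "times_col k (L k 0) u a = (\<Sum>l<k. if l = a then ring_inv (\<alpha> a) * u a else 0)"
    unfolding times_col_def by (intro sum.cong refl) (auto simp: L.simps)
  then show "a < k \<Longrightarrow> ?thesis" by simp
qed

lemma B_eq: "B p q = (if p = q then \<tau> p else 0) - (\<Sum>a<k. row_times k (x' p) (L k 0) a * y q a)"
  "B p q = (if p = q then \<tau> p else 0) - (\<Sum>a<k. x' p a * times_col k (L k 0) (y q) a)"
  by (simp_all add: B_def row_times_L_0 times_col_L_0 mult.assoc)

text \<open>The resolvent identity expressing \<open>L k i\<close> through the inverse of the leading \<open>i \<times> i\<close> block of \<open>B\<close>.\<close>

lemma B_inverse:
  "i \<le> N \<Longrightarrow> \<exists>C. mat_inverse_on i B C \<and> (\<forall>a<k. \<forall>b<k. L k i a b = L k 0 a b +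
    (\<Sum>p<i. \<Sum>q<i. times_col k (L k 0) (y p) a * C p q * row_times k (x' q) (L k 0) b)) \<and>
    (\<forall>i'<i. i = Suc i' \<longrightarrow> C i' i' = ring_inv (\<delta> k i'))"
proof (induction i)
  case 0
  then show ?case by (simp add: mat_inverse_on_def)
next
  case (Suc i)
  let ?Y = "\<lambda>p. times_col k (L k 0) (y p)" and ?X = "\<lambda>q. row_times k (x' q) (L k 0)"
  from Suc obtain C where C: "mat_inverse_on i B C"
    and L: "\<And>a b. a < k \<Longrightarrow> b < k \<Longrightarrow> L k i a b = L k 0 a b + (\<Sum>p<i. \<Sum>q<i. ?Y p a * C p q * ?X q b)"
    by auto
  define u where "u p = (\<Sum>l<i. C p l * B l i)" for p
  define w where "w q = (\<Sum>l<i. B i l * C l q)" for q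
  have Bi: "B p i = - (\<Sum>a<k. ?X p a * y i a)" "B i p = - (\<Sum>a<k. x' i a * ?Y p a)" if "p < i" for p
    using that by (simp add: B_eq(1)) (use that in \<open>simp add: B_eq(2)\<close>)
  \<comment> \<open>The entries of \<open>B\<close> outside the diagonal are contractions of
    \<open>X\<close> or \<open>Y\<close> with oscillators, so the resolvent term collapses to the
    border vector \<open>u\<close>; likewise to \<open>w\<close> for the row in
    \<open>X\<close>.\<close>
  have Y: "times_col k (L k i) (y i) a = ?Y i a - (\<Sum>p<i. ?Y p a * u p)" if "a < k" for a
  proof -
    have "times_col k (L k i) (y i) a =
        (\<Sum>b<k. L k 0 a b * y i b) + (\<Sum>b<k. \<Sum>p<i. \<Sum>q<i. ?Y p a * C p q * ?X q b * y i b)"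
      unfolding times_col_def[of k "L k i"] using that
      by (simp add: L distrib_right sum.distrib sum_distrib_right)
    also have "(\<Sum>b<k. L k 0 a b * y i b) = ?Y i a" by (simp add: times_col_def)
    also have "(\<Sum>b<k. \<Sum>p<i. \<Sum>q<i. ?Y p a * C p q * ?X q b * y i b) =
        (\<Sum>p<i. \<Sum>b<k. \<Sum>q<i. ?Y p a * C p q * ?X q b * y i b)" by (rule sum.swap)
    also have "\<dots> = (\<Sum>p<i. \<Sum>q<i. \<Sum>b<k. ?Y p a * C p q * ?X q b * y i b)"
      by (intro sum.cong refl sum.swap)
    also have "\<dots> = - (\<Sum>p<i. ?Y p a * u p)"
      unfolding u_def by (simp add: Bi sum_distrib_left sum_negf mult.assoc)
    finally show ?thesis by simp
  qed
  have X: "row_times k (x' i) (L k i) b = ?X i b - (\<Sum>q<i. w q * ?X q b)" if "b < k" for b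
  proof -
    have "row_times k (x' i) (L k i) b =
        (\<Sum>a<k. x' i a * L k 0 a b) + (\<Sum>a<k. \<Sum>p<i. \<Sum>q<i. x' i a * ?Y p a * C p q * ?X q b)"
      unfolding row_times_def[of k "x' i" "L k i"] using that
      by (simp add: L distrib_left sum.distrib sum_distrib_left mult.assoc)
    also have "(\<Sum>a<k. x' i a * L k 0 a b) = ?X i b" by (simp add: row_times_def)
    also have "(\<Sum>a<k. \<Sum>p<i. \<Sum>q<i. x' i a * ?Y p a * C p q * ?X q b) =
        (\<Sum>p<i. \<Sum>a<k. \<Sum>q<i. x' i a * ?Y p a * C p q * ?X q b)" by (rule sum.swap)
    also have "\<dots> = (\<Sum>p<i. \<Sum>q<i. \<Sum>a<k. x' i a * ?Y p a * C p q * ?X q b)"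
      by (intro sum.cong refl sum.swap)
    also have "\<dots> = (\<Sum>q<i. \<Sum>p<i. \<Sum>a<k. x' i a * ?Y p a * C p q * ?X q b)" by (rule sum.swap)
    also have "\<dots> = - (\<Sum>q<i. w q * ?X q b)"
      unfolding w_def by (simp add: Bi sum_distrib_right sum_negf)
    finally show ?thesis by simp
  qed
  \<comment> \<open>The same pivot computed in two ways: \<open>\<tau> i\<close> after elimination
    of all \<open>\<alpha>\<close> and the earlier \<open>\<tau>\<close>, in either order.\<close>
  have \<delta>: "B i i - (\<Sum>p<i. \<Sum>q<i. B i p * C p q * B q i) = \<delta> k i"
  proof -
    have "\<delta> k i = \<tau> i - (\<Sum>a<k. x' i a * times_col k (L k i) (y i) a)"
      by (simp add: \<delta>_def schur_def times_col_def sum_distrib_left mult.assoc)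
    also have "\<dots> = B i i + (\<Sum>a<k. \<Sum>p<i. x' i a * ?Y p a * u p)"
      by (simp add: Y B_eq(2) right_diff_distrib sum_subtractf sum_distrib_left mult.assoc)
    also have "(\<Sum>a<k. \<Sum>p<i. x' i a * ?Y p a * u p) = (\<Sum>p<i. \<Sum>a<k. x' i a * ?Y p a * u p)"
      by (rule sum.swap)
    also have "\<dots> = - (\<Sum>p<i. B i p * u p)" by (simp add: Bi sum_distrib_right sum_negf)
    also have "\<dots> = - (\<Sum>p<i. \<Sum>q<i. B i p * C p q * B q i)"
      by (simp add: u_def sum_distrib_left mult.assoc)
    finally show ?thesis by simp
  qed
  let ?C = "bordered_inverse i C (B i) (\<lambda>p. B p i) (\<delta> k i)"
  have "two_sided_unit (\<delta> k i)" using Suc.prems by (intro unit_\<delta>) auto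
  then have inv: "mat_inverse_on (Suc i) B ?C"
    using mat_inverse_on_bordered[OF C] by (simp add: \<delta>)
  let ?D = "ring_inv (\<delta> k i)"
  have C': "p < i \<Longrightarrow> q < i \<Longrightarrow> ?C p q = C p q + u p * ?D * w q"
    "p < i \<Longrightarrow> ?C p i = - (u p * ?D)" "q < i \<Longrightarrow> ?C i q = - (?D * w q)" "?C i i = ?D" for p q
    by (simp_all add: bordered_inverse_def u_def w_def)
  have "L k (Suc i) a b = L k 0 a b + (\<Sum>p<Suc i. \<Sum>q<Suc i. ?Y p a * ?C p q * ?X q b)"
    if "a < k" "b < k" for a b
  proof -
    have prod3: "(\<Sum>p<i. F p) * D * (\<Sum>q<i. G q) = (\<Sum>p<i. \<Sum>q<i. F p * D * G q)" for F G :: "nat \<Rightarrow> 'r" and D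
      by (simp only: sum_distrib_right) (simp only: sum_distrib_left)
    have "(\<Sum>p<Suc i. \<Sum>q<Suc i. ?Y p a * ?C p q * ?X q b) =
        (\<Sum>p<i. \<Sum>q<i. ?Y p a * C p q * ?X q b) + (\<Sum>p<i. \<Sum>q<i. (?Y p a * u p) * ?D * (w q * ?X q b))
        - (\<Sum>p<i. ?Y p a * u p * ?D * ?X i b) - (\<Sum>q<i. ?Y i a * ?D * (w q * ?X q b)) + ?Y i a * ?D * ?X i b"
      by (simp add: C' distrib_left distrib_right sum.distrib sum_negf mult.assoc)
    also have "\<dots> = (\<Sum>p<i. \<Sum>q<i. ?Y p a * C p q * ?X q b) +
        (\<Sum>p<i. ?Y p a * u p) * ?D * (\<Sum>q<i. w q * ?X q b)
        - (\<Sum>p<i. ?Y p a * u p) * ?D * ?X i b - ?Y i a * ?D * (\<Sum>q<i. w q * ?X q b) + ?Y i a * ?D * ?X i b"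
      unfolding prod3 by (simp only: sum_distrib_right sum_distrib_left)
    also have "\<dots> = (\<Sum>p<i. \<Sum>q<i. ?Y p a * C p q * ?X q b) +
        (?Y i a - (\<Sum>p<i. ?Y p a * u p)) * ?D * (?X i b - (\<Sum>q<i. w q * ?X q b))"
      by (simp add: algebra_simps)
    finally show ?thesis using that
      by (simp add: L.simps(2) rank_one_update_def L X Y \<delta>_def)
  qed
  moreover have "\<forall>i'<Suc i. Suc i = Suc i' \<longrightarrow> ?C i' i' = ring_inv (\<delta> k i')" by (simp add: C')
  ultimately show ?case using inv by blast
qed

lemma quasi_minor_B:
  assumes "i < N" "mat_inverse_on (Suc i) B C"
  shows "ring_inv (C i i) = \<delta> k i"
proof -
  obtain C' where C': "mat_inverse_on (Suc i) B C'" "C' i i = ring_inv (\<delta> k i)"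
    using B_inverse[of "Suc i"] assms(1) by auto
  then have "C i i = ring_inv (\<delta> k i)"
    using mat_inverse_on_unique[OF assms(2) C'(1)] by simp
  then show ?thesis using unit_\<delta>[of i k] assms(1) by simp
qed

section \<open>Conjugation to the normally ordered matrix\<close>

definition G where "G b c = (if b = c then \<alpha> b else 0) - (\<Sum>p<N. x p c * (y p b * h p))"
text \<open>Over the empty block the Schur complement is \<open>\<tau>\<close> itself, so this is a
  product of \<open>\<tau>\<close> for even and \<open>h\<close> for odd rows, the counterpart of
  the rational prefactor in u.\<close>

definition f where "f n = prod_list (map (dd 0) [0..<n])"

lemma dd_0: "dd 0 p = (if od p then h p else \<tau> p)"
  by (simp add: dd_def \<delta>_def schur_def h_def)

lemma unit_f: "two_sided_unit (f n)"
  unfolding f_def using unit_\<tau> by (intro two_sided_unit_prod_list) (auto simp: dd_0 h_def)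

lemma f_comm: "f n * x p a = x p a * f n" "f n * y p a = y p a * f n" "f n * h p = h p * f n"
  unfolding f_def
  by (intro prod_list_commute; use h_comm \<tau>x \<tau>y in \<open>auto simp: dd_0\<close>)+

lemma f_comm_left: "f n * (x p a * u) = x p a * (f n * u)" "f n * (y p a * u) = y p a * (f n * u)"
  by (simp_all only: f_comm flip: mult.assoc)

text \<open>A function of the derivative is itself differentiated on passing
  \<open>\<alpha>\<close>; the added sum is the logarithmic derivative of
  \<open>f n\<close>.\<close>

lemma f_\<alpha>: "f n * \<alpha> a = (\<alpha> a + (\<Sum>p<n. if od p then - h p else h p)) * f n"
proof (induction n)
  case 0
  then show ?case by (simp add: f_def)
next
  case (Suc n)
  let ?e = "\<lambda>p. if od p then - h p else h p"
  have f: "f (Suc n) = f n * dd 0 n" by (simp add: f_def)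
  have "dd 0 n * \<alpha> a = (\<alpha> a + ?e n) * dd 0 n"
    using unit_\<tau>[of n] h_\<alpha>[of a n] \<tau>\<alpha>[of n a] by (auto simp: dd_0 distrib_right left_diff_distrib h_def)
  then have "f (Suc n) * \<alpha> a = f n * \<alpha> a * dd 0 n + f n * ?e n * dd 0 n"
    by (simp add: f distrib_left distrib_right mult.assoc)
  also have "f n * ?e n = ?e n * f n" by (simp add: f_comm)
  finally show ?case by (simp add: Suc f distrib_right mult.assoc)
qed

text \<open>Bringing x to the left of y in \<open>K\<close> costs a contraction \<open>h\<close>,
  with the sign of the row, whenever \<open>a = b\<close>. Their sum is the logarithmic derivative
  in \<open>f_\<alpha>\<close>, and the two cancel.\<close>

lemma f_K: "a < k \<Longrightarrow> b < k \<Longrightarrow> f N * K N a b = G a b * f N"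
proof -
  assume ab: "a < k" "b < k"
  have 1: "y p a * h p * x' p b = x p b * (y p a * h p) + (if a = b then if od p then - h p else h p else 0)"
    if "p < N" for p
  proof -
    have "y p a * h p * x' p b = y p a * x' p b * h p"
      using h_comm(1)[of p p b] by (auto simp: x'_def mult.assoc)
    also have "y p a * x' p b = x p b * y p a + (if a = b then if od p then - 1 else 1 else 0)"
      using yx[of p p a b] that ab by (auto simp: x'_def)
    finally show ?thesis by (auto simp: distrib_right mult.assoc)
  qed
  have fx: "f N * (x p b * (y p a * h p)) = x p b * (y p a * h p) * f N" for p
    by (simp add: f_comm f_comm_left mult.assoc)
  have fh: "f N * (if a = b then if od p then - h p else h p else 0) =
      (if a = b then if od p then - h p else h p else 0) * f N" for p
    using f_comm(3)[of N p] by simp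
  have "f N * K N a b = f N * (if a = b then \<alpha> a else 0) - (\<Sum>p<N. x p b * (y p a * h p)) * f N -
      (\<Sum>p<N. if a = b then if od p then - h p else h p else 0) * f N"
    unfolding K_def right_diff_distrib sum_distrib_left sum_distrib_right diff_diff_eq sum.distrib[symmetric]
    by (intro arg_cong2[where f = "(-)"] sum.cong refl)
      (simp only: 1 lessThan_iff distrib_left fx fh)
  also have "\<dots> = G a b * f N"
    by (auto simp: G_def f_\<alpha> left_diff_distrib distrib_right)
  finally show ?thesis .
qed

lemma mat_inverse_on_G:
  assumes "j \<le> k"
  shows "mat_inverse_on j G (\<lambda>a b. f N * L j N a b * ring_inv (f N))"
  unfolding mat_inverse_on_def
proof (intro allI impI conjI)
  fix a b assume ab: "a < j" "b < j"
  note inv = mat_inverse_onD[OF mat_inverse_on_K[OF order_refl assms] ab]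
  have "(\<Sum>l<j. G a l * (f N * L j N l b * ring_inv (f N))) =
      f N * (\<Sum>l<j. K N a l * L j N l b) * ring_inv (f N)"
  proof -
    have "G a l * (f N * u) = f N * K N a l * u" if "l < j" for l u
      using f_K[of a l] ab that assms by (simp flip: mult.assoc)
    then show ?thesis by (simp add: sum_distrib_left sum_distrib_right mult.assoc)
  qed
  then show "(\<Sum>l<j. G a l * (f N * L j N l b * ring_inv (f N))) = (if a = b then 1 else 0)"
    using unit_f by (simp add: inv)
  have "(\<Sum>l<j. f N * L j N a l * ring_inv (f N) * G l b) =
      f N * (\<Sum>l<j. L j N a l * K N l b) * ring_inv (f N)"
  proof -
    have "ring_inv (f N) * G l b = K N l b * ring_inv (f N)" if "l < j" for l
    proof -
      have "ring_inv (f N) * (f N * K N l b) * ring_inv (f N) = ring_inv (f N) * (G l b * f N) * ring_inv (f N)"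
        using f_K[of l b] ab that assms by simp
      then show ?thesis using unit_f by (simp add: mult.assoc)
    qed
    then show ?thesis by (simp add: sum_distrib_left sum_distrib_right mult.assoc)
  qed
  then show "(\<Sum>l<j. f N * L j N a l * ring_inv (f N) * G l b) = (if a = b then 1 else 0)"
    using unit_f by (simp add: inv)
qed

lemma \<alpha>_left: "\<alpha> a * (x p b * u) = x p b * (\<alpha> a * u)" "\<alpha> a * (y p b * u) = y p b * (\<alpha> a * u)"
  by (simp_all only: \<alpha>x \<alpha>y flip: mult.assoc)

lemma h_left: "h q * (x p b * u) = x p b * (h q * u)" "h q * (y p b * u) = y p b * (h q * u)"
  by (simp_all only: h_comm flip: mult.assoc)

text \<open>The signs from reordering the pair of x and the pair of y coincide, so bosonic and
  fermionic rows satisfy the same matrix unit relations.\<close>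

lemma x_y_x_y:
  assumes "p < N" "q < N" "a < k" "b < k" "c < k" "e < k"
  shows "x p b * y p a * (x q e * y q c) = x q e * y q c * (x p b * y p a) +
    (if p = q then (if a = e then x p b * y p c else 0) - (if c = b then x p e * y p a else 0) else 0)"
proof -
  let ?s = "\<lambda>u. if od p \<and> od q then - u else u :: 'r"
  have 1: "x p b * y p a * (x q e * y q c) = ?s (x p b * x q e * (y p a * y q c)) +
      (if p = q \<and> a = e then x p b * y q c else 0)"
  proof -
    have "x p b * y p a * (x q e * y q c) = x p b * (y p a * x q e) * y q c" by (simp only: mult.assoc)
    then show ?thesis using assms by (simp add: yx[of p q a e] distrib_left distrib_right mult.assoc)
  qed
  have 2: "x q e * y q c * (x p b * y p a) = ?s (x q e * x p b * (y q c * y p a)) +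
      (if p = q \<and> c = b then x q e * y p a else 0)"
  proof -
    have "x q e * y q c * (x p b * y p a) = x q e * (y q c * x p b) * y p a" by (simp only: mult.assoc)
    then show ?thesis using assms by (simp add: yx[of q p c b] distrib_left distrib_right mult.assoc)
  qed
  have "x q e * x p b * (y q c * y p a) = x p b * x q e * (y p a * y q c)"
    unfolding xx[of q e p b] yy[of q c p a] by simp
  then show ?thesis unfolding 1 2 by auto
qed

lemma manin_G: "manin k G"
  unfolding manin_def
proof (intro allI impI)
  fix a b c e assume *: "a < k" "b < k" "c < k" "e < k"
  define W where "W p a b = x p b * (y p a * h p)" for p a b
  define Z where "Z a b = (\<Sum>p<N. x p b * (y p a * (h p * h p)))" for a b
  have \<alpha>W: "\<alpha> d * W p a b = W p a b * \<alpha> d + x p b * (y p a * (h p * h p))" for d p a b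
  proof -
    have "\<alpha> d * W p a b = x p b * (y p a * (\<alpha> d * h p))"
      unfolding W_def by (simp only: \<alpha>_left)
    then show ?thesis by (simp add: h_\<alpha> W_def distrib_left mult.assoc)
  qed
  have W: "W p a b = x p b * y p a * h p" for p a b by (simp add: W_def mult.assoc)
  have hxy: "h p * (x q b * y q a * h q) = x q b * y q a * (h q * h p)" for p q a b
    by (simp add: h_left mult.assoc h_comm(4)[of p q])
  have hh: "h q * h p = h p * h q" for p q by (rule h_comm)
  have WW: "W p a b * W q c e = W q c e * W p a b + (if p = q then (if a = e then x p b * (y p c * (h p * h p)) else 0) -
      (if c = b then x p e * (y p a * (h p * h p)) else 0) else 0)"
    if "p < N" "q < N" "a < k" "b < k" "c < k" "e < k" for p q a b c e
  proof -
    have 1: "W p a b * W q c e = x p b * y p a * (x q e * y q c) * (h q * h p)"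
      and 2: "W q c e * W p a b = x q e * y q c * (x p b * y p a) * (h q * h p)"
      unfolding W by (simp_all only: mult.assoc[of _ "h _" "_"] hxy) (simp_all add: mult.assoc hh[of q p])
    show ?thesis unfolding 1 2 x_y_x_y[OF that]
      by (simp add: distrib_right left_diff_distrib mult.assoc)
  qed
  define S where "S a b = (\<Sum>p<N. W p a b)" for a b
  have \<alpha>S: "\<alpha> d * S a b = S a b * \<alpha> d + Z a b" for d a b
    by (simp add: S_def Z_def sum_distrib_left sum_distrib_right \<alpha>W sum.distrib)
  have SS: "S a b * S c e = S c e * S a b + (if a = e then Z c b else 0) - (if c = b then Z a e else 0)"
    if "a < k" "b < k" "c < k" "e < k" for a b c e
  proof -
    have "S a b * S c e = (\<Sum>p<N. \<Sum>q<N. W q c e * W p a b +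
        (if p = q then (if a = e then x p b * (y p c * (h p * h p)) else 0) -
          (if c = b then x p e * (y p a * (h p * h p)) else 0) else 0))"
      unfolding S_def sum_product using that by (intro sum.cong refl WW) auto
    also have "\<dots> = (\<Sum>p<N. \<Sum>q<N. W q c e * W p a b) +
        (\<Sum>p<N. (if a = e then x p b * (y p c * (h p * h p)) else 0) -
          (if c = b then x p e * (y p a * (h p * h p)) else 0))"
      by (simp add: sum.distrib)
    also have "(\<Sum>p<N. \<Sum>q<N. W q c e * W p a b) = S c e * S a b"
      unfolding S_def sum_product by (rule sum.swap)
    finally show ?thesis by (simp add: Z_def sum_subtractf)
  qed
  have G: "G a b = (if a = b then \<alpha> a else 0) - S a b" for a b
    by (simp add: G_def S_def W_def)
  \<comment> \<open>The commutator of \<open>\<alpha>\<close> with \<open>h\<close> and the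
    contraction of oscillators both lead to the square of \<open>h\<close>, hence to the same
    \<open>Z\<close>. The resulting right-hand side is invariant under exchange of \<open>a\<close>
    and \<open>c\<close>, which is the Manin relation.\<close>
  have comm: "G a b * G c e - G c e * G a b = (if c = e then Z a b else 0) - (if a = b then Z c e else 0)
      + (if a = e then Z c b else 0) - (if c = b then Z a e else 0)"
    if "a < k" "b < k" "c < k" "e < k" for a b c e
    using \<alpha>S[of a c e] \<alpha>S[of c a b] SS[OF that] \<alpha>\<alpha>[of a c]
    by (auto simp: G left_diff_distrib right_diff_distrib)
  show "G a b * G c e - G c e * G a b = G c b * G a e - G a e * G c b"
    using * by (simp add: comm)
qed

text \<open>\<open>exchange_all\<close> leaves \<open>f N\<close> to the left of the pivots
  \<open>\<kappa> j N\<close>. Pulling it through to the right conjugates them into the quasi-minors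
  of \<open>G\<close>, whose product is the column determinant.\<close>

theorem prod_\<alpha>_dd: "prod_list (map \<alpha> [0..<k]) * prod_list (map (dd k) [0..<N]) = col_det k G * f N"
proof -
  let ?F = "ring_inv (f N)"
  have inv: "ring_inv (f N * L (Suc j) N j j * ?F) = f N * \<kappa> j N * ?F"
    and unit: "two_sided_unit (f N * L (Suc j) N j j * ?F)" if "j < k" for j
  proof -
    have "two_sided_unit (L (Suc j) N j j)" using unit_L that by simp
    then have 1: "(f N * L (Suc j) N j j * ?F) * (f N * \<kappa> j N * ?F) = 1"
      "(f N * \<kappa> j N * ?F) * (f N * L (Suc j) N j j * ?F) = 1"
      using unit_f[of N] by (simp_all add: \<kappa>_def mult.assoc)
    show "ring_inv (f N * L (Suc j) N j j * ?F) = f N * \<kappa> j N * ?F" by (rule ring_inv_eqI[OF 1])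
    show "two_sided_unit (f N * L (Suc j) N j j * ?F)" by (rule two_sided_unitI[OF 1])
  qed
  have "col_det k G = prod_list (map (\<lambda>j. ring_inv (f N * L (Suc j) N j j * ?F)) [0..<k])"
    by (rule col_det_prod[of k G "\<lambda>j a b. f N * L (Suc j) N a b * ?F", OF manin_G])
      (use mat_inverse_on_G unit in auto)
  also have "\<dots> = prod_list (map (\<lambda>j. f N * \<kappa> j N * ?F) [0..<k])"
    using inv by (intro arg_cong[where f = prod_list] map_cong) auto
  also have "\<dots> = f N * prod_list (map (\<lambda>j. \<kappa> j N) js) * ?F" if "js = [0..<k]" for js
    unfolding that[symmetric] using unit_f[of N] by (induction js) (simp_all add: mult.assoc)
  finally have "col_det k G * f N = f N * prod_list (map (\<lambda>j. \<kappa> j N) [0..<k])"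
    using unit_f[of N] by (simp add: mult.assoc)
  then show ?thesis using exchange_all[of N] by (simp add: f_def)
qed

section \<open>Normal ordering of the determinant of \<open>G\<close>\<close>

definition op where "op a c u = (if a = c then \<alpha> a * u else 0) - (\<Sum>q<N. x q a * u * (y q c * h q))"

text \<open>Exchanging two such operators exchanges two x on the left and two y on the right, with
  the same sign on both sides. Unlike the entries of \<open>G\<close>, the operators therefore
  commute, and the order of the columns becomes irrelevant.\<close>

lemma op_commute: "op a c (op b e u) = op b e (op a c u)"
proof -
  define M where "M q a c u = x q a * u * (y q c * h q)" for q a c u
  have hy: "h p * (y q c * h q) = y q c * (h q * h p)" for p q c
    by (simp add: h_left h_comm(4)[of p q])
  have \<alpha>M: "\<alpha> d * M q a c u = M q a c (\<alpha> d * u)" for d q a c u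
    unfolding M_def by (simp add: \<alpha>_left mult.assoc)
  have MM: "M q a c (M p b e u) = M p b e (M q a c u)" for p q
  proof -
    have "M q a c (M p b e u) = x q a * x p b * u * ((y p e * y q c) * (h q * h p))"
      unfolding M_def by (simp add: mult.assoc hy)
    also have "\<dots> = x p b * x q a * u * ((y q c * y p e) * (h q * h p))"
      unfolding xx[of q a p b] yy[of p e q c] by simp
    also have "\<dots> = M p b e (M q a c u)"
      unfolding M_def by (simp add: mult.assoc hy h_comm(4)[of q p])
    finally show ?thesis .
  qed
  have M_diff: "M q a c (u - v) = M q a c u - M q a c v" for q a c u v
    by (simp add: M_def right_diff_distrib left_diff_distrib)
  have M_sum: "M q a c (\<Sum>p<n. g p) = (\<Sum>p<n. M q a c (g p))" for q a c n and g :: "nat \<Rightarrow> 'r"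
    by (simp add: M_def sum_distrib_left sum_distrib_right)
  have M_0: "M q a c 0 = 0" for q a c by (simp add: M_def)
  have "(\<Sum>q<N. \<Sum>p<N. M q a c (M p b e u)) = (\<Sum>q<N. \<Sum>p<N. M q b e (M p a c u))"
    by (subst sum.swap) (simp add: MM)
  moreover have "\<alpha> c * (\<alpha> e * u) = \<alpha> e * (\<alpha> c * u)"
    by (simp only: \<alpha>\<alpha>[of c e] flip: mult.assoc)
  moreover have "op a c u = (if a = c then \<alpha> a * u else 0) - (\<Sum>q<N. M q a c u)" for a c u
    by (simp add: op_def M_def)
  ultimately show ?thesis
    by (simp add: M_diff M_sum M_0 right_diff_distrib sum_subtractf sum_distrib_left \<alpha>M)
qed

lemma col_det_G_normal_order: "col_det k G = alt_sum k (\<lambda>\<sigma>. fold (\<lambda>c. op (\<sigma> c) c) [0..<k] 1)"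
proof -
  have comm: "y q a * h q * G b c - G b c * (y q a * h q) = y q b * h q * G a c - G a c * (y q b * h q)"
    if "q < N" "a < k" "b < k" "c < k" for q a b c
  proof -
    define V where "V a = y q a * (h q * h q)" for a
    have 1: "\<alpha> d * (y q a * h q) = y q a * h q * \<alpha> d + V a" for d a
    proof -
      have "\<alpha> d * (y q a * h q) = y q a * (\<alpha> d * h q)" by (simp only: \<alpha>_left)
      then show ?thesis by (simp add: h_\<alpha> V_def distrib_left mult.assoc)
    qed
    have 2: "y q a * h q * (x p c * (y p b * h p)) = x p c * (y p b * h p) * (y q a * h q) +
        (if p = q then if a = c then V b else 0 else 0)" if p: "p < N" and ab: "a < k" "b < k" for p a b
    proof -
      have hxyh: "h q * (x p c * (y p b * h p)) = x p c * (y p b * (h q * h p))"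
        "h p * (y q a * h q) = y q a * (h q * h p)"
        by (simp_all add: h_left h_comm(4)[of p q])
      have "y q a * h q * (x p c * (y p b * h p)) = (y q a * x p c) * (y p b * (h q * h p))"
        by (simp add: hxyh mult.assoc)
      also have "\<dots> = (if od p \<and> od q then - (x p c * (y q a * y p b)) else x p c * (y q a * y p b)) * (h q * h p) +
          (if p = q \<and> a = c then y p b * (h q * h p) else 0)"
        using yx[of q p a c] that \<open>q < N\<close> \<open>c < k\<close> by (auto simp: distrib_right mult.assoc)
      also have "(if od p \<and> od q then - (x p c * (y q a * y p b)) else x p c * (y q a * y p b)) =
          x p c * (y p b * y q a)"
        unfolding yy[of q a p b] by auto
      finally show ?thesis by (auto simp: V_def hxyh mult.assoc)
    qed
    \<comment> \<open>This commutator is symmetric in \<open>a\<close> and \<open>b\<close>, as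
      required for moving the factor with the row index.\<close>
    have "y q a * h q * G b c - G b c * (y q a * h q) =
        - (if b = c then V a else 0) - (if a = c then V b else 0)"
      if "a < k" "b < k" for a b
    proof -
      have "y q a * h q * (\<Sum>p<N. x p c * (y p b * h p)) =
          (\<Sum>p<N. x p c * (y p b * h p)) * (y q a * h q) + (if a = c then V b else 0)"
        using \<open>q < N\<close> that by (simp add: sum_distrib_left sum_distrib_right 2 sum.distrib)
      then show ?thesis using 1[of c a]
        by (auto simp: G_def right_diff_distrib left_diff_distrib)
    qed
    then show ?thesis using that by simp
  qed
  have "col_det k G = alt_sum k (\<lambda>\<sigma>. foldr (\<lambda>c. op c (\<sigma> c)) [0..<k] 1)"
  proof -
    have op: "(\<lambda>u. (if b = c then \<alpha> b else 0) * u - (\<Sum>q<N. x q c * u * (y q b * h q))) = op c b" for b c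
      by (auto simp: op_def fun_eq_iff)
    show ?thesis
      unfolding col_det_def
      using alt_sum_normal_order_right[where A = G and T = "\<lambda>b c. if b = c then \<alpha> b else 0" and N = N
          and X = x and Y = "\<lambda>q b. y q b * h q" and n = k and cs = "[0..<k]" and \<Phi> = "\<lambda>_ u. u",
          unfolded op] comm
      by (simp add: G_def[abs_def] atLeast0LessThan)
  qed
  \<comment> \<open>In \<open>G\<close> the column index sits on x, in \<open>G_image\<close> on y.
    Passing to inverse permutations, which have the same sign, aligns the two.\<close>
  also have "\<dots> = alt_sum k (\<lambda>\<sigma>. foldr (\<lambda>c. op c (inv_into UNIV \<sigma> c)) [0..<k] 1)"
    by (rule alt_sum_inverse[symmetric])
  also have "\<dots> = alt_sum k (\<lambda>\<sigma>. fold (\<lambda>c. op (\<sigma> c) c) [0..<k] 1)"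
    by (intro alt_sum_cong foldr_inverse_permutes op_commute)
  finally show ?thesis .
qed

end

section \<open>Absence of 2-torsion in the operator algebras\<close>

instance presented_alg :: (relations) two_torsion_free
proof
  fix x :: "'a presented_alg"
  assume "x + x = 0"
  then have "(1 / 2) *\<^sub>C (2 *\<^sub>C x) = 0"
    using cscale_add_left[of 1 1 x] by (simp add: cscale_one)
  then show "x = 0" by (simp add: cscale_cscale cscale_one)
qed

instance fls :: (two_torsion_free) two_torsion_free
proof
  fix x :: "'a fls"
  assume "x + x = 0"
  then have "fls_nth x n + fls_nth x n = 0" for n
    by (metis fls_plus_nth fls_zero_nth)
  then show "x = 0" by (intro fls_eqI) (simp only: fls_zero_nth, rule double_eq_0D)
qed

instance pdo :: ("{derivation_ring, two_torsion_free}") two_torsion_free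
proof
  fix x :: "'a pdo"
  assume "x + x = 0"
  then have "pdo_nth x n + pdo_nth x n = 0" for n
    by (metis pdo_nth_simps(1,3))
  then show "x = 0" by (intro pdo_eqI) (simp only: pdo_nth_simps, rule double_eq_0D)
qed

subsection \<open>Unital ring homomorphisms\<close>

definition unital_ring_hom :: "('a::ring_1 \<Rightarrow> 'b::ring_1) \<Rightarrow> bool"
  where "unital_ring_hom f \<longleftrightarrow> f 1 = 1 \<and> (\<forall>x y. f (x + y) = f x + f y) \<and> (\<forall>x y. f (x * y) = f x * f y)"

context
  fixes f :: "'a::ring_1 \<Rightarrow> 'b::ring_1"
  assumes f: "unital_ring_hom f"
begin

lemma hom_one: "f 1 = 1" and hom_add: "f (x + y) = f x + f y" and hom_mult: "f (x * y) = f x * f y"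
  using f by (auto simp: unital_ring_hom_def)

lemma hom_zero: "f 0 = 0"
  using hom_add[of 0 0] by simp

lemma hom_diff: "f (x - y) = f x - f y"
  using hom_add[of "x - y" y] by simp

lemma hom_uminus: "f (- x) = - f x"
  using hom_diff[of 0 x] by (simp add: hom_zero)

lemma hom_sum: "f (\<Sum>i\<in>I. g i) = (\<Sum>i\<in>I. f (g i))"
  by (induction I rule: infinite_finite_induct) (simp_all add: hom_zero hom_add)

lemma hom_prod_list: "f (prod_list as) = prod_list (map f as)"
  by (induction as) (simp_all add: hom_one hom_mult)

lemma hom_of_nat: "f (of_nat n) = of_nat n"
  by (induction n) (simp_all add: hom_zero hom_add hom_one)

lemma hom_of_int: "f (of_int n) = of_int n"
  by (cases n rule: int_cases2) (simp_all add: hom_of_nat hom_uminus)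

text \<open>\<open>ring_inv\<close> is a definite description and is transported only where an
  inverse exists. For this reason the quasi-minors of \<open>B_mat\<close> are shown to be units
  already over the enveloping algebra.\<close>

lemma hom_ring_inv: "two_sided_unit a \<Longrightarrow> two_sided_unit (f a) \<and> f (ring_inv a) = ring_inv (f a)"
proof -
  assume a: "two_sided_unit a"
  have "f a * f (ring_inv a) = 1" "f (ring_inv a) * f a = 1"
    unfolding hom_mult[symmetric] using a by (simp_all add: hom_one)
  then show ?thesis using two_sided_unitI ring_inv_eqI by metis
qed

lemma hom_mat_inverse_on:
  assumes "mat_inverse_on n A C"
  shows "mat_inverse_on n (\<lambda>i j. f (A i j)) (\<lambda>i j. f (C i j))"
  unfolding mat_inverse_on_def hom_mult[symmetric] hom_sum[symmetric]
  using mat_inverse_onD[OF assms] by (simp add: hom_one hom_zero)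

lemma hom_alt_sum: "f (alt_sum n F) = alt_sum n (\<lambda>\<sigma>. f (F \<sigma>))"
  by (simp add: alt_sum_def hom_sum hom_mult hom_of_int)

lemma hom_col_det: "f (col_det n A) = col_det n (\<lambda>a b. f (A a b))"
  by (simp add: col_det_def hom_alt_sum hom_prod_list comp_def)

end

lemma unital_ring_hom_calg_hom: "calg_hom h \<Longrightarrow> unital_ring_hom h"
  by (simp add: calg_hom_def unital_ring_hom_def)

lemma of_cx_mult: "of_cx (a * b) = of_cx a * of_cx b"
  by (simp add: of_cx_def mult_cscale_left cscale_cscale)

lemma unital_ring_hom_of_cx: "unital_ring_hom of_cx"
  by (simp add: unital_ring_hom_def of_cx_mult) (simp add: of_cx_def cscale_add_left)

lemma of_cx_central: "of_cx c * a = a * of_cx c"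
  by (simp add: of_cx_def mult_cscale_left mult_cscale_right)

subsection \<open>Laurent series\<close>

text \<open>A homomorphism may raise subdegrees. Fixed lower bounds, valid for a series and its
  image alike, allow products to be compared term by term.\<close>

lemma fls_times_nth_interval:
  fixes f g :: "'a::ring_1 fls"
  assumes f: "\<And>n. n < A \<Longrightarrow> fls_nth f n = 0" and g: "\<And>n. n < B \<Longrightarrow> fls_nth g n = 0"
  shows "fls_nth (f * g) n = (\<Sum>i = A..n - B. fls_nth f i * fls_nth g (n - i))"
proof (cases "f = 0 \<or> g = 0")
  case False
  then have A: "A \<le> fls_subdegree f" and B: "B \<le> fls_subdegree g"
    using f g by (auto intro: fls_subdegree_geI)
  have "fls_nth (f * g) n =
      (\<Sum>i = fls_subdegree f..n - fls_subdegree g. fls_nth f i * fls_nth g (n - i))"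
    by (rule fls_times_nth)
  also have "\<dots> = (\<Sum>i = A..n - B. fls_nth f i * fls_nth g (n - i))"
    by (rule sum.mono_neutral_left) (use A B in auto)
  finally show ?thesis .
qed auto

lemma fls_bound: obtains A where "\<And>n. n < A \<Longrightarrow> fls_nth f n = 0"
  using fls_eq0_below_subdegree by metis

lemma unital_ring_hom_fls_map:
  fixes h :: "'a::ring_1 \<Rightarrow> 'b::ring_1"
  assumes h: "unital_ring_hom h"
  shows "unital_ring_hom (fls_map h)"
  unfolding unital_ring_hom_def
proof (intro conjI allI)
  note nth = fls_nth_map[of h, OF hom_zero[OF h]]
  show "fls_map h 1 = 1" by (rule fls_eqI) (simp add: nth hom_zero[OF h] hom_one[OF h])
  fix f g :: "'a fls"
  show "fls_map h (f + g) = fls_map h f + fls_map h g" by (rule fls_eqI) (simp add: nth hom_add[OF h])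
  obtain A where A: "\<And>n. n < A \<Longrightarrow> fls_nth f n = 0" using fls_bound by metis
  obtain B where B: "\<And>n. n < B \<Longrightarrow> fls_nth g n = 0" using fls_bound by metis
  show "fls_map h (f * g) = fls_map h f * fls_map h g"
  proof (rule fls_eqI)
    fix n
    have "fls_nth (fls_map h f * fls_map h g) n =
        (\<Sum>i = A..n - B. fls_nth (fls_map h f) i * fls_nth (fls_map h g) (n - i))"
      by (rule fls_times_nth_interval) (simp_all add: nth A B hom_zero[OF h])
    then show "fls_nth (fls_map h (f * g)) n = fls_nth (fls_map h f * fls_map h g) n"
      using fls_times_nth_interval[of A f B g n] A B by (simp add: nth hom_sum[OF h] hom_mult[OF h])
  qed
qed

lemma fls_map_const: "h 0 = 0 \<Longrightarrow> fls_map h (fls_const c) = fls_const (h c)"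
  by (rule fls_eqI) (simp add: fls_nth_map)

lemma fls_map_X_inv: "h 0 = 0 \<Longrightarrow> h 1 = 1 \<Longrightarrow> fls_map h fls_X_inv = fls_X_inv"
  by (rule fls_eqI) (simp add: fls_nth_map)

lemma fls_nth_derivation:
  "fls_nth (derivation f) n = - (of_int (n - 1) * fls_nth f (n - 1))" for f :: "'a::ring_1 fls"
  by (simp add: derivation_fls_def fls_X_power_times_conv_shift)

lemma fls_map_derivation:
  fixes h :: "'a::ring_1 \<Rightarrow> 'b::ring_1"
  assumes h: "unital_ring_hom h"
  shows "fls_map h (derivation f) = derivation (fls_map h f)"
proof -
  note hom = hom_zero[OF h] hom_uminus[OF h] hom_mult[OF h] hom_of_int[OF h]
  show ?thesis
    by (rule fls_eqI) (simp only: fls_nth_map[of h, OF hom(1)] fls_nth_derivation hom)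
qed

lemma derivation_fls_const [simp]: "derivation (fls_const c :: 'a::ring_1 fls) = 0"
  by (rule fls_eqI) (simp add: fls_nth_derivation)

lemma fls_const_nth_mult:
  fixes F :: "'a::ring_1 fls"
  shows "fls_nth (fls_const c * F) n = c * fls_nth F n" "fls_nth (F * fls_const c) n = fls_nth F n * c"
proof -
  obtain A where A: "\<And>n. n < A \<Longrightarrow> fls_nth F n = 0" using fls_bound by metis
  have "fls_nth (fls_const c * F) n = (\<Sum>i = min 0 (n - A)..n - A. fls_nth (fls_const c) i * fls_nth F (n - i))"
    by (rule fls_times_nth_interval) (use A in auto)
  also have "\<dots> = (\<Sum>i = min 0 (n - A)..n - A. if i = 0 then c * fls_nth F n else 0)"
    by (rule sum.cong) auto
  also have "\<dots> = c * fls_nth F n" using A[of n] by auto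
  finally show "fls_nth (fls_const c * F) n = c * fls_nth F n" .
  have "fls_nth (F * fls_const c) n = (\<Sum>i = A..n - min 0 (n - A). fls_nth F i * fls_nth (fls_const c) (n - i))"
    by (rule fls_times_nth_interval) (use A in auto)
  also have "\<dots> = (\<Sum>i = A..n - min 0 (n - A). if i = n then fls_nth F n * c else 0)"
    by (rule sum.cong) auto
  also have "\<dots> = fls_nth F n * c" using A[of n] by auto
  finally show "fls_nth (F * fls_const c) n = fls_nth F n * c" .
qed

lemma fls_X_inv_nth_mult:
  fixes F :: "'a::ring_1 fls"
  shows "fls_nth (fls_X_inv * F) n = fls_nth F (n + 1)" "fls_nth (F * fls_X_inv) n = fls_nth F (n + 1)"
  by (simp_all add: fls_X_inv_times_conv_shift)

lemma fls_map_of_cx_central: "fls_map of_cx c * F = F * fls_map of_cx c"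
proof (rule fls_eqI)
  fix n
  obtain A where A: "\<And>n. n < A \<Longrightarrow> fls_nth (fls_map of_cx c) n = (0 :: 'a)"
    using fls_bound by metis
  obtain B where B: "\<And>n. n < B \<Longrightarrow> fls_nth F n = 0" using fls_bound by metis
  have "fls_nth (fls_map of_cx c * F) n =
      (\<Sum>i = A..n - B. fls_nth (fls_map of_cx c) i * fls_nth F (n - i))"
    by (rule fls_times_nth_interval) (use A B in auto)
  also have "\<dots> = (\<Sum>i = B..n - A. fls_nth F i * fls_nth (fls_map of_cx c) (n - i))"
    by (rule sum.reindex_bij_witness[of _ "\<lambda>i. n - i" "\<lambda>i. n - i"])
      (auto simp: fls_nth_map of_cx_central)
  also have "\<dots> = fls_nth (F * fls_map of_cx c) n"
    by (rule fls_times_nth_interval[symmetric]) (use A B in auto)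
  finally show "fls_nth (fls_map of_cx c * F) n = fls_nth (F * fls_map of_cx c) n" .
qed

subsection \<open>Orders of pseudodifferential operators\<close>

lemma unital_ring_hom_pdo_map:
  fixes h :: "'a::derivation_ring \<Rightarrow> 'b::derivation_ring"
  assumes h: "unital_ring_hom h" and der: "\<And>a. h (derivation a) = derivation (h a)"
  shows "unital_ring_hom (pdo_map h)"
  unfolding unital_ring_hom_def
proof (intro conjI allI)
  note nth = pdo_nth_map[of h, OF hom_zero[OF h]]
  have ders: "h ((derivation ^^ s) a) = (derivation ^^ s) (h a)" for s a
    by (induction s) (simp_all add: der)
  show "pdo_map h 1 = 1" by (rule pdo_eqI) (simp add: nth hom_zero[OF h] hom_one[OF h])
  fix P Q :: "'a pdo"
  show "pdo_map h (P + Q) = pdo_map h P + pdo_map h Q" by (rule pdo_eqI) (simp add: nth hom_add[OF h])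
  obtain A where A: "\<And>r. pdo_nth P r \<noteq> 0 \<Longrightarrow> r \<le> A" using pdo_bound[of P] by metis
  obtain B where B: "\<And>r. pdo_nth Q r \<noteq> 0 \<Longrightarrow> r \<le> B" using pdo_bound[of Q] by metis
  show "pdo_map h (P * Q) = pdo_map h P * pdo_map h Q"
  proof (rule pdo_eqI)
    fix N
    let ?S = "nat (A + B - N)"
    have 1: "pdo_nth (P * Q) N = (\<Sum>r\<in>{N - B..A}. \<Sum>s\<le>?S.
        of_int (zbinom r s) * (pdo_nth P r * (derivation ^^ s) (pdo_nth Q (N - r + int s))))"
      by (rule pdo_nth_times_box[OF A B]) auto
    have 2: "pdo_nth (pdo_map h P * pdo_map h Q) N = (\<Sum>r\<in>{N - B..A}. \<Sum>s\<le>?S.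
        of_int (zbinom r s) * (pdo_nth (pdo_map h P) r * (derivation ^^ s) (pdo_nth (pdo_map h Q) (N - r + int s))))"
    proof (rule pdo_nth_times_box)
      show "r \<le> A" if "pdo_nth (pdo_map h P) r \<noteq> 0" for r
        using that A[of r] hom_zero[OF h] by (cases "pdo_nth P r = 0") (auto simp: nth)
      show "r \<le> B" if "pdo_nth (pdo_map h Q) r \<noteq> 0" for r
        using that B[of r] hom_zero[OF h] by (cases "pdo_nth Q r = 0") (auto simp: nth)
    qed auto
    show "pdo_nth (pdo_map h (P * Q)) N = pdo_nth (pdo_map h P * pdo_map h Q) N"
      unfolding 2 nth 1 by (simp add: hom_sum[OF h] hom_mult[OF h] hom_of_int[OF h] ders)
  qed
qed

lemma pdo_map_const: "h 0 = 0 \<Longrightarrow> pdo_map h (pdo_const c) = pdo_const (h c)"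
  by (rule pdo_eqI) (simp add: pdo_nth_map pdo_nth_const)

lemma pdo_map_partial: "h 0 = 0 \<Longrightarrow> h 1 = 1 \<Longrightarrow> pdo_map h pdo_partial = pdo_partial"
  by (rule pdo_eqI) (simp add: pdo_nth_map pdo_nth_partial)

lemma pdo_nth_const_mult:
  fixes P :: "'a::derivation_ring pdo"
  shows "pdo_nth (pdo_const a * P) N = a * pdo_nth P N"
proof -
  obtain B where B: "\<And>r. pdo_nth P r \<noteq> 0 \<Longrightarrow> r \<le> B" using pdo_bound[of P] by metis
  have "pdo_nth (pdo_const a * P) N = (\<Sum>(r, s) \<in> {0} \<times> {..nat (B - N)}.
      of_int (zbinom r s) * (pdo_nth (pdo_const a) r * (derivation ^^ s) (pdo_nth P (N - r + int s))))"
    by (rule pdo_nth_times) (auto simp: pdo_nth_const split: if_splits dest!: B)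
  also have "\<dots> = (\<Sum>s\<le>nat (B - N). of_int (zbinom 0 s) * (a * (derivation ^^ s) (pdo_nth P (N + int s))))"
    by (simp only: sum.cartesian_product[symmetric]) (simp add: pdo_nth_const del: zbinom_simps)
  also have "\<dots> = (\<Sum>s\<le>nat (B - N). if s = 0 then a * pdo_nth P N else 0)"
    by (rule sum.cong) auto
  finally show ?thesis by simp
qed

lemma pdo_nth_mult_monomial:
  fixes P :: "'a::derivation_ring pdo"
  assumes Q: "\<And>r. pdo_nth Q r = (if r = M then c else 0)" and c: "derivation c = 0"
  shows "pdo_nth (P * Q) N = pdo_nth P (N - M) * c"
proof -
  obtain B where B: "\<And>r. pdo_nth P r \<noteq> 0 \<Longrightarrow> r \<le> B" using pdo_bound[of P] by metis
  have dc: "(derivation ^^ s) c = (if s = 0 then c else 0)" for s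
    by (induction s) (simp_all add: c)
  have "pdo_nth (P * Q) N = (\<Sum>(r, s) \<in> (\<lambda>s. (N - M + int s, s)) ` {..nat (B + M - N)}.
      of_int (zbinom r s) * (pdo_nth P r * (derivation ^^ s) (pdo_nth Q (N - r + int s))))"
  proof (rule pdo_nth_times)
    fix r s assume "pdo_nth P r \<noteq> 0" "pdo_nth Q (N - r + int s) \<noteq> 0"
    then have "r \<le> B" "r = N - M + int s" using B by (auto simp: Q split: if_splits)
    then show "(r, s) \<in> (\<lambda>s. (N - M + int s, s)) ` {..nat (B + M - N)}" by auto
  qed simp
  also have "\<dots> = (\<Sum>s\<le>nat (B + M - N). if s = 0 then pdo_nth P (N - M) * c else 0)"
  proof (subst sum.reindex)
    show "inj_on (\<lambda>s. (N - M + int s, s)) {..nat (B + M - N)}" by (auto intro: inj_onI)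
  qed (rule sum.cong, auto simp: Q dc)
  finally show ?thesis by simp
qed

lemmas pdo_nth_mult_partial = pdo_nth_mult_monomial[OF pdo_nth_partial derivation_one, unfolded mult_1_right]
lemmas pdo_nth_mult_const = pdo_nth_mult_monomial[OF pdo_nth_const, unfolded diff_0_right]

lemma unital_ring_hom_pdo_const: "unital_ring_hom pdo_const"
  unfolding unital_ring_hom_def
proof (intro conjI allI)
  show "pdo_const 1 = 1" by (rule pdo_eqI) (simp add: pdo_nth_const)
  show "pdo_const (x + y) = pdo_const x + pdo_const y" for x y :: 'a
    by (rule pdo_eqI) (simp add: pdo_nth_const)
  show "pdo_const (x * y) = pdo_const x * pdo_const y" for x y :: 'a
    by (rule pdo_eqI) (simp add: pdo_nth_const pdo_nth_const_mult)
qed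

definition pdo_order_le :: "'a::zero pdo \<Rightarrow> int \<Rightarrow> bool"
  where "pdo_order_le P N \<longleftrightarrow> (\<forall>r>N. pdo_nth P r = 0)"

lemma pdo_order_leD: "pdo_order_le P N \<Longrightarrow> r > N \<Longrightarrow> pdo_nth P r = 0"
  by (simp add: pdo_order_le_def)

lemma pdo_order_le_mono: "pdo_order_le P M \<Longrightarrow> M \<le> N \<Longrightarrow> pdo_order_le P N"
  by (auto simp: pdo_order_le_def)

lemma pdo_order_le_const [simp]: "pdo_order_le (pdo_const a) 0"
  by (simp add: pdo_order_le_def pdo_nth_const)

context
  fixes P Q :: "'a::derivation_ring pdo"
begin

lemma pdo_order_le_0 [simp]: "pdo_order_le (0 :: 'a pdo) N"
  by (simp add: pdo_order_le_def)

lemma pdo_order_le_1 [simp]: "pdo_order_le (1 :: 'a pdo) 0"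
  by (simp add: pdo_order_le_def)

lemma pdo_order_le_add: "pdo_order_le P N \<Longrightarrow> pdo_order_le Q N \<Longrightarrow> pdo_order_le (P + Q) N"
  by (simp add: pdo_order_le_def)

lemma pdo_order_le_diff: "pdo_order_le P N \<Longrightarrow> pdo_order_le Q N \<Longrightarrow> pdo_order_le (P - Q) N"
  by (simp add: pdo_order_le_def)

lemma pdo_order_le_uminus: "pdo_order_le P N \<Longrightarrow> pdo_order_le (- P) N"
  by (simp add: pdo_order_le_def)

lemma
  assumes P: "pdo_order_le P M" and Q: "pdo_order_le Q N"
  shows pdo_order_le_mult: "pdo_order_le (P * Q) (M + N)"
    and pdo_nth_mult_top: "pdo_nth (P * Q) (M + N) = pdo_nth P M * pdo_nth Q N"
proof -
  have bounds: "pdo_nth P r \<noteq> 0 \<Longrightarrow> r \<le> M" "pdo_nth Q r \<noteq> 0 \<Longrightarrow> r \<le> N" for r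
    using pdo_order_leD[OF P, of r] pdo_order_leD[OF Q, of r] by force+
  have box: "pdo_nth (P * Q) K = (\<Sum>r\<in>{K - N..M}. \<Sum>s\<le>nat (M + N - K).
      of_int (zbinom r s) * (pdo_nth P r * (derivation ^^ s) (pdo_nth Q (K - r + int s))))" for K
    by (rule pdo_nth_times_box[OF bounds]) auto
  show "pdo_order_le (P * Q) (M + N)" by (simp add: pdo_order_le_def box)
  show "pdo_nth (P * Q) (M + N) = pdo_nth P M * pdo_nth Q N" by (simp add: box)
qed

end

lemma pdo_order_le_sum:
  fixes f :: "'i \<Rightarrow> 'a::derivation_ring pdo"
  shows "(\<And>i. i \<in> I \<Longrightarrow> pdo_order_le (f i) N) \<Longrightarrow> pdo_order_le (\<Sum>i\<in>I. f i) N"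
  by (induction I rule: infinite_finite_induct) (simp_all add: pdo_order_le_add)

lemma pdo_order_le_power:
  fixes E :: "'a::derivation_ring pdo"
  assumes "pdo_order_le E (- 1)"
  shows "pdo_order_le (E ^ n) (- int n)"
proof (induction n)
  case (Suc n)
  then show ?case using pdo_order_le_mult[OF assms Suc] by (simp add: algebra_simps)
qed simp

text \<open>The geometric series. Since \<open>E ^ n\<close> has order at most \<open>- n\<close>,
  the coefficient at \<open>r\<close> receives only the powers up to \<open>nat (- r)\<close>, and
  the partial sums \<open>S M\<close> agree with \<open>Q\<close> up to order below
  \<open>- M\<close>.\<close>

lemma pdo_one_minus_unit:
  fixes E :: "'a::derivation_ring pdo"
  assumes E: "pdo_order_le E (- 1)"
  obtains Q where "(1 - E) * Q = 1" "Q * (1 - E) = 1" "pdo_order_le Q 0"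
proof -
  define Q where "Q = Abs_pdo (\<lambda>r. \<Sum>n\<le>nat (- r). pdo_nth (E ^ n) r)"
  have Q: "pdo_nth Q r = (\<Sum>n\<le>nat (- r). pdo_nth (E ^ n) r)" for r
    unfolding Q_def by (subst pdo_nth_Abs[of 0]) simp_all
  define S where "S M = (\<Sum>n\<le>M. E ^ n)" for M
  have nth_S: "pdo_nth (S M) r = (\<Sum>n\<le>M. pdo_nth (E ^ n) r)" for M r
    unfolding S_def by (induction M) simp_all
  have QS: "pdo_order_le (Q - S M) (- int (Suc M))" for M
    unfolding pdo_order_le_def
  proof (intro allI impI)
    fix r assume r: "r > - int (Suc M)"
    have "pdo_nth (E ^ n) r = 0" if "\<not> n \<le> nat (- r)" for n
      by (rule pdo_order_leD[OF pdo_order_le_power[OF E]]) (use that in linarith)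
    then have "(\<Sum>n\<le>nat (- r). pdo_nth (E ^ n) r) = (\<Sum>n\<le>M. pdo_nth (E ^ n) r)"
      by (intro sum.mono_neutral_left) (use r in auto)
    then show "pdo_nth (Q - S M) r = 0" by (simp add: Q nth_S)
  qed
  have S: "(1 - E) * S M = 1 - E ^ Suc M" "S M * (1 - E) = 1 - E ^ Suc M" for M
  proof (induction M)
    case (Suc M)
    have "S (Suc M) = S M + E ^ Suc M" by (simp add: S_def)
    then show "(1 - E) * S (Suc M) = 1 - E ^ Suc (Suc M)" "S (Suc M) * (1 - E) = 1 - E ^ Suc (Suc M)"
      by (simp_all only: distrib_left distrib_right Suc)
        (simp_all add: left_diff_distrib right_diff_distrib power_commutes mult.assoc)
  qed (simp_all add: S_def)
  have E0: "pdo_order_le (1 - E) 0"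
    by (intro pdo_order_le_diff pdo_order_le_mono[OF E]) simp_all
  have "pdo_nth ((1 - E) * Q) r = pdo_nth 1 r \<and> pdo_nth (Q * (1 - E)) r = pdo_nth 1 r" for r
  proof -
    define M where "M = nat (- r)"
    have M: "r > - int (Suc M)" by (simp add: M_def)
    have "(1 - E) * Q = (1 - E) * (Q - S M) + (1 - E) * S M"
      "Q * (1 - E) = (Q - S M) * (1 - E) + S M * (1 - E)"
      by (simp_all flip: distrib_left distrib_right)
    then have "(1 - E) * Q = (1 - E) * (Q - S M) + (1 - E ^ Suc M)"
      "Q * (1 - E) = (Q - S M) * (1 - E) + (1 - E ^ Suc M)"
      by (simp_all only: S)
    moreover have "pdo_nth ((1 - E) * (Q - S M)) r = 0" "pdo_nth ((Q - S M) * (1 - E)) r = 0"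
      using pdo_order_leD[OF pdo_order_le_mult[OF E0 QS] , of M r]
        pdo_order_leD[OF pdo_order_le_mult[OF QS E0], of M r] M by simp_all
    moreover have "pdo_nth (E ^ Suc M) r = 0"
      using pdo_order_leD[OF pdo_order_le_power[OF E] M] .
    ultimately show ?thesis by (simp del: power_Suc)
  qed
  then have "(1 - E) * Q = 1" "Q * (1 - E) = 1" by (auto intro: pdo_eqI)
  moreover have "pdo_order_le Q 0" by (simp add: pdo_order_le_def Q)
  ultimately show ?thesis using that by blast
qed

text \<open>\<open>W\<close> inverts the leading term, so \<open>P * W\<close> differs from 1 by an
  operator of negative order, and the geometric series yields a right inverse of \<open>P\<close>.
  It is two-sided because \<open>W\<close> is a unit.\<close>

lemma
  fixes P :: "'a::derivation_ring pdo"
  assumes P: "pdo_order_le P N" and unit: "two_sided_unit (pdo_nth P N)"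
  shows pdo_unit: "two_sided_unit P"
    and pdo_order_le_ring_inv: "pdo_order_le (ring_inv P) (- N)"
    and pdo_nth_ring_inv: "pdo_nth (ring_inv P) (- N) = ring_inv (pdo_nth P N)"
proof -
  define D :: "int \<Rightarrow> 'a pdo" where "D M = Abs_pdo (\<lambda>r. if r = M then 1 else 0)" for M
  have D: "pdo_nth (D M) r = (if r = M then 1 else 0)" for M r
    unfolding D_def by (subst pdo_nth_Abs[of M]) auto
  have DD: "D M * D K = D (M + K)" for M K
    by (rule pdo_eqI) (simp add: pdo_nth_mult_monomial[OF D] D algebra_simps)
  have D0: "D 0 = 1" by (rule pdo_eqI) (simp add: D)
  let ?a = "ring_inv (pdo_nth P N)"
  define W where "W = D (- N) * pdo_const ?a"
  note const = unital_ring_hom_pdo_const[where 'a = 'a]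
  have a: "pdo_const ?a * pdo_const (pdo_nth P N) = 1" "pdo_const (pdo_nth P N) * pdo_const ?a = 1"
    using unit by (simp_all add: hom_one[OF const] flip: hom_mult[OF const])
  have "W * (pdo_const (pdo_nth P N) * D N) = 1"
  proof -
    have "W * (pdo_const (pdo_nth P N) * D N) = D (- N) * (pdo_const ?a * pdo_const (pdo_nth P N)) * D N"
      by (simp only: W_def mult.assoc)
    then show ?thesis by (simp only: a) (simp add: DD D0)
  qed
  moreover have "pdo_const (pdo_nth P N) * D N * W = 1"
  proof -
    have "pdo_const (pdo_nth P N) * D N * W = pdo_const (pdo_nth P N) * (D N * D (- N)) * pdo_const ?a"
      by (simp only: W_def mult.assoc)
    then show ?thesis by (simp add: DD D0 a)
  qed
  ultimately have W: "two_sided_unit W" by (rule two_sided_unitI)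
  have D_order: "pdo_order_le (D (- N)) (- N)" by (simp add: pdo_order_le_def D)
  have W_order: "pdo_order_le W (- N)" and W_top: "pdo_nth W (- N) = ?a"
    using pdo_order_le_mult[OF D_order, of "pdo_const ?a" 0] pdo_nth_mult_top[OF D_order, of "pdo_const ?a" 0]
    by (simp_all add: W_def D pdo_nth_const)
  define E where "E = 1 - P * W"
  have "pdo_order_le E (- 1)"
    unfolding pdo_order_le_def
  proof (intro allI impI)
    fix r :: int assume "r > - 1"
    then consider "r = 0" | "r > 0" by linarith
    then show "pdo_nth E r = 0"
      using pdo_nth_mult_top[OF P W_order] pdo_order_leD[OF pdo_order_le_mult[OF P W_order], of r] unit
      by cases (simp_all add: E_def W_top)
  qed
  then obtain Q where Q: "(1 - E) * Q = 1" "Q * (1 - E) = 1" "pdo_order_le Q 0"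
    by (rule pdo_one_minus_unit)
  have PW: "1 - E = P * W" by (simp add: E_def)
  have 1: "P * (W * Q) = 1" using Q(1) by (simp add: PW mult.assoc)
  have 2: "W * Q * P = 1"
  proof -
    have "W * Q * P = W * (Q * (1 - E)) * ring_inv W"
      using W by (simp add: PW mult.assoc)
    then show ?thesis using W by (simp add: Q(2))
  qed
  show "two_sided_unit P" using 1 2 by (rule two_sided_unitI)
  have inv: "ring_inv P = W * Q" by (rule ring_inv_eqI[OF 1 2])
  show ord: "pdo_order_le (ring_inv P) (- N)"
    unfolding inv using pdo_order_le_mult[OF W_order Q(3)] by simp
  have "pdo_nth (P * ring_inv P) (N + - N) = pdo_nth P N * pdo_nth (ring_inv P) (- N)"
    by (rule pdo_nth_mult_top[OF P ord])
  then have "?a * (pdo_nth P N * pdo_nth (ring_inv P) (- N)) = ?a" using 1 by (simp add: inv)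
  then show "pdo_nth (ring_inv P) (- N) = ?a" using unit by simp
qed

lemma pdo_monic_unit:
  fixes P :: "'a::derivation_ring pdo"
  assumes "pdo_order_le P 0"
  shows "two_sided_unit (pdo_partial - P)" "pdo_order_le (ring_inv (pdo_partial - P)) (- 1)"
    "pdo_order_le (pdo_partial - P) 1"
proof -
  have 1: "pdo_order_le (pdo_partial - P) 1" "pdo_nth (pdo_partial - P) 1 = 1"
    using pdo_order_leD[OF assms] by (simp_all add: pdo_order_le_def pdo_nth_partial)
  then show "two_sided_unit (pdo_partial - P)" "pdo_order_le (ring_inv (pdo_partial - P)) (- 1)"
    "pdo_order_le (pdo_partial - P) 1"
    using pdo_unit[OF 1(1)] pdo_order_le_ring_inv[OF 1(1)] by simp_all
qed

text \<open>Every \<open>\<delta> j i\<close> is the derivative minus an operator of order at most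
  0, hence a unit with inverse of order at most - 1. An update therefore changes \<open>L\<close>
  only in negative orders, and the leading coefficients stay those of the inverse diagonal
  matrix.\<close>

lemma howe_pair_units_pdo:
  fixes x y :: "nat \<Rightarrow> nat \<Rightarrow> 'a::{derivation_ring,two_torsion_free} pdo"
  assumes hp: "howe_pair N k x y \<alpha> \<tau> od"
    and xy: "\<And>p a. pdo_order_le (x p a) 0" "\<And>p a. pdo_order_le (y p a) 0"
    and \<alpha>: "\<And>a. pdo_order_le (\<alpha> a) 0" "\<And>a. two_sided_unit (pdo_nth (\<alpha> a) 0)"
    and \<tau>: "\<And>p. \<tau> p = pdo_partial - t p" "\<And>p. pdo_order_le (t p) 0"
  shows "howe_pair_units N k x y \<alpha> \<tau> od"
proof -
  interpret howe_pair N k x y \<alpha> \<tau> od by (rule hp)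
  have mult: "pdo_order_le (P * Q) 0" if "pdo_order_le P 0" "pdo_order_le Q 0" for P Q :: "'a pdo"
    using pdo_order_le_mult[OF that] by simp
  have x': "pdo_order_le (x' p a) 0" for p a using xy by (simp add: x'_def pdo_order_le_uminus)
  have \<delta>: "two_sided_unit (\<delta> j i)" "pdo_order_le (ring_inv (\<delta> j i)) (- 1)"
    if L: "\<And>a b. pdo_order_le (L j i a b) 0" for i j
  proof -
    have "\<delta> j i = pdo_partial - (t i + (\<Sum>a<j. \<Sum>b<j. x' i a * L j i a b * y i b))"
      by (simp add: \<delta>_def schur_def \<tau>)
    moreover have "pdo_order_le (t i + (\<Sum>a<j. \<Sum>b<j. x' i a * L j i a b * y i b)) 0"
      by (intro pdo_order_le_add pdo_order_le_sum mult x' xy L \<tau>)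
    ultimately show "two_sided_unit (\<delta> j i)" "pdo_order_le (ring_inv (\<delta> j i)) (- 1)"
      by (simp_all only: pdo_monic_unit)
  qed
  have L: "pdo_order_le (L j i a b) 0 \<and> pdo_nth (L j i a b) 0 = pdo_nth (L j 0 a b) 0" for j i a b
  proof (induction i arbitrary: a b)
    case 0
    then show ?case using pdo_order_le_ring_inv[OF \<alpha>] by (simp add: L.simps)
  next
    case (Suc i)
    have "pdo_order_le (times_col j (L j i) (y i) a * ring_inv (\<delta> j i)) (- 1)"
      using pdo_order_le_mult[of "times_col j (L j i) (y i) a" 0 "ring_inv (\<delta> j i)" "- 1"] Suc \<delta>(2)
      by (simp add: times_col_def pdo_order_le_sum mult xy)
    from pdo_order_le_mult[OF this, of "row_times j (x' i) (L j i) b" 0]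
    have "pdo_order_le (times_col j (L j i) (y i) a * ring_inv (\<delta> j i) * row_times j (x' i) (L j i) b) (- 1)"
      using Suc by (simp add: row_times_def pdo_order_le_sum mult x')
    moreover have "L j (Suc i) a b = L j i a b +
        times_col j (L j i) (y i) a * ring_inv (\<delta> j i) * row_times j (x' i) (L j i) b"
      by (simp add: L.simps rank_one_update_def \<delta>_def)
    ultimately show ?case using Suc[of a b]
      by (simp add: pdo_order_le_add pdo_order_le_mono[of _ "- 1" 0] pdo_order_leD)
  qed
  show ?thesis
  proof
    show "two_sided_unit (\<delta> j i)" for i j using L by (intro \<delta>) blast
    show "two_sided_unit (L (Suc j) i j j)" for i j
      using pdo_unit[of "L (Suc j) i j j" 0] L[of "Suc j" i j j] \<alpha>(2)[of j] pdo_nth_ring_inv[OF \<alpha>, of j]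
      by (simp add: L.simps)
  qed
qed

text \<open>The order argument without oscillators, for use over the enveloping algebra. Off the
  diagonal the entries have order 0 and the inverse block has order - 1, so every Schur complement
  stays the derivative minus an operator of order at most 0.\<close>

lemma pdo_mat_inverse:
  fixes E :: "nat \<Rightarrow> nat \<Rightarrow> 'a::derivation_ring pdo"
  defines "A \<equiv> \<lambda>i j. (if i = j then pdo_partial else 0) - E i j"
  assumes E: "\<And>i j. pdo_order_le (E i j) 0"
  shows "\<exists>C. mat_inverse_on n A C \<and> (\<forall>i<n. \<forall>j<n. pdo_order_le (C i j) (- 1)) \<and>
    (\<forall>i. n = Suc i \<longrightarrow> two_sided_unit (C i i) \<and> pdo_order_le (ring_inv (C i i)) 1)"
proof (induction n)
  case 0
  then show ?case by (simp add: mat_inverse_on_def)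
next
  case (Suc n)
  then obtain C where C: "mat_inverse_on n A C" and ord: "\<And>i j. i < n \<Longrightarrow> j < n \<Longrightarrow> pdo_order_le (C i j) (- 1)"
    by blast
  define d where "d = A n n - (\<Sum>p<n. \<Sum>q<n. A n p * C p q * A q n)"
  have A: "pdo_order_le (A p n) 0" "pdo_order_le (A n p) 0" if "p < n" for p
    using that by (simp_all add: A_def pdo_order_le_uminus E)
  have u: "pdo_order_le (\<Sum>l<n. C p l * A l n) (- 1)" "pdo_order_le (\<Sum>l<n. A n l * C l p) (- 1)"
    if "p < n" for p
    using pdo_order_le_mult[OF ord[OF that] A(1)] pdo_order_le_mult[OF A(2) ord[OF _ that]] that
    by (auto intro!: pdo_order_le_sum)
  have "pdo_order_le (\<Sum>p<n. \<Sum>q<n. A n p * C p q * A q n) 0"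
  proof (intro pdo_order_le_sum)
    fix p q assume "p \<in> {..<n}" "q \<in> {..<n}"
    then have "pdo_order_le (A n p * C p q * A q n) (0 + - 1 + 0)"
      by (intro pdo_order_le_mult A ord) auto
    then show "pdo_order_le (A n p * C p q * A q n) 0" by (rule pdo_order_le_mono) simp
  qed
  from pdo_order_le_add[OF E this]
  have d: "two_sided_unit d" "pdo_order_le (ring_inv d) (- 1)" "pdo_order_le d 1"
    using pdo_monic_unit[of "E n n + (\<Sum>p<n. \<Sum>q<n. A n p * C p q * A q n)"]
    by (simp_all add: d_def A_def diff_diff_eq)
  let ?C = "bordered_inverse n C (A n) (\<lambda>p. A p n) d"
  have "mat_inverse_on (Suc n) A ?C"
    using mat_inverse_on_bordered[OF C] d(1) by (simp add: d_def)
  moreover have "pdo_order_le (?C i j) (- 1)" if "i < Suc n" "j < Suc n" for i j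
  proof -
    have "pdo_order_le (u * ring_inv d) (- 1)" "pdo_order_le (ring_inv d * w) (- 1)"
      "pdo_order_le (u * ring_inv d * w) (- 1)"
      if "pdo_order_le u (- 1)" "pdo_order_le w (- 1)" for u w
      using pdo_order_le_mult[OF that(1) d(2)] pdo_order_le_mult[OF d(2) that(2)]
        pdo_order_le_mult[OF pdo_order_le_mult[OF that(1) d(2)] that(2)]
      by (auto elim: pdo_order_le_mono)
    then show ?thesis using that u ord d(2)
      by (auto simp: bordered_inverse_def less_Suc_eq intro!: pdo_order_le_add pdo_order_le_uminus)
  qed
  moreover have "?C n n = ring_inv d" by (simp add: bordered_inverse_def)
  ultimately show ?case using d by (intro exI[of _ ?C]) simp
qed

subsection \<open>Scalars and constants in the operator algebra\<close>

definition cst :: "'a::complex_algebra \<Rightarrow> 'a fls pdo" where "cst a = pdo_const (fls_const a)"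
definition sca :: "complex fls \<Rightarrow> 'a::complex_algebra fls pdo" where "sca \<phi> = pdo_const (fls_map of_cx \<phi>)"

lemma unital_ring_hom_comp: "unital_ring_hom f \<Longrightarrow> unital_ring_hom g \<Longrightarrow> unital_ring_hom (\<lambda>x. f (g x))"
  by (simp add: unital_ring_hom_def)

lemma hom_sca: "unital_ring_hom sca"
  unfolding sca_def[abs_def]
  by (intro unital_ring_hom_comp[OF unital_ring_hom_pdo_const] unital_ring_hom_fls_map unital_ring_hom_of_cx)

lemma hom_cst: "unital_ring_hom cst"
proof -
  have "unital_ring_hom (fls_const :: 'b::ring_1 \<Rightarrow> _)"
    by (auto simp: unital_ring_hom_def fls_const_nth_mult intro!: fls_eqI)
  from unital_ring_hom_comp[OF unital_ring_hom_pdo_const this] show ?thesis by (simp add: cst_def[abs_def])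
qed

lemma sca_const: "sca (fls_const c) = cst (of_cx c)"
  by (simp add: sca_def cst_def fls_map_const)

lemma sca_comm: "sca \<phi> * pdo_const F = pdo_const F * sca \<phi>"
  by (simp add: sca_def fls_map_of_cx_central flip: hom_mult[OF unital_ring_hom_pdo_const])

lemma sca_cst: "sca \<phi> * cst a = cst a * sca \<phi>" and sca_sca: "sca \<phi> * sca \<psi> = sca \<psi> * sca \<phi>"
  by (simp_all add: cst_def sca_comm) (metis sca_comm sca_def)

lemma partial_cst: "pdo_partial * cst a = cst a * pdo_partial"
proof -
  have "pdo_const (0 :: 'a fls) = 0" by (rule hom_zero[OF unital_ring_hom_pdo_const])
  then show ?thesis by (simp add: cst_def pdo_partial_const)
qed

lemma cst_of_cx_comm: "cst (of_cx c) * P = P * cst (of_cx c)"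
proof (rule pdo_eqI)
  fix r
  show "pdo_nth (cst (of_cx c) * P) r = pdo_nth (P * cst (of_cx c)) r"
    unfolding cst_def using fls_map_of_cx_central[of "fls_const c"]
    by (simp add: pdo_nth_const_mult pdo_nth_mult_const fls_map_const)
qed

abbreviation (input) lin :: "complex \<Rightarrow> complex fls" where "lin c \<equiv> fls_X_inv - fls_const c"

lemma lin_nonzero: "lin c \<noteq> 0"
proof
  assume "lin c = 0"
  then have "fls_nth (lin c) (- 1) = 0" by simp
  then show False by simp
qed

lemma partial_sca_lin: "pdo_partial * sca (lin c) = sca (lin c) * pdo_partial + 1"
proof -
  have "derivation (fls_map of_cx (lin c) :: 'a::complex_algebra fls) = fls_map of_cx (derivation (lin c))"
    by (rule fls_map_derivation[symmetric]) (rule unital_ring_hom_of_cx)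
  also have "derivation (lin c) = 1"
    using derivation_add[of "lin c" "fls_const c"] derivation_fls_X_inv[where 'a = complex] by simp
  finally show ?thesis
    by (simp add: sca_def pdo_partial_const hom_one[OF unital_ring_hom_fls_map[OF unital_ring_hom_of_cx]]
        hom_one[OF unital_ring_hom_pdo_const])
qed

lemma sca_inverse: "sca (lin c) * sca (1 / lin c) = 1" "sca (1 / lin c) * sca (lin c) = 1"
  using lin_nonzero[of c] by (simp_all add: hom_one[OF hom_sca] flip: hom_mult[OF hom_sca])

lemma sca_lin_unit: "two_sided_unit (sca (lin c))" "ring_inv (sca (lin c)) = sca (1 / lin c)"
  using sca_inverse two_sided_unitI ring_inv_eqI by metis+

lemma partial_sca_inverse:
  "pdo_partial * sca (1 / lin c) = sca (1 / lin c) * pdo_partial - sca (1 / lin c) * sca (1 / lin c)"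
proof -
  let ?w = "sca (1 / lin c) :: 'a fls pdo"
  have "?w * (pdo_partial * sca (lin c)) * ?w = ?w * (sca (lin c) * pdo_partial + 1) * ?w"
    by (simp only: partial_sca_lin)
  moreover have "?w * (pdo_partial * sca (lin c)) * ?w = ?w * pdo_partial * (sca (lin c) * ?w)"
    "?w * (sca (lin c) * pdo_partial + 1) * ?w = (?w * sca (lin c)) * pdo_partial * ?w + ?w * ?w"
    by (simp_all add: distrib_left distrib_right mult.assoc)
  ultimately have "?w * pdo_partial = pdo_partial * ?w + ?w * ?w"
    by (simp only: sca_inverse mult_1_left mult_1_right)
  then show ?thesis by simp
qed

definition tau :: "complex \<Rightarrow> 'a::complex_algebra fls pdo"
  where "tau c = pdo_partial - cst (of_cx c)"

lemma tau_unit: "two_sided_unit (tau c)"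
  unfolding tau_def by (rule pdo_monic_unit) (simp add: cst_def)

lemma tau_comm: "tau c * cst a = cst a * tau c" "tau c * tau c' = tau c' * tau c"
  "tau c * sca (lin c') = sca (lin c') * tau c + 1"
  using cst_of_cx_comm[of c "cst a"] cst_of_cx_comm[of c "cst (of_cx c')"] cst_of_cx_comm[of c "sca (lin c')"]
  by (simp_all add: tau_def left_diff_distrib right_diff_distrib partial_cst partial_sca_lin)

subsection \<open>The dual pair inside the Weyl superalgebra\<close>

context
  fixes z \<Lambda> :: "nat \<Rightarrow> complex"
begin

text \<open>Constants commute with v and with the derivative, so the oscillator relations carry over
  unchanged. The leading coefficient of each \<open>\<alpha>\<close> is \<open>v - z\<close>, a unit
  among Laurent series.\<close>

lemma howe_pair_weyl:
  "howe_pair_units (CARD('m) + CARD('n)) CARD('k) (\<lambda>i a. cst (wx i a :: ('m, 'n, 'k) weyl))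
    (\<lambda>i a. cst (wd i a)) (\<lambda>a. sca (lin (z a))) (\<lambda>i. tau (\<Lambda> i)) (\<lambda>i. \<not> i < CARD('m))"
proof (rule howe_pair_units_pdo[where t = "\<lambda>i. cst (of_cx (\<Lambda> i))"])
  have sign: "(- 1 :: complex) ^ (parity CARD('m) p * parity CARD('m) q) =
      (if \<not> p < CARD('m) \<and> \<not> q < CARD('m) then - 1 else 1)" for p q
    by (simp add: parity_def)
  have cs: "(if c then - 1 else 1) *\<^sub>C u = (if c then - u else u)" for c and u :: "('m, 'n, 'k) weyl"
    by (simp add: cscale_minus_left cscale_one)
  note hom = hom_mult[OF hom_cst, symmetric] hom_uminus[OF hom_cst, symmetric] hom_add[OF hom_cst, symmetric]
    hom_one[OF hom_cst, symmetric]
  show "howe_pair (CARD('m) + CARD('n)) CARD('k) (\<lambda>i a. cst (wx i a :: ('m, 'n, 'k) weyl))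
    (\<lambda>i a. cst (wd i a)) (\<lambda>a. sca (lin (z a))) (\<lambda>i. tau (\<Lambda> i)) (\<lambda>i. \<not> i < CARD('m))"
  proof
    fix p q a b
    show "cst (wx p a :: ('m, 'n, 'k) weyl) * cst (wx q b) =
        (if \<not> p < CARD('m) \<and> \<not> q < CARD('m) then - (cst (wx q b) * cst (wx p a)) else cst (wx q b) * cst (wx p a))"
      unfolding hom using wx_wx[of p a q b, where 'm = 'm and 'n = 'n and 'k = 'k] by (simp add: sign cs)
    show "cst (wd p a :: ('m, 'n, 'k) weyl) * cst (wd q b) =
        (if \<not> p < CARD('m) \<and> \<not> q < CARD('m) then - (cst (wd q b) * cst (wd p a)) else cst (wd q b) * cst (wd p a))"
      unfolding hom using wd_wd[of p a q b, where 'm = 'm and 'n = 'n and 'k = 'k] by (simp add: sign cs)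
    show "cst (wd p a :: ('m, 'n, 'k) weyl) * cst (wx q b) =
        (if \<not> p < CARD('m) \<and> \<not> q < CARD('m) then - (cst (wx q b) * cst (wd p a)) else cst (wx q b) * cst (wd p a)) +
        (if p = q \<and> a = b then 1 else 0)"
      if "p < CARD('m) + CARD('n)" "q < CARD('m) + CARD('n)" "a < CARD('k)" "b < CARD('k)"
    proof -
      have "cst (wd p a :: ('m, 'n, 'k) weyl) * cst (wx q b) =
          cst ((if \<not> p < CARD('m) \<and> \<not> q < CARD('m) then - (wx q b * wd p a) else wx q b * wd p a) +
          (if p = q \<and> a = b then 1 else 0))"
        unfolding hom using wd_wx[of p a q b, where 'm = 'm and 'n = 'n and 'k = 'k] that by (simp add: sign cs)
      then show ?thesis by (simp add: hom_add[OF hom_cst] hom_mult[OF hom_cst] hom_uminus[OF hom_cst]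
            hom_one[OF hom_cst] hom_zero[OF hom_cst])
    qed
  qed (simp_all add: sca_cst sca_sca tau_comm sca_lin_unit tau_unit)
  have "unital_ring_hom (fls_map (of_cx :: complex \<Rightarrow> ('m, 'n, 'k) weyl))"
    by (intro unital_ring_hom_fls_map unital_ring_hom_of_cx)
  from hom_ring_inv[OF this, of "lin (z a)" for a]
  show "two_sided_unit (pdo_nth (sca (lin (z a)) :: ('m, 'n, 'k) weyl fls pdo) 0)" for a
    using two_sided_unitI[of "lin (z a)" "1 / lin (z a)"] lin_nonzero[of "z a"] by (simp add: sca_def pdo_nth_const)
qed (simp_all add: cst_def sca_def tau_def)

end

subsection \<open>The bispectral correspondence\<close>

text \<open>A relation and not a map: the powers of v are bounded above in each coefficient, but not
  uniformly over all orders of the derivative, so exchanging the exponents can lead out of the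
  algebra.\<close>

definition bispectral :: "'a::zero fls pdo \<Rightarrow> 'a fls pdo \<Rightarrow> bool"
  where "bispectral P P' \<longleftrightarrow> (\<forall>r s. pdo_coeff2 P r s = pdo_coeff2 P' s r)"

lemma bispectralD: "bispectral P P' \<Longrightarrow> pdo_coeff2 P r s = pdo_coeff2 P' s r"
  by (simp add: bispectral_def)

lemma pdo_coeff2_simps [simp]:
  fixes P Q :: "'a::complex_algebra fls pdo"
  shows "pdo_coeff2 (0 :: 'a fls pdo) r s = 0"
    "pdo_coeff2 (1 :: 'a fls pdo) r s = (if r = 0 \<and> s = 0 then 1 else 0)"
    "pdo_coeff2 (P + Q) r s = pdo_coeff2 P r s + pdo_coeff2 Q r s"
    "pdo_coeff2 (P - Q) r s = pdo_coeff2 P r s - pdo_coeff2 Q r s"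
    "pdo_coeff2 (of_int n * P) r s = of_int n * pdo_coeff2 P r s"
    "pdo_coeff2 (cst a * P) r s = a * pdo_coeff2 P r s"
    "pdo_coeff2 (P * cst a) r s = pdo_coeff2 P r s * a"
    "pdo_coeff2 (P * pdo_partial) r s = pdo_coeff2 P r (s - 1)"
    "pdo_coeff2 (sca fls_X_inv * P) r s = pdo_coeff2 P (r - 1) s"
proof -
  have "of_int n = (cst (of_int n) :: 'a fls pdo)" by (rule hom_of_int[OF hom_cst, symmetric])
  then show "pdo_coeff2 (of_int n * P) r s = of_int n * pdo_coeff2 P r s"
    by (simp add: pdo_coeff2_def cst_def pdo_nth_const_mult fls_const_nth_mult)
qed (simp_all add: pdo_coeff2_def cst_def sca_def pdo_nth_const_mult pdo_nth_mult_const fls_const_nth_mult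
  pdo_nth_mult_partial fls_map_X_inv fls_X_inv_nth_mult del: fls_const_mult_const)

lemma pdo_coeff2_lin_tau:
  "pdo_coeff2 (sca (lin c) * P) r s = pdo_coeff2 P (r - 1) s - of_cx c * pdo_coeff2 P r s"
  "pdo_coeff2 (P * tau c) r s = pdo_coeff2 P r (s - 1) - of_cx c * pdo_coeff2 P r s"
  by (simp_all add: hom_diff[OF hom_sca] sca_const tau_def left_diff_distrib right_diff_distrib of_cx_central)

lemma bispectral_0: "bispectral 0 (0 :: 'a::complex_algebra fls pdo)"
  and bispectral_1: "bispectral 1 (1 :: 'a::complex_algebra fls pdo)"
  by (auto simp: bispectral_def)

lemma bispectral_diff: "bispectral P P' \<Longrightarrow> bispectral Q Q' \<Longrightarrow> bispectral (P - Q) (P' - Q')"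
  for P P' :: "'a::complex_algebra fls pdo"
  by (simp add: bispectral_def)

lemma bispectral_sum:
  fixes F F' :: "'i \<Rightarrow> 'a::complex_algebra fls pdo"
  shows "(\<And>i. i \<in> I \<Longrightarrow> bispectral (F i) (F' i)) \<Longrightarrow> bispectral (\<Sum>i\<in>I. F i) (\<Sum>i\<in>I. F' i)"
  by (induction I rule: infinite_finite_induct) (simp_all add: bispectral_def)

lemma bispectral_of_int: "bispectral P P' \<Longrightarrow> bispectral (of_int n * P) (of_int n * P')"
  for P P' :: "'a::complex_algebra fls pdo"
  by (simp add: bispectral_def)

lemma bispectral_cst: "bispectral P P' \<Longrightarrow> bispectral (cst a * P * cst b) (cst a * P' * cst b)"
  by (simp add: bispectral_def)

text \<open>Functions multiplied from the left and derivatives from the right only shift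
  coefficients, with no derivative terms; the correspondence exchanges these two sides.\<close>

lemma bispectral_tau_lin: "bispectral P P' \<Longrightarrow> bispectral (P * tau c) (sca (lin c) * P')"
  and bispectral_lin_tau: "bispectral P P' \<Longrightarrow> bispectral (sca (lin c) * P) (P' * tau c)"
  by (simp_all add: bispectral_def pdo_coeff2_lin_tau)

text \<open>The quotients are determined by a recursion for the coefficients, which vanish for large \<open>r\<close>.\<close>

lemma bispectral_inverse:
  fixes P P' :: "'a::complex_algebra fls pdo"
  assumes "bispectral P P'"
  shows "bispectral (sca (1 / lin c) * P) (P' * ring_inv (tau c))"
proof -
  define Q where "Q = sca (1 / lin c) * P"
  define Q' where "Q' = P' * ring_inv (tau c)"
  have P: "P = sca (lin c) * Q" by (simp add: Q_def sca_inverse flip: mult.assoc)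
  have P': "P' = Q' * tau c" by (simp add: Q'_def mult.assoc tau_unit)
  have "pdo_coeff2 Q r s = pdo_coeff2 Q' s r" for r s
  proof -
    define \<delta> where "\<delta> r = pdo_coeff2 Q r s - pdo_coeff2 Q' s r" for r
    have step: "\<delta> (r - 1) = of_cx c * \<delta> r" for r
      using bispectralD[OF assms, of r s]
      by (simp add: P P' pdo_coeff2_lin_tau \<delta>_def right_diff_distrib algebra_simps)
    obtain A where A: "\<And>n. n < A \<Longrightarrow> fls_nth (pdo_nth Q s) n = 0" using fls_bound by metis
    obtain N where N: "\<And>r. pdo_nth Q' r \<noteq> 0 \<Longrightarrow> r \<le> N" using pdo_bound[of Q'] by metis
    \<comment> \<open>With \<open>s\<close> fixed, the Laurent series bounds the powers of v in
      \<open>Q\<close>, and the order bounds those of the derivative in \<open>Q'\<close>. From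
      \<open>M\<close> on both vanish, and the recursion descends from there.\<close>
    define M where "M = max (- A) N + 1"
    have above: "\<delta> (M + int n) = 0" for n
    proof -
      have "pdo_nth Q' (M + int n) = 0" using N[of "M + int n"] by (force simp: M_def)
      moreover have "- (M + int n) < A" by (simp add: M_def)
      ultimately show ?thesis using A by (simp add: \<delta>_def pdo_coeff2_def)
    qed
    have below: "\<delta> (M - int n) = 0" for n
    proof (induction n)
      case 0
      then show ?case using above[of 0] by simp
    next
      case (Suc n)
      have "M - int (Suc n) = M - int n - 1" by simp
      then show ?case by (simp only: step Suc mult_zero_right)
    qed
    have "\<delta> r = 0"
    proof (cases "r \<ge> M")
      case True
      then show ?thesis using above[of "nat (r - M)"] by simp
    next
      case False
      then show ?thesis using below[of "nat (M - r)"] by simp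
    qed
    then show ?thesis by (simp add: \<delta>_def)
  qed
  then show ?thesis by (simp add: bispectral_def Q_def Q'_def)
qed

subsection \<open>The images of the two generating operators\<close>

lemma pi_gl_spec:
  fixes z :: "nat \<Rightarrow> complex"
  defines "h \<equiv> pi_gl z :: ('m, 'n) U_gl_current \<Rightarrow> ('m, 'n, 'k) weyl"
  shows "calg_hom h" "i < CARD('m) + CARD('n) \<Longrightarrow> j < CARD('m) + CARD('n) \<Longrightarrow>
    fls_map h (e_series i j) = (\<Sum>a < CARD('k). fls_const (wx i a * wd j a) * fls_map of_cx (1 / lin (z a)))"
proof -
  have "calg_hom h \<and> (\<forall>i < CARD('m) + CARD('n). \<forall>j < CARD('m) + CARD('n).
      fls_map h (e_series i j) = (\<Sum>a < CARD('k). fls_const (wx i a * wd j a) * fls_map of_cx (1 / lin (z a))))"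
    unfolding h_def pi_gl_def by (rule theI'[OF pi_gl_ex1])
  then show "calg_hom h" "i < CARD('m) + CARD('n) \<Longrightarrow> j < CARD('m) + CARD('n) \<Longrightarrow>
    fls_map h (e_series i j) = (\<Sum>a < CARD('k). fls_const (wx i a * wd j a) * fls_map of_cx (1 / lin (z a)))"
    by auto
qed

lemma pi_k_spec:
  fixes \<Lambda> :: "nat \<Rightarrow> complex"
  defines "h \<equiv> pi_k \<Lambda> :: ('k, 0) U_gl_current \<Rightarrow> ('m, 'n, 'k) weyl"
  shows "calg_hom h" "a < CARD('k) \<Longrightarrow> b < CARD('k) \<Longrightarrow>
    fls_map h (e_series a b) = (\<Sum>i < CARD('m) + CARD('n). fls_const (wx i a * wd i b) * fls_map of_cx (1 / lin (\<Lambda> i)))"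
proof -
  have "calg_hom h \<and> (\<forall>a < CARD('k). \<forall>b < CARD('k). fls_map h (e_series a b) =
      (\<Sum>i < CARD('m) + CARD('n). fls_const (wx i a * wd i b) * fls_map of_cx (1 / lin (\<Lambda> i))))"
    unfolding h_def pi_k_def by (rule theI'[OF pi_k_ex1])
  then show "calg_hom h" "a < CARD('k) \<Longrightarrow> b < CARD('k) \<Longrightarrow>
    fls_map h (e_series a b) = (\<Sum>i < CARD('m) + CARD('n). fls_const (wx i a * wd i b) * fls_map of_cx (1 / lin (\<Lambda> i)))"
    by auto
qed

lemma of_cx_calg_hom: "calg_hom h \<Longrightarrow> h (of_cx c) = of_cx c"
  by (simp add: calg_hom_def of_cx_def)

lemma hom_pdo_map_fls_map: "calg_hom h \<Longrightarrow> unital_ring_hom (pdo_map (fls_map h))"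
  by (intro unital_ring_hom_pdo_map unital_ring_hom_fls_map fls_map_derivation unital_ring_hom_calg_hom)

lemma pdo_map_fls_map_tau:
  assumes "calg_hom h"
  shows "pdo_map (fls_map h) (tau c) = tau c"
proof -
  note hom = hom_zero[OF unital_ring_hom_fls_map[OF unital_ring_hom_calg_hom[OF assms]]]
    hom_one[OF unital_ring_hom_fls_map[OF unital_ring_hom_calg_hom[OF assms]]]
  show ?thesis
    by (simp add: tau_def hom_diff[OF hom_pdo_map_fls_map[OF assms]] pdo_map_partial hom cst_def pdo_map_const
        fls_map_const calg_hom_zero[OF assms] of_cx_calg_hom[OF assms])
qed

lemma pdo_map_fls_map_const:
  "calg_hom h \<Longrightarrow> pdo_map (fls_map h) (pdo_const F) = pdo_const (fls_map h F)"
  by (rule pdo_map_const) (rule hom_zero[OF unital_ring_hom_fls_map[OF unital_ring_hom_calg_hom]])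

definition G_image :: "(nat \<Rightarrow> complex) \<Rightarrow> (nat \<Rightarrow> complex) \<Rightarrow> nat \<Rightarrow> nat \<Rightarrow> ('m, 'n, 'k) weyl fls pdo"
  where "G_image z \<Lambda> a b = (if a = b then tau (z a) else 0) -
    (\<Sum>i < CARD('m) + CARD('n). (cst (wx i a) * sca (1 / lin (\<Lambda> i))) * cst (wd i b))"

lemma pdo_map_cdet_G_mat:
  "pdo_map (fls_map (pi_k \<Lambda> :: ('k, 0) U_gl_current \<Rightarrow> ('m, 'n, 'k) weyl)) (cdet (G_mat z)) =
    col_det CARD('k) (G_image z \<Lambda>)"
proof -
  let ?h = "pi_k \<Lambda> :: ('k, 0) U_gl_current \<Rightarrow> ('m, 'n, 'k) weyl"
  note h = pi_k_spec[where \<Lambda> = \<Lambda> and 'm = 'm and 'n = 'n and 'k = 'k]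
  note hom = hom_pdo_map_fls_map[OF h(1)]
  have G: "G_mat z = mat CARD('k) CARD('k) (\<lambda>(a, b). (if a = b then tau (z a) else 0) -
      pdo_const (e_series a b :: ('k, 0) U_gl_current fls))"
    unfolding G_mat_def tau_def cst_def by (simp add: if_distrib)
  have image: "pdo_map (fls_map ?h) ((if a = b then tau (z a) else 0) - pdo_const (e_series a b)) = G_image z \<Lambda> a b"
    if "a < CARD('k)" "b < CARD('k)" for a b
  proof -
    have "pdo_const (fls_map ?h (e_series a b)) =
        (\<Sum>i < CARD('m) + CARD('n). cst (wx i a * wd i b) * sca (1 / lin (\<Lambda> i)))"
      unfolding h(2)[OF that] cst_def sca_def
      by (simp add: hom_sum[OF unital_ring_hom_pdo_const] hom_mult[OF unital_ring_hom_pdo_const])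
    also have "\<dots> = (\<Sum>i < CARD('m) + CARD('n). (cst (wx i a) * sca (1 / lin (\<Lambda> i))) * cst (wd i b))"
      by (intro sum.cong refl) (simp add: hom_mult[OF hom_cst] mult.assoc sca_cst)
    finally show ?thesis
      by (simp add: G_image_def hom_diff[OF hom] hom_zero[OF hom] pdo_map_fls_map_tau[OF h(1)]
          pdo_map_fls_map_const[OF h(1)])
  qed
  have "pdo_map (fls_map ?h) (cdet (G_mat z)) = col_det CARD('k) (\<lambda>a b. pdo_map (fls_map ?h)
      ((if a = b then tau (z a) else 0) - pdo_const (e_series a b)))"
    unfolding G cdet_mat by (rule hom_col_det[OF hom])
  also have "\<dots> = col_det CARD('k) (G_image z \<Lambda>)"
    unfolding col_det_def
  proof (intro alt_sum_cong arg_cong[where f = prod_list] map_cong refl image)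
    fix \<sigma> c assume "\<sigma> permutes {..<CARD('k)}" "c \<in> set [0..<CARD('k)]"
    then show "\<sigma> c < CARD('k)" "c < CARD('k)" using permutes_in_image[of \<sigma> "{..<CARD('k)}" c] by auto
  qed
  finally show ?thesis .
qed

definition G_op :: "(nat \<Rightarrow> complex) \<Rightarrow> (nat \<Rightarrow> complex) \<Rightarrow> nat \<Rightarrow> nat \<Rightarrow>
    ('m, 'n, 'k) weyl fls pdo \<Rightarrow> ('m, 'n, 'k) weyl fls pdo"
  where "G_op z \<Lambda> a c u = u * (if a = c then tau (z a) else 0) -
    (\<Sum>i < CARD('m) + CARD('n). (cst (wx i a) * sca (1 / lin (\<Lambda> i))) * u * cst (wd i c))"

text \<open>The row index sits on x together with \<open>1 / (u - \<Lambda>)\<close>. The derivative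
  of this fraction and the contraction of oscillators both produce its square, so the commutators
  with the entries are symmetric in the two rows.\<close>

lemma col_det_G_image:
  "col_det CARD('k) (G_image z \<Lambda> :: _ \<Rightarrow> _ \<Rightarrow> ('m, 'n, 'k) weyl fls pdo) =
    alt_sum CARD('k) (\<lambda>\<sigma>. fold (\<lambda>c. G_op z \<Lambda> (\<sigma> c) c) [0..<CARD('k)] 1)"
proof -
  interpret W: howe_pair_units "CARD('m) + CARD('n)" "CARD('k)" "\<lambda>i a. cst (wx i a :: ('m, 'n, 'k) weyl)"
    "\<lambda>i a. cst (wd i a)" "\<lambda>a. sca (lin (z a))" "\<lambda>i. tau (\<Lambda> i)" "\<lambda>i. \<not> i < CARD('m)"
    by (rule howe_pair_weyl)
  let ?x = "\<lambda>i a. cst (wx i a :: ('m, 'n, 'k) weyl)" and ?y = "\<lambda>i a. cst (wd i a :: ('m, 'n, 'k) weyl)"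
  let ?w = "\<lambda>i. sca (1 / lin (\<Lambda> i)) :: ('m, 'n, 'k) weyl fls pdo"
  have comm: "?x q a * ?w q * G_image z \<Lambda> b c - G_image z \<Lambda> b c * (?x q a * ?w q) =
      ?x q b * ?w q * G_image z \<Lambda> a c - G_image z \<Lambda> a c * (?x q b * ?w q)"
    if "q < CARD('m) + CARD('n)" "a < CARD('k)" "b < CARD('k)" "c < CARD('k)" for q a b c
  proof -
    define V where "V a = ?x q a * (?w q * ?w q)" for a
    have 1: "?x q a * ?w q * tau c = tau c * (?x q a * ?w q) + V a" for a c
    proof -
      have "tau c * (?x q a * ?w q) = ?x q a * (tau c * ?w q)"
        by (simp only: tau_comm flip: mult.assoc)
      also have "tau c * ?w q = ?w q * tau c - ?w q * ?w q"
        using cst_of_cx_comm[of c "?w q"]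
        by (simp add: tau_def left_diff_distrib right_diff_distrib partial_sca_inverse)
      finally show ?thesis by (simp add: V_def right_diff_distrib mult.assoc)
    qed
    have 2: "?x q a * ?w q * (?x p b * ?w p * ?y p c) = ?x p b * ?w p * ?y p c * (?x q a * ?w q) -
        (if p = q then if a = c then V b else 0 else 0)"
      if p: "p < CARD('m) + CARD('n)" and ab: "a < CARD('k)" "b < CARD('k)" for p a b
    proof -
      let ?s = "\<lambda>u. if \<not> p < CARD('m) \<and> \<not> q < CARD('m) then - u else u :: ('m, 'n, 'k) weyl fls pdo"
      have w: "?w r * (?x i d * u) = ?x i d * (?w r * u)" "?w r * (?y i d * u) = ?y i d * (?w r * u)"
        "?w r * ?y i d = ?y i d * ?w r" for r i d u
        by (simp_all only: sca_cst flip: mult.assoc)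
      have "?x p b * ?w p * ?y p c * (?x q a * ?w q) = ?x p b * (?y p c * ?x q a) * (?w p * ?w q)"
        by (simp add: mult.assoc w)
      also have "\<dots> = ?s (?x p b * ?x q a * ?y p c) * (?w p * ?w q) +
          (if p = q \<and> a = c then ?x p b * (?w p * ?w q) else 0)"
        using W.yx[of p q c a] that \<open>q < CARD('m) + CARD('n)\<close> \<open>c < CARD('k)\<close>
        by (auto simp: distrib_left distrib_right mult.assoc)
      also have "?s (?x p b * ?x q a * ?y p c) = ?x q a * ?x p b * ?y p c"
        using W.xx[of p b q a] by auto
      also have "?x q a * ?x p b * ?y p c * (?w p * ?w q) = ?x q a * ?w q * (?x p b * ?w p * ?y p c)"
        by (simp add: mult.assoc w sca_sca[of "1 / lin (\<Lambda> p)" "1 / lin (\<Lambda> q)"])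
      finally show ?thesis by (auto simp: V_def)
    qed
    have "?x q a * ?w q * G_image z \<Lambda> b c - G_image z \<Lambda> b c * (?x q a * ?w q) =
        (if b = c then V a else 0) + (if a = c then V b else 0)"
      if "a < CARD('k)" "b < CARD('k)" for a b
    proof -
      have "?x q a * ?w q * (\<Sum>p < CARD('m) + CARD('n). ?x p b * ?w p * ?y p c) =
          (\<Sum>p < CARD('m) + CARD('n). ?x p b * ?w p * ?y p c) * (?x q a * ?w q) - (if a = c then V b else 0)"
        unfolding sum_distrib_left sum_distrib_right
        using \<open>q < CARD('m) + CARD('n)\<close> that by (simp add: 2 sum_subtractf)
      then show ?thesis using 1[of a "z c"]
        by (auto simp: G_image_def right_diff_distrib left_diff_distrib)
    qed
    then show ?thesis using that by simp
  qed
  have op: "(\<lambda>u. u * (if b = c then tau (z b) else 0) -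
      (\<Sum>i < CARD('m) + CARD('n). ?x i b * ?w i * u * ?y i c)) = G_op z \<Lambda> b c" for b c
    by (simp add: G_op_def fun_eq_iff)
  show ?thesis
    unfolding col_det_def
    using alt_sum_normal_order_left[where A = "G_image z \<Lambda>" and T = "\<lambda>b c. if b = c then tau (z b) else 0"
        and N = "CARD('m) + CARD('n)" and X = "\<lambda>i a. ?x i a * ?w i" and Y = ?y and n = "CARD('k)"
        and cs = "[0..<CARD('k)]" and \<Phi> = "\<lambda>_ u. u", unfolded op] comm
    by (simp add: G_image_def[abs_def] atLeast0LessThan)
qed

definition B_entry :: "(nat \<Rightarrow> complex) \<Rightarrow> nat \<Rightarrow> nat \<Rightarrow> ('m, 'n) U_gl_current fls pdo"
  where "B_entry \<Lambda> i j = (if i = j then tau (\<Lambda> i) else 0) - pdo_const ((- 1) ^ parity CARD('m) i * e_series i j)"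

lemma B_mat_eq: "(B_mat \<Lambda> :: ('m, 'n) U_gl_current fls pdo mat) =
    mat (CARD('m) + CARD('n)) (CARD('m) + CARD('n)) (\<lambda>(i, j). B_entry \<Lambda> i j)"
  unfolding B_mat_def B_entry_def tau_def cst_def by (simp add: if_distrib)

lemma B_entry_inverse:
  "\<exists>C. mat_inverse_on n (B_entry \<Lambda> :: _ \<Rightarrow> _ \<Rightarrow> ('m, 'n) U_gl_current fls pdo) C \<and>
    (\<forall>i<n. \<forall>j<n. pdo_order_le (C i j) (- 1)) \<and>
    (\<forall>i. n = Suc i \<longrightarrow> two_sided_unit (C i i) \<and> pdo_order_le (ring_inv (C i i)) 1)"
proof -
  let ?E = "\<lambda>i j. (if i = j then cst (of_cx (\<Lambda> i)) else 0) +
    pdo_const ((- 1) ^ parity CARD('m) i * e_series i j :: ('m, 'n) U_gl_current fls)"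
  have "B_entry \<Lambda> = (\<lambda>i j. (if i = j then pdo_partial else 0) - ?E i j)"
    by (auto simp: B_entry_def tau_def fun_eq_iff)
  moreover have "pdo_order_le (?E i j) 0" for i j
    by (simp add: pdo_order_le_add cst_def)
  ultimately show ?thesis using pdo_mat_inverse[of ?E n] by simp
qed

lemma quasi_minor_B_mat:
  assumes "i < CARD('m) + CARD('n)"
  obtains C where "mat_inverse_on (Suc i) (B_entry \<Lambda> :: _ \<Rightarrow> _ \<Rightarrow> ('m, 'n) U_gl_current fls pdo) C"
    "quasi_minor (B_mat \<Lambda> :: ('m, 'n) U_gl_current fls pdo mat) (Suc i) = ring_inv (C i i)"
    "two_sided_unit (C i i)" "pdo_order_le (C i i) (- 1)" "pdo_order_le (ring_inv (C i i)) 1"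
  using B_entry_inverse[of "Suc i" \<Lambda>, where 'm = 'm and 'n = 'n]
    quasi_minor_eq[of i "B_entry \<Lambda> :: _ \<Rightarrow> _ \<Rightarrow> ('m, 'n) U_gl_current fls pdo"] assms
  unfolding B_mat_eq by blast

lemma berezinian_eq:
  "berezinian m n A = prod_list (map (\<lambda>i. quasi_minor A (Suc i)) [0..<m]) *
    prod_list (map (\<lambda>i. ring_inv (quasi_minor A (Suc i))) [m..<m + n])"
proof -
  have "[1..<m + 1] = map Suc [0..<m]" "[m + 1..<m + n + 1] = map Suc [m..<m + n]"
    by (simp_all add: map_Suc_upt)
  then show ?thesis unfolding berezinian_def by (simp add: comp_def)
qed

lemma pdo_order_le_prod_list:
  fixes f :: "'i \<Rightarrow> 'a::derivation_ring pdo"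
  assumes "\<And>i. i \<in> set is \<Longrightarrow> pdo_order_le (f i) N"
  shows "pdo_order_le (prod_list (map f is)) (int (length is) * N)"
  using assms
proof (induction "is")
  case (Cons i "is")
  then have "pdo_order_le (f i * prod_list (map f is)) (N + int (length is) * N)"
    by (intro pdo_order_le_mult) auto
  then show ?case by (simp add: algebra_simps)
qed simp

text \<open>Even quasi-minors have order at most 1 and inverted odd ones at most - 1. Consequently
  the bound on \<open>r\<close> in \<open>bethe_gl\<close> discards only zero coefficients.\<close>

lemma pdo_order_le_Ber_B:
  "pdo_order_le (Ber_B \<Lambda> :: ('m, 'n) U_gl_current fls pdo) (int CARD('m) - int CARD('n))"
proof -
  let ?B = "B_mat \<Lambda> :: ('m, 'n) U_gl_current fls pdo mat"
  have 1: "pdo_order_le (quasi_minor ?B (Suc i)) 1" "pdo_order_le (ring_inv (quasi_minor ?B (Suc i))) (- 1)"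
    if i: "i < CARD('m) + CARD('n)" for i
  proof -
    from quasi_minor_B_mat[OF i, of \<Lambda>] obtain C where
      "quasi_minor ?B (Suc i) = ring_inv (C i i)" "two_sided_unit (C i i)" "pdo_order_le (C i i) (- 1)"
      "pdo_order_le (ring_inv (C i i)) 1"
      by metis
    then show "pdo_order_le (quasi_minor ?B (Suc i)) 1"
      "pdo_order_le (ring_inv (quasi_minor ?B (Suc i))) (- 1)" by simp_all
  qed
  have "pdo_order_le (berezinian CARD('m) CARD('n) ?B)
      (int (length [0..<CARD('m)]) * 1 + int (length [CARD('m)..<CARD('m) + CARD('n)]) * - 1)"
    unfolding berezinian_eq using 1 by (intro pdo_order_le_mult pdo_order_le_prod_list) auto
  then show ?thesis by (simp add: Ber_B_def)
qed

lemma sca_prod_list: "sca (\<Prod>i<n. \<phi> i) = prod_list (map (\<lambda>i. sca (\<phi> i)) [0..<n])"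
  by (induction n) (simp_all add: hom_one[OF hom_sca] hom_mult[OF hom_sca])

theorem bispectral_cdet_Ber:
  fixes z \<Lambda> :: "nat \<Rightarrow> complex"
  shows "bispectral
    (sca ((\<Prod>i<CARD('m). lin (\<Lambda> i)) / (\<Prod>i\<in>{CARD('m)..<CARD('m) + CARD('n)}. lin (\<Lambda> i))) *
      pdo_map (fls_map (pi_k \<Lambda> :: ('k, 0) U_gl_current \<Rightarrow> ('m, 'n, 'k) weyl)) (cdet (G_mat z)))
    (sca (\<Prod>a<CARD('k). lin (z a)) *
      pdo_map (fls_map (pi_gl z :: ('m, 'n) U_gl_current \<Rightarrow> ('m, 'n, 'k) weyl)) (Ber_B \<Lambda>))"
proof -
  let ?m = "CARD('m)" and ?N = "CARD('m) + CARD('n)" and ?k = "CARD('k)"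
  interpret W: howe_pair_units ?N ?k "\<lambda>i a. cst (wx i a :: ('m, 'n, 'k) weyl)"
    "\<lambda>i a. cst (wd i a)" "\<lambda>a. sca (lin (z a))" "\<lambda>i. tau (\<Lambda> i)" "\<lambda>i. \<not> i < ?m"
    by (rule howe_pair_weyl)
  let ?h = "pi_gl z :: ('m, 'n) U_gl_current \<Rightarrow> ('m, 'n, 'k) weyl"
  let ?H = "pdo_map (fls_map ?h)"
  note h = pi_gl_spec[where z = z and 'm = 'm and 'n = 'n and 'k = 'k]
  note hom = hom_pdo_map_fls_map[OF h(1)]
  have H_B: "?H (B_entry \<Lambda> i j) = W.B i j" if ij: "i < ?N" "j < ?N" for i j
  proof -
    have "?H (pdo_const (e_series i j)) = (\<Sum>a<?k. cst (wx i a * wd j a) * sca (1 / lin (z a)))"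
      unfolding pdo_map_fls_map_const[OF h(1)] h(2)[OF ij] cst_def sca_def
      by (simp add: hom_sum[OF unital_ring_hom_pdo_const] hom_mult[OF unital_ring_hom_pdo_const])
    also have "\<dots> = (\<Sum>a<?k. cst (wx i a) * sca (1 / lin (z a)) * cst (wd j a))"
      by (intro sum.cong refl) (simp add: hom_mult[OF hom_cst] mult.assoc sca_cst)
    finally have e: "?H (pdo_const (e_series i j)) = \<dots>" .
    have "pdo_const ((- 1) ^ parity ?m i * e_series i j :: ('m, 'n) U_gl_current fls) =
        (if i < ?m then pdo_const (e_series i j) else - pdo_const (e_series i j))"
      by (simp add: parity_def hom_uminus[OF unital_ring_hom_pdo_const])
    then have "?H (pdo_const ((- 1) ^ parity ?m i * e_series i j)) =
        (\<Sum>a<?k. W.x' i a * sca (1 / lin (z a)) * cst (wd j a))"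
      by (simp add: hom_uminus[OF hom] e W.x'_def sum_negf)
    then show ?thesis
      by (simp add: B_entry_def W.B_def hom_diff[OF hom] hom_zero[OF hom] pdo_map_fls_map_tau[OF h(1)] sca_lin_unit)
  qed
  \<comment> \<open>The inverse over the enveloping algebra maps to an inverse of the block of
    \<open>W.B\<close>, and uniqueness identifies its corner. As \<open>C i i\<close> is a unit, the
    map respects \<open>ring_inv\<close>.\<close>
  have minor: "?H (quasi_minor (B_mat \<Lambda>) (Suc i)) = W.\<delta> ?k i"
    "?H (ring_inv (quasi_minor (B_mat \<Lambda>) (Suc i))) = ring_inv (W.\<delta> ?k i)" if i: "i < ?N" for i
  proof -
    from quasi_minor_B_mat[OF i, of \<Lambda>] obtain C where
      C: "mat_inverse_on (Suc i) (B_entry \<Lambda> :: _ \<Rightarrow> _ \<Rightarrow> ('m, 'n) U_gl_current fls pdo) C"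
      "quasi_minor (B_mat \<Lambda> :: ('m, 'n) U_gl_current fls pdo mat) (Suc i) = ring_inv (C i i)" "two_sided_unit (C i i)"
      by metis
    have "mat_inverse_on (Suc i) W.B (\<lambda>p q. ?H (C p q))"
      using hom_mat_inverse_on[OF hom C(1)] i by (simp add: mat_inverse_on_def H_B)
    then have 1: "ring_inv (?H (C i i)) = W.\<delta> ?k i" by (rule W.quasi_minor_B[OF i])
    with hom_ring_inv[OF hom C(3)]
    show "?H (quasi_minor (B_mat \<Lambda>) (Suc i)) = W.\<delta> ?k i"
      "?H (ring_inv (quasi_minor (B_mat \<Lambda>) (Suc i))) = ring_inv (W.\<delta> ?k i)"
      using C(3) by (simp_all add: C(2)) (metis ring_inv_ring_inv)
  qed
  have "?H (Ber_B \<Lambda>) = prod_list (map (W.dd ?k) [0..<?m]) * prod_list (map (W.dd ?k) [?m..<?N])"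
    unfolding Ber_B_def berezinian_eq hom_mult[OF hom] hom_prod_list[OF hom] map_map comp_def
    by (intro arg_cong2[where f = "(*)"] arg_cong[where f = prod_list] map_cong refl)
      (auto simp: minor W.dd_def)
  also have "\<dots> = prod_list (map (W.dd ?k) [0..<?N])"
    by (simp add: upt_add_eq_append[of 0 ?m])
  finally have Ber: "sca (\<Prod>a<?k. lin (z a)) * ?H (Ber_B \<Lambda>) = col_det ?k W.G * W.f ?N"
    using W.prod_\<alpha>_dd by (simp add: sca_prod_list)
  \<comment> \<open>\<open>W.h\<close> commutes with the constants, so the division by
    \<open>\<tau>\<close> can precede the multiplication by the oscillators and match the fraction
    inside \<open>G_op\<close>.\<close>
  have op: "bispectral (G_op z \<Lambda> a c u) (W.op a c u')" if u: "bispectral u u'" for a c u u'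
    unfolding G_op_def W.op_def
  proof (intro bispectral_diff bispectral_sum)
    show "bispectral (u * (if a = c then tau (z a) else 0)) (if a = c then sca (lin (z a)) * u' else 0)"
      by (simp add: u bispectral_tau_lin bispectral_0)
    fix i
    have "cst (wx i a) * u' * (cst (wd i c) * W.h i) = cst (wx i a) * (u' * W.h i) * cst (wd i c)"
      by (simp add: mult.assoc W.h_comm)
    then show "bispectral (cst (wx i a) * sca (1 / lin (\<Lambda> i)) * u * cst (wd i c))
        (cst (wx i a) * u' * (cst (wd i c) * W.h i))"
      using bispectral_cst[OF bispectral_inverse[OF u]] by (simp add: W.h_def mult.assoc)
  qed
  have "bispectral (fold (\<lambda>c. G_op z \<Lambda> (\<sigma> c) c) cs u) (fold (\<lambda>c. W.op (\<sigma> c) c) cs u')"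
    if "bispectral u u'" for \<sigma> cs u u'
    using that by (induction cs arbitrary: u u') (simp_all add: op)
  then have det: "bispectral (col_det ?k (G_image z \<Lambda>)) (col_det ?k W.G)"
    unfolding col_det_G_image W.col_det_G_normal_order alt_sum_def
    by (intro bispectral_sum bispectral_of_int) (simp add: bispectral_1)
  \<comment> \<open>The prefactor is attached one factor at a time: \<open>\<phi> n\<close> on the
    left of one operator corresponds to \<open>W.dd 0 n\<close> on the right of the other, inverted
    exactly for odd \<open>n\<close>.\<close>
  define \<phi> where "\<phi> i = (if i < ?m then lin (\<Lambda> i) else 1 / lin (\<Lambda> i))" for i
  have "bispectral (sca (\<Prod>i<n. \<phi> i) * P) (P' * W.f n)"
    if "bispectral P P'" for n and P P' :: "('m, 'n, 'k) weyl fls pdo"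
  proof (induction n)
    case 0
    then show ?case using that by (simp add: W.f_def hom_one[OF hom_sca])
  next
    case (Suc n)
    have "sca (\<Prod>i<Suc n. \<phi> i) * P = sca (\<phi> n) * (sca (\<Prod>i<n. \<phi> i) * P)"
      by (simp add: hom_mult[OF hom_sca] sca_sca[of "\<phi> n"] flip: mult.assoc)
    moreover have "P' * W.f (Suc n) = P' * W.f n * W.dd 0 n" by (simp add: W.f_def mult.assoc)
    ultimately show ?case
      using bispectral_lin_tau[OF Suc] bispectral_inverse[OF Suc] by (simp add: \<phi>_def[of n] W.dd_0 W.h_def)
  qed
  from this[OF det, of ?N]
  have main: "bispectral (sca (\<Prod>i<?N. \<phi> i) * col_det ?k (G_image z \<Lambda>)) (sca (\<Prod>a<?k. lin (z a)) * ?H (Ber_B \<Lambda>))"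
    by (simp only: Ber)
  have "(\<Prod>i<?N. \<phi> i) = (\<Prod>i<?m. \<phi> i) * (\<Prod>i\<in>{?m..<?N}. \<phi> i)"
    by (subst prod.union_disjoint[symmetric]) (auto intro!: prod.cong)
  also have "\<dots> = (\<Prod>i<?m. lin (\<Lambda> i)) / (\<Prod>i\<in>{?m..<?N}. lin (\<Lambda> i))"
    by (simp add: \<phi>_def prod_dividef)
  finally show ?thesis using main by (simp only: pdo_map_cdet_G_mat)
qed

subsection \<open>The two Bethe algebras\<close>

lemma unital_subalgebra_least:
  assumes "S \<subseteq> unital_subalgebra T"
  shows "unital_subalgebra S \<subseteq> unital_subalgebra T"
proof
  fix x assume "x \<in> unital_subalgebra S"
  then show "x \<in> unital_subalgebra T"
    by induction (use assms in \<open>auto intro: unital_subalgebra.intros\<close>)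
qed

lemma unital_subalgebra_0: "0 \<in> unital_subalgebra S"
  using unital_subalgebra.scale[OF unital_subalgebra.one, where c = 0] by simp

lemma unital_subalgebra_sum:
  "(\<And>i. i \<in> I \<Longrightarrow> f i \<in> unital_subalgebra S) \<Longrightarrow> (\<Sum>i\<in>I. f i) \<in> unital_subalgebra S"
  by (induction I rule: infinite_finite_induct) (auto intro: unital_subalgebra_0 unital_subalgebra.add)

lemma image_unital_subalgebra:
  assumes h: "calg_hom h"
  shows "h ` unital_subalgebra S = unital_subalgebra (h ` S)"
proof
  show "h ` unital_subalgebra S \<subseteq> unital_subalgebra (h ` S)"
  proof
    fix y assume "y \<in> h ` unital_subalgebra S"
    then obtain x where "x \<in> unital_subalgebra S" "y = h x" by blast
    then show "y \<in> unital_subalgebra (h ` S)"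
    proof (induction arbitrary: y)
      case one
      then show ?case using h by (simp add: calg_hom_def unital_subalgebra.one)
    qed (use h in \<open>auto simp: calg_hom_def intro: unital_subalgebra.intros\<close>)
  qed
  show "unital_subalgebra (h ` S) \<subseteq> h ` unital_subalgebra S"
  proof
    fix y assume "y \<in> unital_subalgebra (h ` S)"
    then show "y \<in> h ` unital_subalgebra S"
    proof induction
      case (gen x)
      then show ?case by (auto intro: unital_subalgebra.gen)
    next
      case one
      have "h 1 = 1" using h by (simp add: calg_hom_def)
      then show ?case by (metis imageI unital_subalgebra.one)
    next
      case (add x y)
      then obtain x' y' where "x' \<in> unital_subalgebra S" "y' \<in> unital_subalgebra S" "x = h x'" "y = h y'" by blast
      moreover from this h have "x + y = h (x' + y')" by (simp add: calg_hom_def)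
      ultimately show ?case by (metis imageI unital_subalgebra.add)
    next
      case (mult x y)
      then obtain x' y' where "x' \<in> unital_subalgebra S" "y' \<in> unital_subalgebra S" "x = h x'" "y = h y'" by blast
      moreover from this h have "x * y = h (x' * y')" by (simp add: calg_hom_def)
      ultimately show ?case by (metis imageI unital_subalgebra.mult)
    next
      case (scale x c)
      then obtain x' where "x' \<in> unital_subalgebra S" "x = h x'" by blast
      moreover from this h have "c *\<^sub>C x = h (c *\<^sub>C x')" by (simp add: calg_hom_def)
      ultimately show ?case by (metis imageI unital_subalgebra.scale)
    qed
  qed
qed

definition coeffs2 :: "'a::zero fls pdo \<Rightarrow> 'a set" where "coeffs2 P = {pdo_coeff2 P r s | r s. True}"

lemma bispectral_coeffs2: "bispectral P P' \<Longrightarrow> coeffs2 P = coeffs2 P'"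
  by (auto simp: coeffs2_def bispectral_def)

text \<open>A coefficient of a product of Laurent series is a finite sum, so linear combinations
  suffice and no completion enters.\<close>

lemma coeffs2_sca_subset: "coeffs2 (sca \<phi> * P) \<subseteq> unital_subalgebra (coeffs2 P)"
proof
  fix x assume "x \<in> coeffs2 (sca \<phi> * P)"
  then obtain r s where x: "x = fls_nth (fls_map of_cx \<phi> * pdo_nth P s) (- r)"
    by (auto simp: coeffs2_def pdo_coeff2_def sca_def pdo_nth_const_mult)
  obtain A where A: "\<And>n. n < A \<Longrightarrow> fls_nth (fls_map of_cx \<phi> :: 'a fls) n = 0" using fls_bound by metis
  obtain B where B: "\<And>n. n < B \<Longrightarrow> fls_nth (pdo_nth P s) n = 0" using fls_bound by metis
  have "x = (\<Sum>i = A..- r - B. fls_nth (fls_map of_cx \<phi>) i * fls_nth (pdo_nth P s) (- r - i))"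
    unfolding x by (rule fls_times_nth_interval) (use A B in auto)
  also have "\<dots> = (\<Sum>i = A..- r - B. fls_nth \<phi> i *\<^sub>C pdo_coeff2 P (r + i) s)"
    by (intro sum.cong refl) (simp add: fls_nth_map pdo_coeff2_def of_cx_def mult_cscale_left)
  also have "\<dots> \<in> unital_subalgebra (coeffs2 P)"
    by (intro unital_subalgebra_sum unital_subalgebra.scale unital_subalgebra.gen) (auto simp: coeffs2_def)
  finally show "x \<in> unital_subalgebra (coeffs2 P)" .
qed

text \<open>Multiplication by the series \<open>1 / \<phi>\<close> gives the converse
  inclusion.\<close>

lemma unital_subalgebra_coeffs2_sca:
  assumes "\<phi> \<noteq> 0"
  shows "unital_subalgebra (coeffs2 (sca \<phi> * P)) = unital_subalgebra (coeffs2 P)"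
proof
  show "unital_subalgebra (coeffs2 (sca \<phi> * P)) \<subseteq> unital_subalgebra (coeffs2 P)"
    by (intro unital_subalgebra_least coeffs2_sca_subset)
  have "P = sca (1 / \<phi> * \<phi>) * P" using assms by (simp add: hom_one[OF hom_sca])
  also have "\<dots> = sca (1 / \<phi>) * (sca \<phi> * P)" by (simp only: hom_mult[OF hom_sca] mult.assoc)
  finally have "coeffs2 P \<subseteq> unital_subalgebra (coeffs2 (sca \<phi> * P))"
    using coeffs2_sca_subset by metis
  then show "unital_subalgebra (coeffs2 P) \<subseteq> unital_subalgebra (coeffs2 (sca \<phi> * P))"
    by (rule unital_subalgebra_least)
qed

text \<open>Zero lies in every such subalgebra, so the index ranges in the definitions of the Bethe
  algebras can be replaced by all integers.\<close>

lemma unital_subalgebra_partial_coeffs2: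
  assumes "\<And>r s. \<not> I s \<Longrightarrow> pdo_coeff2 P r s = 0"
  shows "unital_subalgebra {pdo_coeff2 P r s | r s. I s} = unital_subalgebra (coeffs2 P)"
proof
  show "unital_subalgebra {pdo_coeff2 P r s | r s. I s} \<subseteq> unital_subalgebra (coeffs2 P)"
    by (intro unital_subalgebra_least) (auto simp: coeffs2_def intro: unital_subalgebra.gen)
  have "pdo_coeff2 P r s \<in> unital_subalgebra {pdo_coeff2 P r s | r s. I s}" for r s
    using assms[of s r] by (cases "I s") (auto intro: unital_subalgebra.gen unital_subalgebra_0)
  then show "unital_subalgebra (coeffs2 P) \<subseteq> unital_subalgebra {pdo_coeff2 P r s | r s. I s}"
    by (intro unital_subalgebra_least) (auto simp: coeffs2_def)
qed

lemma pdo_coeff2_map: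
  assumes "calg_hom h"
  shows "pdo_coeff2 (pdo_map (fls_map h) P) r s = h (pdo_coeff2 P r s)"
proof -
  have 0: "h 0 = 0" "fls_map h 0 = 0"
    using calg_hom_zero[OF assms] hom_zero[OF unital_ring_hom_fls_map[OF unital_ring_hom_calg_hom[OF assms]]]
    by auto
  show ?thesis by (simp add: pdo_coeff2_def pdo_nth_map fls_nth_map 0)
qed

text \<open>In \<open>G_op\<close> only the right factor \<open>tau\<close> changes the power of the
  derivative, by 0 or 1. In normal order the degree can thus be read off without moving derivatives
  past coefficients.\<close>

lemma fold_G_op_order:
  "s < 0 \<or> s > int (length cs) \<Longrightarrow>
    pdo_nth (fold (\<lambda>c. G_op z \<Lambda> (\<sigma> c) c) cs 1 :: ('m, 'n, 'k) weyl fls pdo) s = 0"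
proof (induction cs arbitrary: s rule: rev_induct)
  case Nil
  then show ?case by auto
next
  case (snoc c cs)
  define u :: "('m, 'n, 'k) weyl fls pdo" where "u = fold (\<lambda>c. G_op z \<Lambda> (\<sigma> c) c) cs 1"
  have u: "pdo_nth u s = 0" "pdo_nth u (s - 1) = 0"
    using snoc.IH[of s] snoc.IH[of "s - 1"] snoc.prems by (auto simp: u_def)
  have "pdo_nth (\<Sum>i<n. f i) s = (\<Sum>i<n. pdo_nth (f i) s)" for n and f :: "nat \<Rightarrow> ('m, 'n, 'k) weyl fls pdo"
    by (induction n) simp_all
  then have "pdo_nth (G_op z \<Lambda> (\<sigma> c) c u) s = 0"
    by (simp add: G_op_def tau_def cst_def sca_def right_diff_distrib pdo_nth_mult_partial pdo_nth_mult_const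
        pdo_nth_const_mult u mult.assoc)
  then show ?case by (simp add: u_def)
qed

lemma pdo_coeff2_col_det_G_image:
  "\<not> (0 \<le> s \<and> s \<le> int CARD('k)) \<Longrightarrow>
    pdo_coeff2 (col_det CARD('k) (G_image z \<Lambda> :: _ \<Rightarrow> _ \<Rightarrow> ('m, 'n, 'k) weyl fls pdo)) r s = 0"
proof -
  assume s: "\<not> (0 \<le> s \<and> s \<le> int CARD('k))"
  have sum: "pdo_coeff2 (\<Sum>i\<in>I. f i) r s = (\<Sum>i\<in>I. pdo_coeff2 (f i) r s)"
    for I :: "(nat \<Rightarrow> nat) set" and f :: "_ \<Rightarrow> ('m, 'n, 'k) weyl fls pdo"
    by (induction I rule: infinite_finite_induct) simp_all
  have "pdo_coeff2 (fold (\<lambda>c. G_op z \<Lambda> (\<sigma> c) c) [0..<CARD('k)] 1 :: ('m, 'n, 'k) weyl fls pdo) r s = 0" for \<sigma>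
    using fold_G_op_order[of s "[0..<CARD('k)]" z \<Lambda> \<sigma>, where 'm = 'm and 'n = 'n and 'k = 'k] s
    by (auto simp: pdo_coeff2_def)
  then show ?thesis unfolding col_det_G_image alt_sum_def by (simp add: sum)
qed

theorem theorem5p2:
  fixes z \<Lambda> :: "nat \<Rightarrow> complex"
  assumes "CARD('m) + CARD('n) \<ge> 1" and "CARD('k) \<ge> 1"
  shows "(pi_k \<Lambda> :: ('k, 0) U_gl_current \<Rightarrow> ('m, 'n, 'k) weyl) ` bethe_k z =
      (pi_gl z :: ('m, 'n) U_gl_current \<Rightarrow> ('m, 'n, 'k) weyl) ` bethe_gl \<Lambda> \<and>
    (\<forall>b g :: int \<Rightarrow> int \<Rightarrow> ('m, 'n, 'k) weyl.
      (\<forall>r s. pdo_coeff2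
          (pdo_const (fls_map of_cx (\<Prod>a<CARD('k). fls_X_inv - fls_const (z a)))
            * pdo_map (fls_map (pi_gl z)) (Ber_B \<Lambda>)) r s =
        (if 0 \<le> r \<and> r \<le> int CARD('k) \<and> s \<le> int CARD('m) - int CARD('n) then b r s else 0)) \<longrightarrow>
      (\<forall>r s. pdo_coeff2
          (pdo_const (fls_map of_cx
              ((\<Prod>i<CARD('m). fls_X_inv - fls_const (\<Lambda> i)) /
               (\<Prod>i\<in>{CARD('m)..<CARD('m) + CARD('n)}. fls_X_inv - fls_const (\<Lambda> i))))
            * pdo_map (fls_map (pi_k \<Lambda>)) (cdet (G_mat z))) r s =
        (if r \<le> int CARD('m) - int CARD('n) \<and> 0 \<le> s \<and> s \<le> int CARD('k) then g r s else 0)) \<longrightarrow>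
      (\<forall>r s. 0 \<le> r \<and> r \<le> int CARD('k) \<and> s \<le> int CARD('m) - int CARD('n) \<longrightarrow> b r s = g s r))"
proof -
  let ?h = "pi_gl z :: ('m, 'n) U_gl_current \<Rightarrow> ('m, 'n, 'k) weyl"
  let ?h' = "pi_k \<Lambda> :: ('k, 0) U_gl_current \<Rightarrow> ('m, 'n, 'k) weyl"
  let ?\<phi> = "(\<Prod>i<CARD('m). lin (\<Lambda> i)) / (\<Prod>i\<in>{CARD('m)..<CARD('m) + CARD('n)}. lin (\<Lambda> i))"
  let ?\<psi> = "\<Prod>a<CARD('k). lin (z a)"
  let ?P = "pdo_map (fls_map ?h') (cdet (G_mat z))" and ?Q = "pdo_map (fls_map ?h) (Ber_B \<Lambda>)"
  have h: "calg_hom ?h" and h': "calg_hom ?h'" by (rule pi_gl_spec pi_k_spec)+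
  have bi: "bispectral (sca ?\<phi> * ?P) (sca ?\<psi> * ?Q)" by (rule bispectral_cdet_Ber)
  \<comment> \<open>Nonzero scalar series are invertible, so neither prefactor changes the generated
    subalgebra.\<close>
  have nz: "?\<phi> \<noteq> 0" "?\<psi> \<noteq> 0" using lin_nonzero by simp_all
  have "?h' ` bethe_k z = unital_subalgebra (?h' ` {pdo_coeff2 (cdet (G_mat z)) p s | p s. 0 \<le> s \<and> s \<le> int CARD('k)})"
    unfolding bethe_k_def by (rule image_unital_subalgebra[OF h'])
  also have "?h' ` {pdo_coeff2 (cdet (G_mat z)) p s | p s. 0 \<le> s \<and> s \<le> int CARD('k)} =
      {pdo_coeff2 ?P p s | p s. 0 \<le> s \<and> s \<le> int CARD('k)}"
    by (auto simp: pdo_coeff2_map[OF h'])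
  \<comment> \<open>The vanishing outside the range is established for the image, from the normally
    ordered determinant.\<close>
  also have "unital_subalgebra \<dots> = unital_subalgebra (coeffs2 ?P)"
    by (intro unital_subalgebra_partial_coeffs2) (simp add: pdo_map_cdet_G_mat pdo_coeff2_col_det_G_image)
  also have "\<dots> = unital_subalgebra (coeffs2 (sca ?\<phi> * ?P))"
    by (rule unital_subalgebra_coeffs2_sca[OF nz(1), symmetric])
  also have "\<dots> = unital_subalgebra (coeffs2 (sca ?\<psi> * ?Q))" by (simp only: bispectral_coeffs2[OF bi])
  also have "\<dots> = unital_subalgebra (coeffs2 ?Q)" by (rule unital_subalgebra_coeffs2_sca[OF nz(2)])
  also have "\<dots> = unital_subalgebra {pdo_coeff2 ?Q p s | p s. s \<le> int CARD('m) - int CARD('n)}"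
  proof (rule unital_subalgebra_partial_coeffs2[symmetric])
    fix r s assume "\<not> s \<le> int CARD('m) - int CARD('n)"
    then have "pdo_coeff2 (Ber_B \<Lambda> :: ('m, 'n) U_gl_current fls pdo) r s = 0"
      using pdo_order_leD[OF pdo_order_le_Ber_B[where 'm = 'm and 'n = 'n]] by (simp add: pdo_coeff2_def)
    then show "pdo_coeff2 ?Q r s = 0" by (simp add: pdo_coeff2_map[OF h] calg_hom_zero[OF h])
  qed
  also have "{pdo_coeff2 ?Q p s | p s. s \<le> int CARD('m) - int CARD('n)} =
      ?h ` {pdo_coeff2 (Ber_B \<Lambda>) p s | p s. s \<le> int CARD('m) - int CARD('n)}"
    by (auto simp: pdo_coeff2_map[OF h])
  also have "unital_subalgebra \<dots> = ?h ` bethe_gl \<Lambda>"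
    unfolding bethe_gl_def by (rule image_unital_subalgebra[OF h, symmetric])
  finally have algebras: "?h' ` bethe_k z = ?h ` bethe_gl \<Lambda>" .
  have coeffs: "pdo_coeff2 (pdo_const (fls_map of_cx ?\<psi>) * ?Q) r s =
      pdo_coeff2 (pdo_const (fls_map of_cx ?\<phi>) * ?P) s r" for r s
    using bispectralD[OF bi, of s r] by (simp only: sca_def)
  show ?thesis
  proof (intro conjI algebras allI impI, elim conjE)
    fix b g :: "int \<Rightarrow> int \<Rightarrow> ('m, 'n, 'k) weyl" and r s :: int
    assume b: "\<forall>r s. pdo_coeff2 (pdo_const (fls_map of_cx ?\<psi>) * ?Q) r s =
        (if 0 \<le> r \<and> r \<le> int CARD('k) \<and> s \<le> int CARD('m) - int CARD('n) then b r s else 0)"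
      and g: "\<forall>r s. pdo_coeff2 (pdo_const (fls_map of_cx ?\<phi>) * ?P) r s =
        (if r \<le> int CARD('m) - int CARD('n) \<and> 0 \<le> s \<and> s \<le> int CARD('k) then g r s else 0)"
      and rs: "0 \<le> r" "r \<le> int CARD('k)" "s \<le> int CARD('m) - int CARD('n)"
    have "b r s = pdo_coeff2 (pdo_const (fls_map of_cx ?\<psi>) * ?Q) r s"
      using b[rule_format, of r s] rs by simp
    also have "\<dots> = pdo_coeff2 (pdo_const (fls_map of_cx ?\<phi>) * ?P) s r" by (rule coeffs)
    also have "\<dots> = g s r" using g[rule_format, of s r] rs by simp
    finally show "b r s = g s r" .
  qed
qed

end
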